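(* Let $A_1,\dots,A_k$ be stable matching instances on the same $n$ workers and $n$ firms such that every worker has the same preference list in all of them (firms' lists are arbitrary). Then $\mathcal{L}'=\mathcal{M}_{A_1}\cap\mathcal{M}_{A_2}\cap\cdots\cap\mathcal{M}_{A_k}$ is a sublattice of each $\mathcal{L}_{A_i}$. Moreover, the worker-optimal and firm-optimal matchings of $\mathcal{L}'$ and a Birkhoff partial order generating $\mathcal{L}'$ can be found in polynomial time, and the matchings of $\mathcal{L}'$ can be enumerated with polynomial delay.
   Context: In a stable matching instance each agent strictly totally orders the agents of the other side; a perfect matching $M$ is stable under $I$ if no pair $(w,f)\notin M$ has $w$ preferring $f$ to $M(w)$ and $f$ preferring $w$ to $M(f)$ under $I$; $\mathcal{M}_I$ is the set of stable matchings of $I$ and $\mathcal{L}_I$ its lattice with join $\vee_I$ (each worker gets its less preferred partner under $I$) and meet $\wedge_I$ (more preferred). A sublattice is a subset closed under join and meet. Worker-optimal (firm-optimal) element of $\mathcal{L}'$: the one every worker (firm) weakly prefers to all others in $\mathcal{L}'$. A Birkhoff partial order generating $\mathcal{L}'$ is a finite poset whose lattice of closed (downward-closed) sets, under union and intersection, is isomorphic to $\mathcal{L}'$. *)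

theory Defs
  imports
    "HOL-Computational_Algebra.Polynomial"
    "HOL-Combinatorics.Permutations"
    "HOL-Library.Log_Nat"
begin

section \<open>Stable matchings\<close>

text \<open>Workers and firms are both numbered by \<^term>\<open>{..<n}\<close>. A strict total order on the other
  side is a preference list, most preferred agent first. The values of the two components at
  numbers \<open>\<ge> n\<close> are irrelevant.\<close>

record sm_instance =
  wpref :: "nat \<Rightarrow> nat list"
  fpref :: "nat \<Rightarrow> nat list"

definition pref_list :: "nat \<Rightarrow> nat list \<Rightarrow> bool" where
  "pref_list n l \<longleftrightarrow> distinct l \<and> set l = {..<n}"

definition valid_instance :: "nat \<Rightarrow> sm_instance \<Rightarrow> bool" where
  "valid_instance n I \<longleftrightarrow> (\<forall>a<n. pref_list n (wpref I a) \<and> pref_list n (fpref I a))"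

definition prefers :: "nat list \<Rightarrow> nat \<Rightarrow> nat \<Rightarrow> bool" where
  "prefers l x y \<longleftrightarrow> (\<exists>i j. i < j \<and> j < length l \<and> l ! i = x \<and> l ! j = y)"

definition weakly_prefers :: "nat list \<Rightarrow> nat \<Rightarrow> nat \<Rightarrow> bool" where
  "weakly_prefers l x y \<longleftrightarrow> x = y \<or> prefers l x y"

text \<open>A perfect matching is a permutation \<open>M\<close> of \<^term>\<open>{..<n}\<close> mapping each worker to its firm;
  the worker matched to firm \<open>f\<close> is \<open>inv M f\<close>. Since \<^const>\<open>permutes\<close> makes \<open>M\<close> the identity
  outside \<^term>\<open>{..<n}\<close>, equality of functions is equality of matchings.\<close>

definition stable :: "nat \<Rightarrow> sm_instance \<Rightarrow> (nat \<Rightarrow> nat) \<Rightarrow> bool" where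
  "stable n I M \<longleftrightarrow> M permutes {..<n} \<and>
     \<not> (\<exists>w<n. \<exists>f<n. M w \<noteq> f \<and> prefers (wpref I w) f (M w) \<and> prefers (fpref I f) w (inv M f))"

definition stable_matchings :: "nat \<Rightarrow> sm_instance \<Rightarrow> (nat \<Rightarrow> nat) set" where
  "stable_matchings n I = {M. stable n I M}"

text \<open>Join: every worker gets its less preferred partner; meet: its more preferred one. For
  \<open>w \<ge> n\<close> both branches return \<open>w\<close> when \<open>M\<close> and \<open>M'\<close> are matchings.\<close>

definition join :: "sm_instance \<Rightarrow> (nat \<Rightarrow> nat) \<Rightarrow> (nat \<Rightarrow> nat) \<Rightarrow> nat \<Rightarrow> nat" where
  "join I M M' = (\<lambda>w. if prefers (wpref I w) (M w) (M' w) then M' w else M w)"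

definition meet :: "sm_instance \<Rightarrow> (nat \<Rightarrow> nat) \<Rightarrow> (nat \<Rightarrow> nat) \<Rightarrow> nat \<Rightarrow> nat" where
  "meet I M M' = (\<lambda>w. if prefers (wpref I w) (M w) (M' w) then M w else M' w)"

definition sublattice :: "nat \<Rightarrow> sm_instance \<Rightarrow> (nat \<Rightarrow> nat) set \<Rightarrow> bool" where
  "sublattice n I L \<longleftrightarrow> L \<subseteq> stable_matchings n I \<and>
     (\<forall>M\<in>L. \<forall>M'\<in>L. join I M M' \<in> L \<and> meet I M M' \<in> L)"

definition worker_optimal :: "nat \<Rightarrow> sm_instance \<Rightarrow> (nat \<Rightarrow> nat) set \<Rightarrow> (nat \<Rightarrow> nat) \<Rightarrow> bool" where
  "worker_optimal n I L M \<longleftrightarrow> M \<in> L \<and>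
     (\<forall>M'\<in>L. \<forall>w<n. weakly_prefers (wpref I w) (M w) (M' w))"

definition firm_optimal :: "nat \<Rightarrow> sm_instance \<Rightarrow> (nat \<Rightarrow> nat) set \<Rightarrow> (nat \<Rightarrow> nat) \<Rightarrow> bool" where
  "firm_optimal n I L M \<longleftrightarrow> M \<in> L \<and>
     (\<forall>M'\<in>L. \<forall>f<n. weakly_prefers (fpref I f) (inv M f) (inv M' f))"

definition closed_sets :: "'a set \<Rightarrow> 'a rel \<Rightarrow> 'a set set" where
  "closed_sets P R = {S. S \<subseteq> P \<and> (\<forall>x\<in>S. \<forall>y\<in>P. (y, x) \<in> R \<longrightarrow> y \<in> S)}"

definition birkhoff_order ::
  "'a set \<Rightarrow> 'a rel \<Rightarrow> sm_instance \<Rightarrow> (nat \<Rightarrow> nat) set \<Rightarrow> bool" where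
  "birkhoff_order P R I L \<longleftrightarrow> finite P \<and> partial_order_on P R \<and>
     (\<exists>h. bij_betw h (closed_sets P R) L \<and>
          (\<forall>S\<in>closed_sets P R. \<forall>T\<in>closed_sets P R.
             h (S \<union> T) = join I (h S) (h T) \<and> h (S \<inter> T) = meet I (h S) (h T)))"

text \<open>A problem input is a pair of \<open>n\<close> and the list of instances \<open>A\<^sub>1, \<dots>, A\<^sub>k\<close>.\<close>

definition same_workers_inputs :: "(nat \<times> sm_instance list) set" where
  "same_workers_inputs = {(n, As). As \<noteq> [] \<and> (\<forall>A\<in>set As. valid_instance n A) \<and>
     (\<forall>A\<in>set As. \<forall>B\<in>set As. \<forall>w<n. wpref A w = wpref B w)}"

definition common_stable :: "nat \<Rightarrow> sm_instance list \<Rightarrow> (nat \<Rightarrow> nat) set" where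
  "common_stable n As = (\<Inter>A\<in>set As. stable_matchings n A)"

section \<open>A machine model\<close>

text \<open>While programs over a random access memory of natural numbers, organised as arrays
  addressed by an array number and an index (scalars are cells of arrays). Every executed
  operation is charged one unit. The only arithmetic operations are addition and truncated
  subtraction, so the bit length of every value produced is at most linear in the running time
  plus the bit lengths of the input and of the program's constants; hence running time in this model and on a multitape
  Turing machine are polynomially related.

  \<open>Emit a e\<close> outputs one complete item, namely the first \<open>e\<close> cells of array \<open>a\<close>; it is charged
  the length of the item as well. The state records each item with the time of its completion.\<close>

datatype exp = Const nat | Cell nat exp | Plus exp exp | Minus exp exp

datatype com =
    Skip
  | Store nat exp exp
  | Emit nat exp
  | Seq com com
  | Cond exp com com
  | While exp com

record machine_state =
  mem :: "nat \<Rightarrow> nat \<Rightarrow> nat"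
  clock :: nat
  emitted :: "(nat \<times> nat list) list"

fun val :: "exp \<Rightarrow> (nat \<Rightarrow> nat \<Rightarrow> nat) \<Rightarrow> nat" where
  "val (Const c) m = c"
| "val (Cell a e) m = m a (val e m)"
| "val (Plus e1 e2) m = val e1 m + val e2 m"
| "val (Minus e1 e2) m = val e1 m - val e2 m"

fun cost :: "exp \<Rightarrow> nat" where
  "cost (Const c) = 1"
| "cost (Cell a e) = 1 + cost e"
| "cost (Plus e1 e2) = 1 + cost e1 + cost e2"
| "cost (Minus e1 e2) = 1 + cost e1 + cost e2"

definition tick :: "nat \<Rightarrow> machine_state \<Rightarrow> machine_state" where
  "tick t s = s\<lparr>clock := clock s + t\<rparr>"

definition store :: "nat \<Rightarrow> nat \<Rightarrow> nat \<Rightarrow> machine_state \<Rightarrow> machine_state" where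
  "store a i v s = s\<lparr>mem := (mem s)(a := (mem s a)(i := v))\<rparr>"

definition emit :: "nat list \<Rightarrow> machine_state \<Rightarrow> machine_state" where
  "emit xs s = s\<lparr>emitted := emitted s @ [(clock s, xs)]\<rparr>"

text \<open>\<open>exec c s s'\<close>: started in state \<open>s\<close>, program \<open>c\<close> terminates in state \<open>s'\<close>.\<close>

inductive exec :: "com \<Rightarrow> machine_state \<Rightarrow> machine_state \<Rightarrow> bool" where
  Skip: "exec Skip s (tick 1 s)"
| Store: "exec (Store a i e) s
     (tick (1 + cost i + cost e) (store a (val i (mem s)) (val e (mem s)) s))"
| Emit: "exec (Emit a e) s
     (emit (map (mem s a) [0..<val e (mem s)]) (tick (1 + cost e + val e (mem s)) s))"
| Seq: "exec c1 s s1 \<Longrightarrow> exec c2 s1 s2 \<Longrightarrow> exec (Seq c1 c2) s s2"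
| CondTrue: "val e (mem s) \<noteq> 0 \<Longrightarrow> exec c1 (tick (1 + cost e) s) s1 \<Longrightarrow> exec (Cond e c1 c2) s s1"
| CondFalse: "val e (mem s) = 0 \<Longrightarrow> exec c2 (tick (1 + cost e) s) s1 \<Longrightarrow> exec (Cond e c1 c2) s s1"
| WhileFalse: "val e (mem s) = 0 \<Longrightarrow> exec (While e c) s (tick (1 + cost e) s)"
| WhileTrue: "val e (mem s) \<noteq> 0 \<Longrightarrow> exec c (tick (1 + cost e) s) s1 \<Longrightarrow>
     exec (While e c) s1 s2 \<Longrightarrow> exec (While e c) s s2"

inductive_cases exec_elims:
  "exec Skip s t" "exec (Store a i e) s t" "exec (Emit a e) s t" "exec (Seq c1 c2) s t"
  "exec (Cond e c1 c2) s t" "exec (While e c) s t"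

lemma exec_deterministic: "exec c s t \<Longrightarrow> exec c s t' \<Longrightarrow> t' = t"
proof (induction arbitrary: t' rule: exec.induct)
  case Skip
  then show ?case by (auto elim: exec_elims(1))
next
  case Store
  then show ?case by (auto elim: exec_elims(2))
next
  case Emit
  then show ?case by (auto elim: exec_elims(3))
next
  case (Seq c1 s s1 c2 s2)
  from Seq.prems obtain s1' where 1: "exec c1 s s1'" and 2: "exec c2 s1' t'"
    by (rule exec_elims(4))
  from Seq.IH(1)[OF 1] 2 have "exec c2 s1 t'" by (rule subst)
  then show ?case by (rule Seq.IH(2))
next
  case (CondTrue e s c1 s1 c2)
  from CondTrue.prems CondTrue.hyps(1) have "exec c1 (tick (1 + cost e) s) t'"
    by (auto elim: exec_elims(5))
  then show ?case by (rule CondTrue.IH)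
next
  case (CondFalse e s c2 s1 c1)
  from CondFalse.prems CondFalse.hyps(1) have "exec c2 (tick (1 + cost e) s) t'"
    by (auto elim: exec_elims(5))
  then show ?case by (rule CondFalse.IH)
next
  case (WhileFalse e s c)
  from WhileFalse.prems show ?case
    by (rule exec_elims(6)) (use WhileFalse.hyps in simp_all)
next
  case (WhileTrue e s c s1 s2)
  from WhileTrue.prems obtain s1'
    where 1: "exec c (tick (1 + cost e) s) s1'" and 2: "exec (While e c) s1' t'"
    by (rule exec_elims(6)) (use WhileTrue.hyps(1) in simp_all)
  from WhileTrue.IH(1)[OF 1] 2 have "exec (While e c) s1 t'" by (rule subst)
  then show ?case by (rule WhileTrue.IH(2))
qed

definition initial_state :: "nat list \<Rightarrow> machine_state" where
  "initial_state xs =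
     \<lparr>mem = (\<lambda>a i. if a = 0 \<and> i < length xs then xs ! i else 0), clock = 0, emitted = []\<rparr>"

text \<open>\<open>runs c xs os t\<close>: on input \<open>xs\<close>, program \<open>c\<close> emits exactly the timed items \<open>os\<close> and halts
  at time \<open>t\<close>.\<close>

definition runs :: "com \<Rightarrow> nat list \<Rightarrow> (nat \<times> nat list) list \<Rightarrow> nat \<Rightarrow> bool" where
  "runs c xs os t \<longleftrightarrow> (\<exists>s. exec c (initial_state xs) s \<and> emitted s = os \<and> clock s = t)"

text \<open>Bit length of an input, with one extra unit per number as a separator.\<close>

definition input_size :: "nat list \<Rightarrow> nat" where
  "input_size xs = (\<Sum>x\<leftarrow>xs. floorlog 2 x + 1)"

text \<open>The search problem \<open>R\<close> (which outputs are correct for which input) on inputs from \<open>D\<close>,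
  presented to the machine by \<open>enc\<close>, is solvable in polynomial time.\<close>

definition solvable_in_poly_time ::
  "('x \<Rightarrow> nat list) \<Rightarrow> 'x set \<Rightarrow> ('x \<Rightarrow> nat list \<Rightarrow> bool) \<Rightarrow> bool" where
  "solvable_in_poly_time enc D R \<longleftrightarrow>
     (\<exists>c. \<exists>p :: nat poly. \<forall>x\<in>D. \<exists>y t' t.
        runs c (enc x) [(t', y)] t \<and> t \<le> poly p (input_size (enc x)) \<and> R x y)"

text \<open>Enumeration of a set \<open>E x\<close> of items, each exactly once and in any order. The time before
  the first item, between two consecutive items, and from the last item to halting is bounded
  by a polynomial in the input size.\<close>

definition enumerable_with_poly_delay ::
  "('x \<Rightarrow> nat list) \<Rightarrow> 'x set \<Rightarrow> ('x \<Rightarrow> nat list set) \<Rightarrow> bool" where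
  "enumerable_with_poly_delay enc D E \<longleftrightarrow>
     (\<exists>c. \<exists>p :: nat poly. \<forall>x\<in>D. \<exists>os t.
        runs c (enc x) os t \<and> distinct (map snd os) \<and> set (map snd os) = E x \<and>
        (let ts = 0 # map fst os @ [t] in
           \<forall>i. Suc i < length ts \<longrightarrow> ts ! Suc i \<le> ts ! i + poly p (input_size (enc x))))"

section \<open>Encodings\<close>

definition enc_instance :: "nat \<Rightarrow> sm_instance \<Rightarrow> nat list" where
  "enc_instance n I = concat (map (wpref I) [0..<n]) @ concat (map (fpref I) [0..<n])"

definition enc_input :: "nat \<times> sm_instance list \<Rightarrow> nat list" where
  "enc_input = (\<lambda>(n, As). n # length As # concat (map (enc_instance n) As))"

definition enc_matching :: "nat \<Rightarrow> (nat \<Rightarrow> nat) \<Rightarrow> nat list" where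
  "enc_matching n M = map M [0..<n]"

text \<open>A poset on \<^term>\<open>{..<m}\<close> is written as \<open>m\<close> followed by its row-major order matrix.\<close>

definition enc_poset :: "nat \<Rightarrow> nat rel \<Rightarrow> nat list" where
  "enc_poset m R = m # map (\<lambda>ij. of_bool (ij \<in> R)) (List.product [0..<m] [0..<m])"

text \<open>If there is no common stable matching, then no optimal matching exists, and no Birkhoff
  order either, because the lattice of closed sets of a poset is nonempty. In this case the
  correct output is \<open>[0]\<close>; otherwise it is \<open>1\<close> followed by the encoding of a solution.\<close>

definition worker_optimal_output :: "nat \<times> sm_instance list \<Rightarrow> nat list \<Rightarrow> bool" where
  "worker_optimal_output = (\<lambda>(n, As) y. let L = common_stable n As in
     if L = {} then y = [0]
     else \<exists>M. (\<forall>A\<in>set As. worker_optimal n A L M) \<and> y = 1 # enc_matching n M)"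

definition firm_optimal_output :: "nat \<times> sm_instance list \<Rightarrow> nat list \<Rightarrow> bool" where
  "firm_optimal_output = (\<lambda>(n, As) y. let L = common_stable n As in
     if L = {} then y = [0]
     else \<exists>M. (\<forall>A\<in>set As. firm_optimal n A L M) \<and> y = 1 # enc_matching n M)"

definition birkhoff_order_output :: "nat \<times> sm_instance list \<Rightarrow> nat list \<Rightarrow> bool" where
  "birkhoff_order_output = (\<lambda>(n, As) y. let L = common_stable n As in
     if L = {} then y = [0]
     else \<exists>m R. (\<forall>A\<in>set As. birkhoff_order {..<m} R A L) \<and> y = 1 # enc_poset m R)"

end

theory Submission
  imports Defs
begin

text \<open>Since the workers' lists agree, join and meet do not depend on the instance, and a common
  stable matching can be written as the vector of the positions of the partners in the workers'
  lists; the common stable matchings become a set of vectors closed under pointwise maximum and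
  minimum. Pointer advancing in the style of deferred acceptance finds, for any start vector, the
  least common stable vector above it, or detects that there is none: a worker's pointer advances
  when the firm it points at would, in some instance, block with another worker who does not do
  better.

  All four algorithms only use this operation. The worker-optimal matching is the least vector
  above zero. The firm-optimal one is reached by repeatedly raising a single coordinate of the
  current vector. The join-irreducible elements are the least vectors having coordinate \<open>w\<close> at
  least \<open>j\<close>, apart from the bottom. The lexicographic successor of \<open>q\<close> is the least vector above
  \<open>(q\<^sub>0, \<dots>, q\<^sub>i + 1, 0, \<dots>, 0)\<close> that agrees with \<open>q\<close> before \<open>i\<close>, for the largest possible \<open>i\<close>.\<close>

section \<open>Loop programs\<close>

text \<open>The advancing test looks at the whole initial segment of the other worker's list up to
  its pointer, not only at current proposals. No record of rejections is needed, the start vector is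
  free, and a vector without violations is already an injective assignment unblocked in every
  instance. A pointer stops at \<open>n\<close>, which signals failure, so at most
  \<open>n * n\<close> advances occur. Closure under infimum gives a least vector above a given one
  whenever anything lies above it. Closure under supremum makes single-coordinate raises sufficient:
  a maximal vector is greatest. As \<open>q\<close> is the supremum of the least vectors with
  coordinate \<open>w\<close> at least \<open>q w\<close>, the \<open>n * n\<close> pairs yield all
  join-irreducible elements. A vector that first exceeds \<open>q\<close> at \<open>i\<close>
  dominates the bumped vector, so one test per \<open>i\<close> settles the next item without
  backtracking. Except for the outer enumeration loop, only counted loops with bounds at most the
  input size occur, so running times are read off the syntax. The machine cannot multiply; multiples
  of \<open>n\<close> are tabulated.\<close>

type_synonym memory = "nat \<Rightarrow> nat \<Rightarrow> nat"

definition upd :: "nat \<Rightarrow> nat \<Rightarrow> nat \<Rightarrow> memory \<Rightarrow> memory" where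
  "upd a i x m = m(a := (m a)(i := x))"

lemma upd_apply:
  "upd a i x m a = (m a)(i := x)" "b \<noteq> a \<Longrightarrow> upd a i x m b = m b"
  by (simp_all add: upd_def)

text \<open>The loop \<open>For v b c\<close> runs \<open>c\<close> with the scalar \<open>v\<close> counting from 0 up to the value of the
  scalar \<open>b\<close>, so a program whose body leaves \<open>b\<close> and \<open>v\<close> alone always terminates and its effect
  is a function of the memory. A scalar is cell 0 of its own array.\<close>

datatype fcom =
    FSkip
  | Asg nat exp exp
  | FSeq fcom fcom (infixr \<open>;;\<close> 60)
  | FIf exp fcom fcom
  | For nat nat fcom

abbreviation Var :: "nat \<Rightarrow> exp" where
  "Var v \<equiv> Cell v (Const 0)"

fun compile :: "fcom \<Rightarrow> com" where
  "compile FSkip = Skip"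
| "compile (Asg a i e) = Store a i e"
| "compile (c ;; d) = Seq (compile c) (compile d)"
| "compile (FIf e c d) = Cond e (compile c) (compile d)"
| "compile (For v b c) = Seq (Store v (Const 0) (Const 0))
     (While (Minus (Var b) (Var v)) (Seq (compile c) (Store v (Const 0) (Plus (Var v) (Const 1)))))"

text \<open>A loop bound is read once on entry, whereas the compiled \<open>While\<close> rereads it
  in every round; the side conditions of \<open>exec_compile\<close> make the two agree.\<close>

fun sem :: "fcom \<Rightarrow> memory \<Rightarrow> memory" where
  "sem FSkip m = m"
| "sem (Asg a i e) m = upd a (val i m) (val e m) m"
| "sem (c ;; d) m = sem d (sem c m)"
| "sem (FIf e c d) m = (if val e m \<noteq> 0 then sem c m else sem d m)"
| "sem (For v b c) m = fold (\<lambda>i m. upd v 0 (Suc i) (sem c m)) [0..<m b 0] (upd v 0 0 m)"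

fun mods :: "fcom \<Rightarrow> nat set" where
  "mods FSkip = {}"
| "mods (Asg a i e) = {a}"
| "mods (c ;; d) = mods c \<union> mods d"
| "mods (FIf e c d) = mods c \<union> mods d"
| "mods (For v b c) = insert v (mods c)"

fun bounds :: "fcom \<Rightarrow> nat set" where
  "bounds FSkip = {}"
| "bounds (Asg a i e) = {}"
| "bounds (c ;; d) = bounds c \<union> bounds d"
| "bounds (FIf e c d) = bounds c \<union> bounds d"
| "bounds (For v b c) = insert b (bounds c)"

fun counters_safe :: "fcom \<Rightarrow> bool" where
  "counters_safe FSkip = True"
| "counters_safe (Asg a i e) = True"
| "counters_safe (c ;; d) = (counters_safe c \<and> counters_safe d)"
| "counters_safe (FIf e c d) = (counters_safe c \<and> counters_safe d)"
| "counters_safe (For v b c) = (v \<notin> mods c \<and> counters_safe c)"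

text \<open>A bound on the running time when every loop bound is at most \<open>N\<close>; being defined by recursion
  on the program, it is a polynomial in \<open>N\<close> for each fixed program.\<close>

fun time_bound :: "nat \<Rightarrow> fcom \<Rightarrow> nat" where
  "time_bound N FSkip = 1"
| "time_bound N (Asg a i e) = 1 + cost i + cost e"
| "time_bound N (c ;; d) = time_bound N c + time_bound N d"
| "time_bound N (FIf e c d) = 1 + cost e + time_bound N c + time_bound N d"
| "time_bound N (For v b c) = N * (12 + time_bound N c) + 9"

lemma time_bound_poly: "\<exists>p :: nat poly. \<forall>N. time_bound N c = poly p N"
proof (induction c)
  case FSkip
  have "\<forall>N. time_bound N FSkip = poly [:1:] N" by simp
  then show ?case by blast
next
  case (Asg a i e)
  have "\<forall>N. time_bound N (Asg a i e) = poly [:1 + cost i + cost e:] N" by simp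
  then show ?case by blast
next
  case (FSeq c d)
  then obtain p q :: "nat poly" where
    "\<forall>N. time_bound N c = poly p N" "\<forall>N. time_bound N d = poly q N" by blast
  then have "\<forall>N. time_bound N (c ;; d) = poly (p + q) N" by simp
  then show ?case by blast
next
  case (FIf e c d)
  then obtain p q :: "nat poly" where
    "\<forall>N. time_bound N c = poly p N" "\<forall>N. time_bound N d = poly q N" by blast
  then have "\<forall>N. time_bound N (FIf e c d) = poly ([:1 + cost e:] + p + q) N" by simp
  then show ?case by blast
next
  case (For v b c)
  then obtain p :: "nat poly" where "\<forall>N. time_bound N c = poly p N" by blast
  then have "\<forall>N. time_bound N (For v b c) = poly ([:0, 1:] * ([:12:] + p) + [:9:]) N" by simp
  then show ?case by blast
qed

lemma sem_frame: "a \<notin> mods c \<Longrightarrow> sem c m a = m a"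
proof (induction c arbitrary: m)
  case (For v b c)
  have "fold (\<lambda>i m. upd v 0 (Suc i) (sem c m)) xs m' a = m' a" for xs m'
    using For by (induction xs arbitrary: m') (auto simp: upd_apply)
  then show ?case using For.prems by (simp add: upd_apply)
qed (auto simp: upd_apply)

text \<open>That no bound is modified anywhere in the program keeps all loop bounds at their initial
  values, so bounding them in the start memory suffices, also for inner loops.\<close>

lemma exec_compile:
  assumes "counters_safe c" "bounds c \<inter> mods c = {}" "\<forall>b\<in>bounds c. mem s b 0 \<le> N"
  shows "\<exists>t\<le>time_bound N c.
    exec (compile c) s (s\<lparr>mem := sem c (mem s), clock := clock s + t\<rparr>)"
  using assms
proof (induction c arbitrary: s)
  case FSkip
  have "exec Skip s (tick 1 s)" by (rule exec.Skip)
  then show ?case by (auto simp: tick_def intro!: exI[of _ 1])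
next
  case (Asg a i e)
  have "exec (Store a i e) s
     (tick (1 + cost i + cost e) (store a (val i (mem s)) (val e (mem s)) s))" by (rule exec.Store)
  moreover have "store a (val i (mem s)) (val e (mem s)) s = s\<lparr>mem := sem (Asg a i e) (mem s)\<rparr>"
    by (simp add: store_def upd_def)
  ultimately show ?case
    by (intro exI[of _ "1 + cost i + cost e"]) (simp add: tick_def)
next
  case (FSeq c d)
  have "\<forall>b\<in>bounds c. mem s b 0 \<le> N" "bounds c \<inter> mods c = {}" "counters_safe c"
    using FSeq.prems by auto
  from FSeq.IH(1)[OF this(3,2,1)] obtain t1 where t1: "t1 \<le> time_bound N c"
    and e1: "exec (compile c) s (s\<lparr>mem := sem c (mem s), clock := clock s + t1\<rparr>)" (is "exec _ _ ?s1")
    by blast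
  have "\<forall>b\<in>bounds d. mem ?s1 b 0 \<le> N"
    using FSeq.prems by (auto simp: sem_frame disjoint_iff)
  moreover have "bounds d \<inter> mods d = {}" "counters_safe d"
    using FSeq.prems by auto
  ultimately obtain t2 where t2: "t2 \<le> time_bound N d"
    and e2: "exec (compile d) ?s1 (?s1\<lparr>mem := sem d (mem ?s1), clock := clock ?s1 + t2\<rparr>)"
    using FSeq.IH(2)[of ?s1] by blast
  from exec.Seq[OF e1 e2] t1 t2 show ?case
    by (auto intro!: exI[of _ "t1 + t2"] simp: add.assoc)
next
  case (FIf e c d)
  let ?s1 = "tick (1 + cost e) s"
  show ?case
  proof (cases "val e (mem s) = 0")
    case True
    have "\<exists>t\<le>time_bound N d. exec (compile d) ?s1 (?s1\<lparr>mem := sem d (mem ?s1), clock := clock ?s1 + t\<rparr>)"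
      using FIf.prems by (intro FIf.IH(2)) (auto simp: tick_def)
    then obtain t where t: "t \<le> time_bound N d"
      and e: "exec (compile d) ?s1 (?s1\<lparr>mem := sem d (mem ?s1), clock := clock ?s1 + t\<rparr>)" by blast
    from exec.CondFalse[OF True e, of "compile c"] True t show ?thesis
      by (auto intro!: exI[of _ "1 + cost e + t"] simp: tick_def add.assoc)
  next
    case False
    have "\<exists>t\<le>time_bound N c. exec (compile c) ?s1 (?s1\<lparr>mem := sem c (mem ?s1), clock := clock ?s1 + t\<rparr>)"
      using FIf.prems by (intro FIf.IH(1)) (auto simp: tick_def)
    then obtain t where t: "t \<le> time_bound N c"
      and e: "exec (compile c) ?s1 (?s1\<lparr>mem := sem c (mem ?s1), clock := clock ?s1 + t\<rparr>)" by blast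
    from exec.CondTrue[OF False e, of "compile d"] False t show ?thesis
      by (auto intro!: exI[of _ "1 + cost e + t"] simp: tick_def add.assoc)
  qed
next
  case (For v b c)
  let ?g = "Minus (Var b) (Var v)"
  let ?inc = "Store v (Const 0) (Plus (Var v) (Const 1))"
  let ?W = "While ?g (Seq (compile c) ?inc)"
  let ?F = "\<lambda>i m. upd v 0 (Suc i) (sem c m)"
  have vc: "v \<notin> mods c" "b \<noteq> v" "b \<notin> mods c" "counters_safe c" "bounds c \<inter> mods c = {}" "v \<notin> bounds c"
    using For.prems by auto
  \<comment> \<open>A round costs 6 for the guard and 6 for the increment besides the body; the
    last, failing guard costs 6. With 3 for the initial store this gives the 12 and the 9 of
    \<open>time_bound\<close>.\<close>
  have loop: "\<exists>t\<le>d * (12 + time_bound N c) + 6.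
      exec ?W s (s\<lparr>mem := fold ?F [i..<B] (mem s), clock := clock s + t\<rparr>)"
    if "mem s v 0 = i" "mem s b 0 = B" "i + d = B" "\<forall>b\<in>bounds c. mem s b 0 \<le> N" for s i d B
    using that
  proof (induction d arbitrary: s i)
    case 0
    have "exec ?W s (tick (1 + cost ?g) s)"
      using 0 by (intro exec.WhileFalse) simp
    then show ?case using 0 by (auto simp: tick_def eval_nat_numeral intro!: exI[of _ 6])
  next
    case (Suc d)
    let ?s1 = "tick (1 + cost ?g) s"
    have "\<exists>t\<le>time_bound N c. exec (compile c) ?s1 (?s1\<lparr>mem := sem c (mem ?s1), clock := clock ?s1 + t\<rparr>)"
      using Suc.prems vc by (intro For.IH) (auto simp: tick_def)
    then obtain t1 where t1: "t1 \<le> time_bound N c"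
      and e1: "exec (compile c) ?s1 (?s1\<lparr>mem := sem c (mem ?s1), clock := clock ?s1 + t1\<rparr>)"
      (is "exec _ _ ?s2") by blast
    let ?s3 = "s\<lparr>mem := ?F i (mem s), clock := clock s + t1 + 12\<rparr>"
    have "exec ?inc ?s2 (tick (1 + cost (Const 0) + cost (Plus (Var v) (Const 1)))
        (store v (val (Const 0) (mem ?s2)) (val (Plus (Var v) (Const 1)) (mem ?s2)) ?s2))"
      by (rule exec.Store)
    also have "(tick (1 + cost (Const 0) + cost (Plus (Var v) (Const 1)))
        (store v (val (Const 0) (mem ?s2)) (val (Plus (Var v) (Const 1)) (mem ?s2)) ?s2)) = ?s3"
      using Suc.prems(1) vc(1) by (simp add: tick_def store_def upd_def sem_frame)
    finally have e2: "exec (Seq (compile c) ?inc) ?s1 ?s3" by (rule exec.Seq[OF e1])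
    have fr: "mem ?s3 b' 0 = mem s b' 0" if "b' \<in> bounds c \<or> b' = b" for b'
    proof -
      have "b' \<noteq> v" "b' \<notin> mods c" using that vc by auto
      then show ?thesis by (simp add: upd_apply sem_frame)
    qed
    have "\<exists>t\<le>d * (12 + time_bound N c) + 6.
      exec ?W ?s3 (?s3\<lparr>mem := fold ?F [Suc i..<B] (mem ?s3), clock := clock ?s3 + t\<rparr>)"
      using Suc.prems fr by (intro Suc.IH) (simp_all add: upd_apply)
    then obtain t2 where t2: "t2 \<le> d * (12 + time_bound N c) + 6"
      and e3: "exec ?W ?s3 (?s3\<lparr>mem := fold ?F [Suc i..<B] (mem ?s3), clock := clock ?s3 + t2\<rparr>)"
      by blast
    have "val ?g (mem s) \<noteq> 0" using Suc.prems by simp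
    from exec.WhileTrue[OF this e2 e3] t1 t2 Suc.prems show ?case
      by (auto intro!: exI[of _ "t1 + 12 + t2"] simp: add.assoc upt_conv_Cons)
  qed
  let ?s1 = "s\<lparr>mem := upd v 0 0 (mem s), clock := clock s + 3\<rparr>"
  have e1: "exec (Store v (Const 0) (Const 0)) s ?s1"
    using exec.Store[of v "Const 0" "Const 0" s] by (simp add: tick_def store_def upd_def eval_nat_numeral)
  have "\<exists>t\<le>mem s b 0 * (12 + time_bound N c) + 6. exec ?W ?s1
      (?s1\<lparr>mem := fold ?F [0..<mem s b 0] (mem ?s1), clock := clock ?s1 + t\<rparr>)"
  proof (intro loop ballI)
    fix b' assume "b' \<in> bounds c"
    then have "b' \<noteq> v" using vc(6) by auto
    then show "mem ?s1 b' 0 \<le> N" using \<open>b' \<in> bounds c\<close> For.prems(3) by (simp add: upd_apply)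
  qed (use vc in \<open>simp_all add: upd_apply\<close>)
  then obtain t where t: "t \<le> mem s b 0 * (12 + time_bound N c) + 6" and e2: "exec ?W ?s1
      (?s1\<lparr>mem := fold ?F [0..<mem s b 0] (mem ?s1), clock := clock ?s1 + t\<rparr>)" by blast
  have "mem s b 0 * (12 + time_bound N c) \<le> N * (12 + time_bound N c)"
    using For.prems(3) by (intro mult_right_mono) auto
  with t have "3 + t \<le> time_bound N (For v b c)" unfolding time_bound.simps by linarith
  with exec.Seq[OF e1 e2] show ?case
    by (intro exI[of _ "3 + t"]) (simp add: add.assoc)
qed

text \<open>The step is handed the counter value and the frame facts, so that invariants only need
  to describe what the body changes.\<close>

lemma sem_For_induct:
  assumes "v \<notin> mods c" "b \<noteq> v"
    and base: "I 0 (upd v 0 0 m)"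
    and step: "\<And>i m'. i < m b 0 \<Longrightarrow> I i m' \<Longrightarrow> m' v 0 = i \<Longrightarrow>
      (\<And>a. a \<notin> insert v (mods c) \<Longrightarrow> m' a = m a) \<Longrightarrow> I (Suc i) (upd v 0 (Suc i) (sem c m'))"
  shows "I (m b 0) (sem (For v b c) m)"
proof -
  define F where "F i = fold (\<lambda>i m. upd v 0 (Suc i) (sem c m)) [0..<i] (upd v 0 0 m)" for i
  have "I i (F i) \<and> F i v 0 = i \<and> (\<forall>a. a \<notin> insert v (mods c) \<longrightarrow> F i a = m a)" if "i \<le> m b 0" for i
    using that
  proof (induction i)
    case 0
    then show ?case using base by (simp add: F_def upd_apply)
  next
    case (Suc i)
    then have IH: "I i (F i)" "F i v 0 = i" "\<And>a. a \<notin> insert v (mods c) \<Longrightarrow> F i a = m a" by auto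
    have eq: "F (Suc i) = upd v 0 (Suc i) (sem c (F i))" by (simp add: F_def)
    show ?case using step[OF _ IH] Suc.prems IH(3) unfolding eq
      by (auto simp: upd_apply sem_frame)
  qed
  from this[of "m b 0"] show ?thesis by (simp add: F_def)
qed

text \<open>The equivalence \<open>p' = p \<longleftrightarrow> G p\<close> makes such steps composable: a loop of them leaves the
  array unchanged iff every \<open>G i\<close> holds, and iterating them reaches a point where \<open>G\<close> holds.\<close>

definition progress :: "('a \<Rightarrow> 'a \<Rightarrow> bool) \<Rightarrow> ('a \<Rightarrow> bool) \<Rightarrow> 'a \<Rightarrow> 'a \<Rightarrow> bool" where
  "progress R G p p' \<longleftrightarrow> R p p' \<and> (p' = p \<longleftrightarrow> G p)"

lemma sem_For_progress:
  fixes R :: "(nat \<Rightarrow> nat) \<Rightarrow> (nat \<Rightarrow> nat) \<Rightarrow> bool" and G :: "nat \<Rightarrow> (nat \<Rightarrow> nat) \<Rightarrow> bool"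
  assumes R: "reflp R" "transp R" "antisymp R"
    and vc: "v \<notin> mods c" "b \<noteq> v" "p \<noteq> v"
    and step: "\<And>i m'. i < m b 0 \<Longrightarrow> R (m p) (m' p) \<Longrightarrow> m' v 0 = i \<Longrightarrow>
      (\<And>a. a \<notin> insert v (mods c) \<Longrightarrow> m' a = m a) \<Longrightarrow> progress R (G i) (m' p) (sem c m' p)"
  shows "progress R (\<lambda>x. \<forall>i<m b 0. G i x) (m p) (sem (For v b c) m p)"
proof (rule sem_For_induct[where I = "\<lambda>i m'. progress R (\<lambda>x. \<forall>j<i. G j x) (m p) (m' p)", OF vc(1,2)])
  show "progress R (\<lambda>x. \<forall>i<0. G i x) (m p) (upd v 0 0 m p)"
    using R(1) vc(3) by (simp add: progress_def upd_apply reflpD)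
next
  fix i m'
  assume i: "i < m b 0" and I: "progress R (\<lambda>x. \<forall>j<i. G j x) (m p) (m' p)" and v: "m' v 0 = i"
    and fr: "\<And>a. a \<notin> insert v (mods c) \<Longrightarrow> m' a = m a"
  have I': "R (m p) (m' p)" "m' p = m p \<longleftrightarrow> (\<forall>j<i. G j (m p))"
    using I by (simp_all add: progress_def)
  have s: "R (m' p) (sem c m' p)" "sem c m' p = m' p \<longleftrightarrow> G i (m' p)"
    using step[OF i I'(1) v fr] by (simp_all add: progress_def)
  have "R (m p) (sem c m' p)" by (rule transpD[OF R(2), OF I'(1) s(1)])
  moreover have "sem c m' p = m p \<longleftrightarrow> (\<forall>j<Suc i. G j (m p))"
  proof
    assume eq: "sem c m' p = m p"
    \<comment> \<open>A run that ends where it began cannot have moved in between: antisymmetry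
      forces the first \<open>i\<close> rounds to be stationary, hence also the last one.\<close>
    have "m' p = m p" by (rule antisympD[OF R(3), OF _ I'(1)]) (use s(1) eq in simp)
    then show "\<forall>j<Suc i. G j (m p)" using I' s eq by (auto simp: less_Suc_eq)
  next
    assume "\<forall>j<Suc i. G j (m p)"
    then show "sem c m' p = m p" using I' s by (metis lessI less_Suc_eq)
  qed
  ultimately show "progress R (\<lambda>x. \<forall>j<Suc i. G j x) (m p) (upd v 0 (Suc i) (sem c m') p)"
    using vc(3) by (simp add: progress_def upd_apply)
qed

text \<open>Every round before \<open>G\<close> holds raises \<open>\<mu>\<close> by at least one,
  while \<open>\<mu>\<close> stays below the number of rounds; thus \<open>G\<close> is reached, and
  from then on the rounds change nothing.\<close>

lemma sem_For_iterate:
  fixes R :: "(nat \<Rightarrow> nat) \<Rightarrow> (nat \<Rightarrow> nat) \<Rightarrow> bool" and G :: "(nat \<Rightarrow> nat) \<Rightarrow> bool"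
    and \<mu> :: "(nat \<Rightarrow> nat) \<Rightarrow> nat"
  assumes R: "reflp R" "transp R"
    and vc: "v \<notin> mods c" "b \<noteq> v" "p \<noteq> v"
    and step: "\<And>m'. R (m p) (m' p) \<Longrightarrow>
      (\<And>a. a \<notin> insert v (mods c) \<Longrightarrow> m' a = m a) \<Longrightarrow> progress R G (m' p) (sem c m' p)"
    and mono: "\<And>x y. R (m p) x \<Longrightarrow> R x y \<Longrightarrow> y \<noteq> x \<Longrightarrow> \<mu> x < \<mu> y"
    and bound: "\<And>x. R (m p) x \<Longrightarrow> \<mu> x < m b 0"
  shows "R (m p) (sem (For v b c) m p) \<and> G (sem (For v b c) m p)"
proof -
  let ?I = "\<lambda>i m'. R (m p) (m' p) \<and> (G (m' p) \<or> i \<le> \<mu> (m' p))"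
  have "?I (m b 0) (sem (For v b c) m)"
  proof (rule sem_For_induct[where I = ?I, OF vc(1,2)])
    show "?I 0 (upd v 0 0 m)" using R(1) vc(3) by (simp add: upd_apply reflpD)
  next
    fix i m'
    assume I: "?I i m'" and fr: "\<And>a. a \<notin> insert v (mods c) \<Longrightarrow> m' a = m a"
    have s: "R (m' p) (sem c m' p)" "sem c m' p = m' p \<longleftrightarrow> G (m' p)"
      using step[OF _ fr] I by (simp_all add: progress_def)
    have "R (m p) (sem c m' p)" using R(2) I s(1) by (blast dest: transpD)
    moreover have "G (sem c m' p) \<or> Suc i \<le> \<mu> (sem c m' p)"
      using I s mono[of "m' p" "sem c m' p"] by (cases "G (m' p)") auto
    ultimately show "?I (Suc i) (upd v 0 (Suc i) (sem c m'))" using vc(3) by (simp add: upd_apply)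
  qed
  then show ?thesis using bound[of "sem (For v b c) m p"] by auto
qed

text \<open>A value is true iff it is nonzero; \<open>a - (a - b)\<close> is the minimum of \<open>a\<close> and \<open>b\<close>.\<close>

definition EAnd :: "exp \<Rightarrow> exp \<Rightarrow> exp" where "EAnd a b = Minus a (Minus a b)"
definition ENot :: "exp \<Rightarrow> exp" where "ENot a = Minus (Const 1) a"
definition ELess :: "exp \<Rightarrow> exp \<Rightarrow> exp" where "ELess a b = Minus b a"
definition EEq :: "exp \<Rightarrow> exp \<Rightarrow> exp" where "EEq a b = ENot (Plus (Minus a b) (Minus b a))"

lemma val_bool_exps [simp]:
  "val (EAnd a b) m = 0 \<longleftrightarrow> val a m = 0 \<or> val b m = 0"
  "val (ENot a) m = 0 \<longleftrightarrow> val a m \<noteq> 0"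
  "val (ELess a b) m = 0 \<longleftrightarrow> \<not> val a m < val b m"
  "val (EEq a b) m = 0 \<longleftrightarrow> val a m \<noteq> val b m"
  by (auto simp: EAnd_def ENot_def ELess_def EEq_def)

definition copy_arr :: "nat \<Rightarrow> nat \<Rightarrow> nat \<Rightarrow> nat \<Rightarrow> fcom" where
  "copy_arr v bd a b = For v bd (Asg a (Var v) (Cell b (Var v)))"

declare sem.simps(5) [simp del]

section \<open>The lattice of stable matchings\<close>

lemma pref_listD:
  assumes "pref_list n l"
  shows "length l = n" "distinct l" "set l = {..<n}" "i < n \<Longrightarrow> l ! i < n"
proof -
  show d: "distinct l" and s: "set l = {..<n}" using assms by (simp_all add: pref_list_def)
  then show l: "length l = n" using distinct_card[OF d] by simp
  show "i < n \<Longrightarrow> l ! i < n" using s l nth_mem[of i l] by auto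
qed

lemma pref_list_nth_eq: "pref_list n l \<Longrightarrow> i < n \<Longrightarrow> j < n \<Longrightarrow> l ! i = l ! j \<longleftrightarrow> i = j"
  by (simp add: pref_listD nth_eq_iff_index_eq)

lemma pref_list_index: "pref_list n l \<Longrightarrow> x < n \<Longrightarrow> \<exists>i<n. l ! i = x"
  using pref_listD[of n l] by (metis in_set_conv_nth lessThan_iff)

lemma prefers_nth:
  assumes "pref_list n l" "i < n" "j < n"
  shows "prefers l (l ! i) (l ! j) \<longleftrightarrow> i < j"
proof
  assume "prefers l (l ! i) (l ! j)"
  then obtain i' j' where ij: "i' < j'" "j' < n" "l ! i' = l ! i" "l ! j' = l ! j"
    using pref_listD(1)[OF assms(1)] by (auto simp: prefers_def)
  then have "i' = i" "j' = j"
    using pref_list_nth_eq[OF assms(1)] assms(2,3) less_trans[OF ij(1,2)] by blast+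
  then show "i < j" using ij(1) by simp
qed (use assms(3) pref_listD(1)[OF assms(1)] in \<open>auto simp: prefers_def\<close>)

text \<open>Comparison in a list becomes comparison of numbers, which reduces asymmetry,
  transitivity and totality to facts about \<open><\<close>.\<close>

lemma prefers_rank:
  assumes "pref_list n l"
  obtains r :: "nat \<Rightarrow> nat" where "inj_on r {..<n}"
    and "\<And>x y. prefers l x y \<longleftrightarrow> x < n \<and> y < n \<and> r x < r y"
proof -
  obtain r where r: "r x < n \<and> l ! r x = x" if "x < n" for x
    using pref_list_index[OF assms] by metis
  have "inj_on r {..<n}" using r by (metis inj_onI lessThan_iff)
  moreover have "prefers l x y \<longleftrightarrow> x < n \<and> y < n \<and> r x < r y" for x y
  proof (cases "x < n \<and> y < n")
    case True
    then show ?thesis using prefers_nth[OF assms, of "r x" "r y"] r by simp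
  next
    case False
    then show ?thesis using pref_listD[OF assms] by (auto simp: prefers_def)
  qed
  ultimately show thesis by (rule that)
qed

lemma prefers_asym: "pref_list n l \<Longrightarrow> prefers l x y \<Longrightarrow> \<not> prefers l y x"
  by (erule prefers_rank[of n l]) auto

lemma prefers_trans: "pref_list n l \<Longrightarrow> prefers l x y \<Longrightarrow> prefers l y z \<Longrightarrow> prefers l x z"
  by (erule prefers_rank[of n l]) auto

lemma prefers_total:
  "pref_list n l \<Longrightarrow> x < n \<Longrightarrow> y < n \<Longrightarrow> x \<noteq> y \<Longrightarrow> prefers l x y \<or> prefers l y x"
  by (erule prefers_rank[of n l]) (metis inj_onD lessThan_iff linorder_neqE_nat)

lemma stable_permutes: "stable n I M \<Longrightarrow> M permutes {..<n}"
  by (simp add: stable_def)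

text \<open>The firm's list is total, so the absence of a blocking pair turns into a positive
  statement about the firm's own partner \<open>u\<close>. Later blocking-pair arguments use this
  form.\<close>

lemma stableD:
  assumes "valid_instance n I" "stable n I M" "M u = f" "w < n" "f < n"
    and "prefers (wpref I w) f (M w)"
  shows "prefers (fpref I f) u w"
proof -
  have p: "M permutes {..<n}" using assms(2) by (rule stable_permutes)
  have u: "inv M f = u" "u < n" using p assms(3,5) by (auto simp: permutes_inverses permutes_in_image)
      (metis lessThan_iff permutes_in_image)
  have "M w \<noteq> f" using assms(1,4,6) prefers_asym by (metis valid_instance_def)
  moreover from this have "\<not> prefers (fpref I f) w u"
    using assms(2,4-6) u unfolding stable_def by blast
  ultimately show ?thesis
    using prefers_total[of n "fpref I f" w u] assms u by (auto simp: valid_instance_def)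
qed

text \<open>Since \<open>M\<close> is onto, firms can be addressed through their partners, which
  removes \<open>inv\<close> from stability proofs.\<close>

lemma stableI:
  assumes "M permutes {..<n}" "valid_instance n I"
    and "\<And>u w. u < n \<Longrightarrow> w < n \<Longrightarrow> prefers (wpref I w) (M u) (M w) \<Longrightarrow> prefers (fpref I (M u)) u w"
  shows "stable n I M"
  unfolding stable_def
proof (intro conjI notI)
  show "M permutes {..<n}" by fact
  assume "\<exists>w<n. \<exists>f<n. M w \<noteq> f \<and> prefers (wpref I w) f (M w) \<and> prefers (fpref I f) w (inv M f)"
  then obtain w f where f: "w < n" "f < n" "prefers (wpref I w) f (M w)" "prefers (fpref I f) w (inv M f)"
    by blast
  define u where "u = inv M f"
  have u: "M u = f" "u < n" using assms(1) f(2) unfolding u_def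
    by (auto simp: permutes_inverses) (metis lessThan_iff permutes_in_image permutes_inv)
  have "prefers (fpref I f) u w" using assms(3)[of u w] u f by simp
  then show False using f(4) u_def assms(2) f(2) prefers_asym by (metis valid_instance_def)
qed

lemma permutes_lessThanI:
  assumes "inj_on f {..<n}" "\<And>x. x < n \<Longrightarrow> f x < n" "\<And>x. x \<ge> n \<Longrightarrow> f x = x"
  shows "f permutes {..<n :: nat}"
proof (rule bij_imp_permutes)
  have "f ` {..<n} = {..<n}"
    using assms(1,2) by (intro endo_inj_surj) auto
  then show "bij_betw f {..<n} {..<n}" using assms(1) by (simp add: bij_betw_def)
qed (use assms(3) in auto)

section \<open>Meet and join of two stable matchings\<close>

context
  fixes n I M M'
  assumes valid: "valid_instance n I" and st: "stable n I M" "stable n I M'"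
begin

private lemma perms: "M permutes {..<n}" "M' permutes {..<n}"
  using st by (simp_all add: stable_permutes)

private lemma range: "w < n \<Longrightarrow> M w < n" "w < n \<Longrightarrow> M' w < n" "w \<ge> n \<Longrightarrow> M w = w" "w \<ge> n \<Longrightarrow> M' w = w"
  using perms by (metis lessThan_iff permutes_in_image, metis lessThan_iff permutes_in_image,
    metis lessThan_iff not_le permutes_not_in, metis lessThan_iff not_le permutes_not_in)

private lemma eqD: "M w = M u \<Longrightarrow> w = u" "M' w = M' u \<Longrightarrow> w = u"
  using perms[THEN permutes_inj] by (blast dest: injD)+

private lemma wp: "w < n \<Longrightarrow> pref_list n (wpref I w)" "f < n \<Longrightarrow> pref_list n (fpref I f)"
  using valid by (auto simp: valid_instance_def)

text \<open>Otherwise the common firm \<open>M w\<close> would, by stability of \<open>M\<close>,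
  rank \<open>w\<close> above \<open>w'\<close> and, by stability of \<open>M'\<close>, rank
  \<open>w'\<close> above \<open>w\<close>.\<close>

private lemma no_crossing:
  assumes "w < n" "w' < n" "M w = M' w'" "prefers (wpref I w) (M w) (M' w)"
  shows "\<not> prefers (wpref I w') (M' w') (M w')"
proof
  assume "prefers (wpref I w') (M' w') (M w')"
  then have "prefers (fpref I (M w)) w w'"
    using stableD[OF valid st(1), of w "M w" w'] assms by (simp add: range)
  moreover have "prefers (fpref I (M w)) w' w"
    using stableD[OF valid st(2), of w' "M w" w] assms by (simp add: range)
  ultimately show False using prefers_asym wp(2) range assms(1) by blast
qed


text \<open>A collision can only arise between a worker keeping its \<open>M\<close> firm and one
  keeping its \<open>M'\<close> firm; both then like the shared firm better than their other one,
  contrary to \<open>no_crossing\<close>.\<close>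

lemma meet_permutes: "meet I M M' permutes {..<n}"
proof (rule permutes_lessThanI)
  show "inj_on (meet I M M') {..<n}"
  proof (rule inj_onI)
    fix w w' assume "w \<in> {..<n}" "w' \<in> {..<n}" and eq: "meet I M M' w = meet I M M' w'"
    then have w: "w < n" "w' < n" by auto
    show "w = w'"
    proof (rule ccontr)
      assume ne: "w \<noteq> w'"
      have *: False if "u < n" "u' < n" "u \<noteq> u'" "M u = M' u'" "prefers (wpref I u) (M u) (M' u)"
        "\<not> prefers (wpref I u') (M u') (M' u')" for u u'
      proof -
        have "M u' \<noteq> M' u'" using that eqD by metis
        then have "prefers (wpref I u') (M' u') (M u')"
          using prefers_total[OF wp(1)[OF that(2)] range(1,2)[OF that(2)]] that by blast
        then show False using no_crossing that by blast
      qed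
      show False
      proof (cases "prefers (wpref I w) (M w) (M' w)"; cases "prefers (wpref I w') (M w') (M' w')")
        assume "prefers (wpref I w) (M w) (M' w)" "prefers (wpref I w') (M w') (M' w')"
        then show False using eq ne eqD(1)[of w w'] by (simp add: meet_def)
      next
        assume "prefers (wpref I w) (M w) (M' w)" "\<not> prefers (wpref I w') (M w') (M' w')"
        then show False using eq ne *[of w w'] w by (simp add: meet_def)
      next
        assume "\<not> prefers (wpref I w) (M w) (M' w)" "prefers (wpref I w') (M w') (M' w')"
        then show False using eq ne *[of w' w] w by (simp add: meet_def)
      next
        assume "\<not> prefers (wpref I w) (M w) (M' w)" "\<not> prefers (wpref I w') (M w') (M' w')"
        then show False using eq ne eqD(2)[of w w'] by (simp add: meet_def)
      qed
    qed
  qed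
qed (simp_all add: meet_def range)

text \<open>Surjectivity is deduced from injectivity of the meet: a firm that the join gives to
  neither of its two partners would be given by the meet to both.\<close>

lemma join_permutes: "join I M M' permutes {..<n}"
proof (rule permutes_lessThanI)
  have "join I M M' ` {..<n} = {..<n}"
  proof (intro equalityI subsetI)
    fix f assume "f \<in> {..<n}"
    then have f: "f < n" by simp
    obtain a b where ab: "M a = f" "M' b = f" using perms by (metis permutes_surj surjE)
    then have lt: "a < n" "b < n" using f range(3,4) by (metis not_le)+
    have "join I M M' a = f \<or> join I M M' b = f"
    proof (rule ccontr)
      assume "\<not> ?thesis"
      then have "prefers (wpref I a) (M a) (M' a)" "\<not> prefers (wpref I b) (M b) (M' b)" "M b \<noteq> f" "M' a \<noteq> f"
        using ab by (auto simp: join_def split: if_splits)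
      then have "meet I M M' a = f" "meet I M M' b = f" "a \<noteq> b" using ab by (auto simp: meet_def)
      then show False using meet_permutes by (metis permutes_inj injD)
    qed
    then show "f \<in> join I M M' ` {..<n}" using lt by auto
  qed (auto simp: join_def range)
  then show "inj_on (join I M M') {..<n}" by (simp add: eq_card_imp_inj_on)
qed (simp_all add: join_def range)

text \<open>A worker that likes a firm better than its meet partner likes it better than both of its
  partners, so stability of whichever matching supplies the firm's partner \<open>u\<close>
  applies.\<close>

lemma stable_meet: "stable n I (meet I M M')"
proof (rule stableI[OF meet_permutes valid])
  fix u w assume uw: "u < n" "w < n"
  assume p: "prefers (wpref I w) (meet I M M' u) (meet I M M' w)"
  have r: "meet I M M' u < n" using uw by (simp add: meet_def range)
  have "prefers (wpref I w) (meet I M M' u) (M w)" "prefers (wpref I w) (meet I M M' u) (M' w)"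
  proof -
    let ?f = "meet I M M' u" and ?l = "wpref I w"
    have l: "pref_list n ?l" using wp(1) uw(2) .
    have "prefers ?l ?f (M w) \<and> prefers ?l ?f (M' w)"
    proof (cases "prefers ?l (M w) (M' w)")
      case True
      then have "meet I M M' w = M w" by (simp add: meet_def)
      then show ?thesis using p True prefers_trans[OF l, of ?f "M w" "M' w"] by simp
    next
      case False
      then have m: "meet I M M' w = M' w" by (simp add: meet_def)
      have "M w = M' w \<or> prefers ?l (M' w) (M w)"
        using prefers_total[OF l range(1,2)[OF uw(2)]] False by blast
      then show ?thesis using p m prefers_trans[OF l, of ?f "M' w" "M w"] by auto
    qed
    then show "prefers ?l ?f (M w)" "prefers ?l ?f (M' w)" by simp_all
  qed
  moreover have "M u = meet I M M' u \<or> M' u = meet I M M' u" by (simp add: meet_def)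
  ultimately show "prefers (fpref I (meet I M M' u)) u w"
    using stableD[OF valid st(1) _ uw(2) r] stableD[OF valid st(2) _ uw(2) r] by blast
qed

text \<open>A worker \<open>w\<close> that likes \<open>f\<close> better than its join partner is
  matched to that partner in \<open>M\<close> or \<open>M'\<close>, so \<open>f\<close> ranks its
  own partner there above \<open>w\<close>. It remains that \<open>f\<close> ranks \<open>v\<close>,
  its partner in the join, at least as high as both of its partners.\<close>

lemma stable_join: "stable n I (join I M M')"
proof (rule stableI[OF join_permutes valid])
  fix v w assume vw: "v < n" "w < n"
  define f where "f = join I M M' v"
  assume p: "prefers (wpref I w) (join I M M' v) (join I M M' w)"
  have f: "f < n" using vw by (simp add: f_def join_def range)
  obtain a b where ab: "M a = f" "M' b = f" using perms by (metis permutes_surj surjE)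
  then have lt: "a < n" "b < n" using f range(3,4) by (metis not_le)+
  have "M v = f \<or> M' v = f" using f_def by (auto simp: join_def)
  then have vab: "v = a \<or> v = b" using ab eqD by metis
  \<comment> \<open>If \<open>v\<close> is not the partner of \<open>f\<close> in \<open>M\<close>,
    then the partner \<open>a\<close> loses \<open>f\<close> in the join because it likes
    \<open>f\<close> better than \<open>M' a\<close>; stability of \<open>M'\<close> then makes
    \<open>f\<close> prefer \<open>v\<close> to \<open>a\<close>. The case of \<open>b\<close> is
    symmetric.\<close>
  have *: "prefers (fpref I f) v a \<or> v = a" "prefers (fpref I f) v b \<or> v = b"
  proof -
    have "M' v = f \<Longrightarrow> v \<noteq> a \<Longrightarrow> prefers (fpref I f) v a"
    proof -
      assume v: "M' v = f" "v \<noteq> a"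
      have "join I M M' a \<noteq> f"
        using v(2) injD[OF permutes_inj[OF join_permutes], of a v] f_def by auto
      then have "prefers (wpref I a) f (M' a)" using ab by (auto simp: join_def split: if_splits)
      then show ?thesis using stableD[OF valid st(2) v(1) lt(1) f] by simp
    qed
    moreover have "M v = f \<Longrightarrow> v \<noteq> b \<Longrightarrow> prefers (fpref I f) v b"
    proof -
      assume v: "M v = f" "v \<noteq> b"
      have "join I M M' b \<noteq> f"
        using v(2) injD[OF permutes_inj[OF join_permutes], of b v] f_def by auto
      then have "\<not> prefers (wpref I b) (M b) f" "M b \<noteq> f" using ab by (auto simp: join_def split: if_splits)
      then have "prefers (wpref I b) f (M b)" using prefers_total[OF wp(1)[OF lt(2)] range(1)[OF lt(2)] f] by blast
      then show ?thesis using stableD[OF valid st(1) v(1) lt(2) f] by simp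
    qed
    ultimately show "prefers (fpref I f) v a \<or> v = a" "prefers (fpref I f) v b \<or> v = b"
      using vab ab by blast+
  qed
  have "prefers (fpref I f) a w \<or> prefers (fpref I f) b w"
  proof (cases "join I M M' w = M w")
    case True
    then show ?thesis using p stableD[OF valid st(1) ab(1) vw(2) f] f_def by simp
  next
    case False
    then have "join I M M' w = M' w" by (simp add: join_def split: if_splits)
    then show ?thesis using p stableD[OF valid st(2) ab(2) vw(2) f] f_def by simp
  qed
  then show "prefers (fpref I (join I M M' v)) v w"
    using * prefers_trans[OF wp(2)[OF f], of v] unfolding f_def[symmetric] by blast
qed

end

section \<open>Position vectors of common stable matchings\<close>

locale common_stable_matchings =
  fixes n :: nat and As :: "sm_instance list"
  assumes input: "(n, As) \<in> same_workers_inputs"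
begin

definition wl :: "nat \<Rightarrow> nat list" where "wl w = wpref (As ! 0) w"
definition fl :: "nat \<Rightarrow> nat \<Rightarrow> nat list" where "fl i f = fpref (As ! i) f"

text \<open>A matching is represented by the positions of the partners in the workers' common lists;
  positions are 0 for numbers \<open>\<ge> n\<close>, so join and meet become \<^const>\<open>sup\<close> and \<^const>\<open>inf\<close> of
  functions.\<close>

definition matching :: "(nat \<Rightarrow> nat) \<Rightarrow> nat \<Rightarrow> nat" where
  "matching p = (\<lambda>w. if w < n then wl w ! p w else w)"

definition S :: "(nat \<Rightarrow> nat) set" where
  "S = {p. (\<forall>w<n. p w < n) \<and> (\<forall>w\<ge>n. p w = 0) \<and> matching p \<in> common_stable n As}"

lemma nonempty: "As \<noteq> []"
  using input by (simp add: same_workers_inputs_def)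

lemma valid: "A \<in> set As \<Longrightarrow> valid_instance n A"
  using input by (simp add: same_workers_inputs_def)

lemma wpref_eq: "A \<in> set As \<Longrightarrow> w < n \<Longrightarrow> wpref A w = wl w"
  using input nth_mem[of 0 As] unfolding same_workers_inputs_def wl_def by blast

lemma pref_list_wl: "w < n \<Longrightarrow> pref_list n (wl w)"
  using valid[of "As ! 0"] nonempty by (simp add: wl_def valid_instance_def)

lemma pref_list_fl: "i < length As \<Longrightarrow> f < n \<Longrightarrow> pref_list n (fl i f)"
  using valid[of "As ! i"] by (simp add: fl_def valid_instance_def)

lemma join_eq:
  assumes "A \<in> set As" "B \<in> set As" "M permutes {..<n}" "M' permutes {..<n}"
  shows "join A M M' = join B M M'" "meet A M M' = meet B M M'"
proof -
  have "join A M M' w = join B M M' w \<and> meet A M M' w = meet B M M' w" for w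
  proof (cases "w < n")
    case False
    then have "M w = w" "M' w = w" using assms(3,4) by (auto simp: permutes_def)
    then show ?thesis by (simp add: join_def meet_def)
  qed (use assms(1,2) in \<open>simp add: join_def meet_def wpref_eq\<close>)
  then show "join A M M' = join B M M'" "meet A M M' = meet B M M'" by auto
qed

lemma common_stable_sublattice:
  assumes "A \<in> set As"
  shows "sublattice n A (common_stable n As)"
  unfolding sublattice_def
proof (intro conjI ballI)
  fix M M' assume M: "M \<in> common_stable n As" "M' \<in> common_stable n As"
  have s: "stable n B M" "stable n B M'" if "B \<in> set As" for B
    using M that by (auto simp: common_stable_def stable_matchings_def)
  have "stable n B (join A M M') \<and> stable n B (meet A M M')" if B: "B \<in> set As" for B
    using join_eq[OF assms B s(1,2)[OF B, THEN stable_permutes]]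
      stable_join[OF valid[OF B] s[OF B]] stable_meet[OF valid[OF B] s[OF B]] by simp
  then show "join A M M' \<in> common_stable n As" "meet A M M' \<in> common_stable n As"
    by (simp_all add: common_stable_def stable_matchings_def)
qed (use assms in \<open>auto simp: common_stable_def\<close>)

lemma prefers_wpref:
  "A \<in> set As \<Longrightarrow> w < n \<Longrightarrow> i < n \<Longrightarrow> j < n \<Longrightarrow> prefers (wpref A w) (wl w ! i) (wl w ! j) \<longleftrightarrow> i < j"
  by (simp add: wpref_eq prefers_nth[OF pref_list_wl])

lemma SD: "p \<in> S \<Longrightarrow> w < n \<Longrightarrow> p w < n" "p \<in> S \<Longrightarrow> n \<le> w \<Longrightarrow> p w = 0"
  "p \<in> S \<Longrightarrow> matching p \<in> common_stable n As"
  by (simp_all add: S_def)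

lemma S_stable: "p \<in> S \<Longrightarrow> A \<in> set As \<Longrightarrow> stable n A (matching p)"
  using SD(3) by (auto simp: common_stable_def stable_matchings_def)

lemma matching_join:
  assumes "p \<in> S" "q \<in> S" "A \<in> set As"
  shows "matching (sup p q) = join A (matching p) (matching q)"
    and "matching (inf p q) = meet A (matching p) (matching q)"
  using assms by (auto simp: fun_eq_iff matching_def join_def meet_def prefers_wpref SD sup_nat_def
      inf_nat_def max_def min_def)

lemma S_sup: "p \<in> S \<Longrightarrow> q \<in> S \<Longrightarrow> sup p q \<in> S"
  and S_inf: "p \<in> S \<Longrightarrow> q \<in> S \<Longrightarrow> inf p q \<in> S"
proof -
  assume pq: "p \<in> S" "q \<in> S"
  have A: "As ! 0 \<in> set As" using nonempty by simp
  have "matching (sup p q) \<in> common_stable n As" "matching (inf p q) \<in> common_stable n As"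
    using common_stable_sublattice[OF A] pq SD(3) matching_join[OF pq A] by (simp_all add: sublattice_def)
  moreover have "\<forall>w<n. sup p q w < n" "\<forall>w<n. inf p q w < n" "\<forall>w\<ge>n. sup p q w = 0" "\<forall>w\<ge>n. inf p q w = 0"
    using pq by (auto simp: SD sup_nat_def inf_nat_def less_max_iff_disj min_less_iff_disj)
  ultimately show "sup p q \<in> S" "inf p q \<in> S" by (simp_all add: S_def)
qed

lemma zero_ext: "\<forall>w<n. p w = q w \<Longrightarrow> \<forall>w\<ge>n. p w = 0 \<Longrightarrow> \<forall>w\<ge>n. q w = (0::nat) \<Longrightarrow> p = q"
  by (metis ext not_le)

lemma bij_betw_matching: "bij_betw matching S (common_stable n As)"
  unfolding bij_betw_def
proof (intro conjI inj_onI equalityI subsetI)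
  fix p q assume pq: "p \<in> S" "q \<in> S" "matching p = matching q"
  have "p w = q w" if "w < n" for w
  proof -
    have "wl w ! p w = wl w ! q w" using fun_cong[OF pq(3), of w] that by (simp add: matching_def)
    then show ?thesis using pref_list_nth_eq[OF pref_list_wl] SD(1) pq(1,2) that by blast
  qed
  then show "p = q" using SD(2) pq by (intro zero_ext) auto
next
  fix M assume "M \<in> matching ` S"
  then show "M \<in> common_stable n As" by (auto simp: SD(3))
next
  fix M assume M: "M \<in> common_stable n As"
  then have "stable n (As ! 0) M" using nonempty by (simp add: common_stable_def stable_matchings_def)
  then have per: "M permutes {..<n}" by (rule stable_permutes)
  then have "\<exists>i<n. wl w ! i = M w" if "w < n" for w
    using pref_list_index[OF pref_list_wl[OF that], of "M w"] permutes_in_image[OF per, of w] that by simp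
  then obtain q where q: "w < n \<Longrightarrow> q w < n \<and> wl w ! q w = M w" for w by metis
  define p where "p w = (if w < n then q w else 0)" for w
  have "matching p = M" using q per by (auto simp: fun_eq_iff matching_def p_def permutes_def)
  moreover from this have "p \<in> S" using q M by (simp add: S_def p_def)
  ultimately show "M \<in> matching ` S" by blast
qed

text \<open>Worker \<open>w\<close> points at a firm \<open>f\<close> that is at position \<open>j\<close> of the list of \<open>w'\<close>, not
  worse than the pointer of \<open>w'\<close>, and in the \<open>i\<close>-th instance \<open>f\<close> prefers \<open>w'\<close> (position \<open>a\<close>)
  to \<open>w\<close> (position \<open>b\<close>). Then \<open>w\<close> cannot be matched to \<open>f\<close> in any common stable matching above
  the pointers.\<close>

definition violated :: "(nat \<Rightarrow> nat) \<Rightarrow> nat \<Rightarrow> nat \<Rightarrow> nat \<Rightarrow> nat \<Rightarrow> nat \<Rightarrow> nat \<Rightarrow> bool" where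
  "violated p w w' j i a b \<longleftrightarrow> p w < n \<and> j \<le> p w' \<and> wl w' ! j = wl w ! p w \<and> a < b \<and>
     fl i (wl w ! p w) ! a = w' \<and> fl i (wl w ! p w) ! b = w"

text \<open>If \<open>w\<close> stayed, \<open>q\<close> would match it to the firm;
  \<open>w'\<close> would then be matched strictly after position \<open>j\<close>, prefer the firm,
  and be preferred by it in instance \<open>i\<close>, so this pair would block.\<close>

lemma violated_advance:
  assumes "violated p w w' j i a b" "q \<in> S" "p \<le> q"
    and lt: "w < n" "w' < n" "j < n" "i < length As" "a < n" "b < n"
  shows "p w < q w"
proof (rule ccontr)
  assume "\<not> p w < q w"
  then have eq: "q w = p w" using le_funD[OF assms(3), of w] by simp
  define f where "f = wl w ! p w"
  have v: "p w < n" "j \<le> p w'" "wl w' ! j = f" "a < b" "fl i f ! a = w'" "fl i f ! b = w"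
    using assms(1) by (simp_all add: violated_def f_def)
  have f: "f < n" using pref_listD(4)[OF pref_list_wl] lt(1) v(1) by (simp add: f_def)
  have A: "As ! i \<in> set As" using lt by simp
  have st: "stable n (As ! i) (matching q)" using S_stable[OF assms(2) A] .
  have mw: "matching q w = f" using eq lt by (simp add: matching_def f_def)
  have ne: "w \<noteq> w'" using v pref_list_nth_eq[OF pref_list_fl[OF lt(4) f] lt(5,6)] by auto
  have "matching q w' \<noteq> f"
    using ne mw injD[OF permutes_inj[OF stable_permutes[OF st]], of w w'] by auto
  then have "j \<noteq> q w'" using v(3) lt by (auto simp: matching_def)
  then have "j < q w'" using v(2) le_funD[OF assms(3), of w'] by simp
  then have "prefers (wpref (As ! i) w') f (matching q w')"
    using prefers_wpref[OF A lt(2,3), of "q w'"] SD(1)[OF assms(2) lt(2)] v(3) lt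
    by (simp add: matching_def)
  from stableD[OF valid[OF A] st mw lt(2) f this] have "prefers (fl i f) w w'" by (simp add: fl_def)
  moreover have "prefers (fl i f) w' w"
    using prefers_nth[OF pref_list_fl[OF lt(4) f] lt(5,6)] v by simp
  ultimately show False using prefers_asym[OF pref_list_fl[OF lt(4) f]] by blast
qed

text \<open>Two workers pointing at the same firm violate the condition in one direction or the
  other with \<open>j\<close> equal to the pointer, which is why positions up to and including the
  pointer count; blocking pairs are violations with \<open>j\<close> strictly smaller.\<close>

lemma no_violation_stable:
  assumes "\<forall>w<n. p w < n" "\<forall>w\<ge>n. p w = 0"
    and nv: "\<And>w w' j i a b. w < n \<Longrightarrow> w' < n \<Longrightarrow> j < n \<Longrightarrow> i < length As \<Longrightarrow> a < n \<Longrightarrow> b < n \<Longrightarrow>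
      \<not> violated p w w' j i a b"
  shows "p \<in> S"
proof -
  have P: "prefers (fl i f) w w'" if h: "w < n" "w' < n" "i < length As" "w \<noteq> w'" "wl w ! p w = f" "j \<le> p w'"
    "wl w' ! j = f" for w w' i j f
  proof -
    have f: "f < n" using pref_listD(4)[OF pref_list_wl[OF h(1)], of "p w"] h assms(1) by simp
    obtain a b where ab: "a < n" "b < n" "fl i f ! a = w'" "fl i f ! b = w"
      using pref_list_index[OF pref_list_fl[OF h(3) f]] h(1,2) by metis
    have "j < n" using h(6) assms(1) h(2) le_less_trans by blast
    then have "\<not> a < b" using nv[of w w' j i a b] h ab assms(1) by (simp add: violated_def)
    moreover have "a \<noteq> b" using ab h(4) by auto
    ultimately show ?thesis
      using prefers_nth[OF pref_list_fl[OF h(3) f] ab(2,1)] ab(3,4) by simp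
  qed
  have per: "matching p permutes {..<n}"
  proof (rule permutes_lessThanI)
    show "inj_on (matching p) {..<n}"
    proof (rule inj_onI, rule ccontr)
      fix w w' assume "w \<in> {..<n}" "w' \<in> {..<n}" and m: "matching p w = matching p w'" and ne: "w \<noteq> w'"
      then have w: "w < n" "w' < n" by auto
      have m': "wl w ! p w = wl w' ! p w'" using m w by (simp add: matching_def)
      \<comment> \<open>Injectivity takes the firms' lists from a single instance; the first one
        exists because the list is nonempty.\<close>
      have z: "0 < length As" using nonempty by simp
      have "prefers (fl 0 (wl w ! p w)) w w'" "prefers (fl 0 (wl w ! p w)) w' w"
        using P[OF w z ne refl order_refl m'[symmetric]]
          P[OF w(2,1) z ne[symmetric] m'[symmetric] order_refl refl] by simp_all
      moreover have "wl w ! p w < n" using pref_listD(4)[OF pref_list_wl[OF w(1)]] assms(1) w by simp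
      ultimately show False using prefers_asym[OF pref_list_fl[OF z]] by blast
    qed
    show "matching p x < n" if "x < n" for x
      using that pref_listD(4)[OF pref_list_wl[OF that]] assms(1) by (simp add: matching_def)
  qed (simp add: matching_def)
  have "stable n A (matching p)" if A: "A \<in> set As" for A
  proof (rule stableI[OF per valid[OF A]])
    fix u w assume uw: "u < n" "w < n"
    assume pr: "prefers (wpref A w) (matching p u) (matching p w)"
    obtain i where i: "i < length As" "As ! i = A" using A by (auto simp: in_set_conv_nth)
    have mu: "matching p u = wl u ! p u" "matching p w = wl w ! p w" using uw by (simp_all add: matching_def)
    have "matching p u < n" using mu pref_listD(4)[OF pref_list_wl[OF uw(1)]] assms(1) uw by simp
    then obtain j where j: "j < n" "wl w ! j = matching p u"
      using pref_list_index[OF pref_list_wl[OF uw(2)]] by blast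
    have "j < p w" using pr prefers_wpref[OF A uw(2) j(1), of "p w"] assms(1) uw j(2) mu by simp
    moreover from this have "u \<noteq> w"
      using j mu pref_list_nth_eq[OF pref_list_wl[OF uw(2)] j(1), of "p w"] assms(1) uw by auto
    ultimately show "prefers (fpref A (matching p u)) u w"
      using P[OF uw i(1) _ mu(1)[symmetric] _ j(2)] i(2) by (simp add: fl_def)
  qed
  then show ?thesis using assms(1,2) by (auto simp: S_def common_stable_def stable_matchings_def)
qed

section \<open>Least common stable vectors\<close>

definition least_above :: "(nat \<Rightarrow> nat) \<Rightarrow> (nat \<Rightarrow> nat) \<Rightarrow> bool" where
  "least_above p q \<longleftrightarrow> q \<in> S \<and> p \<le> q \<and> (\<forall>r\<in>S. p \<le> r \<longrightarrow> q \<le> r)"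

lemma least_above_unique: "least_above p q \<Longrightarrow> least_above p r \<Longrightarrow> q = r"
  by (auto simp: least_above_def intro: antisym)

lemma sum_less:
  assumes "p \<le> q" "p \<noteq> q" "\<forall>w\<ge>n. p w = 0" "\<forall>w\<ge>n. q w = (0::nat)"
  shows "(\<Sum>w<n. p w) < (\<Sum>w<n. q w)"
proof (rule sum_strict_mono_ex1)
  obtain w where "p w \<noteq> q w" using assms(2) by auto
  moreover from this have "w < n" using assms(3,4) by (metis not_le)
  ultimately show "\<exists>w\<in>{..<n}. p w < q w" using le_funD[OF assms(1), of w] by (intro bexI[of _ w]) auto
qed (use assms(1) in \<open>auto simp: le_fun_def\<close>)

text \<open>Closure under infimum is what makes a vector of minimal coordinate sum least: its
  infimum with a vector above \<open>p\<close> that it does not lie below would have a smaller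
  sum.\<close>

lemma least_above_exists:
  assumes "q \<in> S" "p \<le> q"
  obtains r where "least_above p r" "r \<le> q"
proof -
  obtain r where r: "r \<in> S" "p \<le> r" and min: "\<And>q. q \<in> S \<and> p \<le> q \<Longrightarrow> (\<Sum>w<n. r w) \<le> (\<Sum>w<n. q w)"
    using ex_has_least_nat[of "\<lambda>q. q \<in> S \<and> p \<le> q" q "\<lambda>q. \<Sum>w<n. q w"] assms by blast
  have "r \<le> q" if q: "q \<in> S" "p \<le> q" for q
  proof (rule ccontr)
    assume "\<not> r \<le> q"
    then have "inf r q \<noteq> r" by (metis inf.cobounded2)
    moreover have "inf r q \<in> S" using S_inf r q by blast
    ultimately have "(\<Sum>w<n. inf r q w) < (\<Sum>w<n. r w)"
      using SD(2) r(1) \<open>inf r q \<in> S\<close> by (intro sum_less) (simp_all del: inf_apply)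
    moreover have "(\<Sum>w<n. r w) \<le> (\<Sum>w<n. inf r q w)"
      using min[of "inf r q"] \<open>inf r q \<in> S\<close> r q by simp
    ultimately show False by simp
  qed
  then show thesis using that[of r] r assms unfolding least_above_def by blast
qed

lemma worker_optimal_least:
  assumes "least_above (\<lambda>_. 0) q" "A \<in> set As"
  shows "worker_optimal n A (common_stable n As) (matching q)"
  unfolding worker_optimal_def
proof (intro conjI ballI allI impI)
  have q: "q \<in> S" using assms by (simp add: least_above_def)
  then show "matching q \<in> common_stable n As" by (rule SD(3))
  fix M w assume "M \<in> common_stable n As" and w: "w < n"
  then obtain r where r: "r \<in> S" "M = matching r" using bij_betw_matching by (auto simp: bij_betw_def)
  then have "q \<le> r" using assms(1) by (simp add: least_above_def le_fun_def)
  then have "q w = r w \<or> q w < r w" by (metis le_funD le_neq_implies_less)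
  then show "weakly_prefers (wpref A w) (matching q w) (M w)"
    using prefers_wpref[OF assms(2) w, of "q w" "r w"] SD(1) q r w
    by (auto simp: weakly_prefers_def matching_def)
qed

text \<open>Stability reverses interests: if the partner \<open>b\<close> of \<open>f\<close> in
  \<open>M\<close> is not kept, \<open>b\<close> is worse off in \<open>matching q\<close> and
  prefers \<open>f\<close>, so \<open>f\<close> must prefer its partner under
  \<open>q\<close>.\<close>

lemma firm_optimal_greatest:
  assumes "q \<in> S" "\<And>r. r \<in> S \<Longrightarrow> r \<le> q" "A \<in> set As"
  shows "firm_optimal n A (common_stable n As) (matching q)"
  unfolding firm_optimal_def
proof (intro conjI ballI allI impI)
  show "matching q \<in> common_stable n As" using assms(1) by (rule SD(3))
  fix M f assume "M \<in> common_stable n As" and f: "f < n"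
  then obtain r where r: "r \<in> S" "M = matching r" using bij_betw_matching by (auto simp: bij_betw_def)
  have st: "stable n A (matching q)" "stable n A M" using S_stable assms r by auto
  note per = st[THEN stable_permutes]
  define a b where "a = inv (matching q) f" and "b = inv M f"
  have ab: "matching q a = f" "M b = f" using per by (simp_all add: a_def b_def permutes_inverses)
  have lt: "b < n" using per(2) f ab(2) by (metis lessThan_iff permutes_in_image)
  show "weakly_prefers (fpref A f) (inv (matching q) f) (inv M f)"
    unfolding a_def[symmetric] b_def[symmetric]
  proof (cases "a = b")
    case False
    have "matching q b \<noteq> f" using False ab injD[OF permutes_inj[OF per(1)], of a b] by auto
    then have "r b \<noteq> q b" using ab(2) r(2) lt by (auto simp: matching_def)
    then have "r b < q b" using le_funD[OF assms(2)[OF r(1)], of b] by simp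
    then have "prefers (wpref A b) f (matching q b)"
      using prefers_wpref[OF assms(3) lt, of "r b" "q b"] SD(1) assms(1) r lt ab(2)
      by (auto simp: matching_def)
    from stableD[OF valid[OF assms(3)] st(1) ab(1) lt f this]
    show "weakly_prefers (fpref A f) a b" by (simp add: weakly_prefers_def)
  qed (simp add: weakly_prefers_def)
qed

end

section \<open>Join-irreducible elements and lexicographic order\<close>

context common_stable_matchings
begin

definition unit :: "nat \<Rightarrow> nat \<Rightarrow> nat \<Rightarrow> nat" where "unit w j = (\<lambda>_. 0)(w := j)"

lemma unit_le_iff: "unit w j \<le> p \<longleftrightarrow> j \<le> p w"
  by (auto simp: unit_def le_fun_def)

text \<open>The least element whose coordinate \<open>w\<close> is at least \<open>j\<close> is join-prime: if it lies below a
  join, the coordinate \<open>w\<close> of one of the joinands is at least \<open>j\<close>. The bottom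
  may be among these elements.\<close>

definition irreducibles :: "(nat \<Rightarrow> nat) set" where
  "irreducibles = {J. \<exists>w<n. \<exists>j<n. least_above (unit w j) J}"

text \<open>The shift skips row 0: the bottom corresponds to the empty closed set and is not an
  element of the poset.\<close>

definition row_order :: "nat \<Rightarrow> (nat \<Rightarrow> nat \<Rightarrow> nat) \<Rightarrow> nat rel" where
  "row_order m row = {(i, j). i < m \<and> j < m \<and> row (Suc i) \<le> row (Suc j)}"

context
  fixes m :: nat and row :: "nat \<Rightarrow> nat \<Rightarrow> nat"
  assumes bot: "least_above (\<lambda>_. 0) (row 0)"
    and inj: "inj_on row {..m}"
    and rows: "row ` {..m} = insert (row 0) irreducibles"
begin

text \<open>Inserting row 0 makes the maximum defined for empty \<open>T\<close> and equal to the
  bottom there.\<close>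

definition span :: "nat set \<Rightarrow> nat \<Rightarrow> nat" where
  "span T x = Max (insert (row 0 x) ((\<lambda>i. row (Suc i) x) ` T))"

private lemma row_S: "i \<le> m \<Longrightarrow> row i \<in> S"
proof -
  assume "i \<le> m"
  then have "row i \<in> insert (row 0) irreducibles" using rows by blast
  then show "row i \<in> S" using bot by (auto simp: irreducibles_def least_above_def)
qed

private lemma row_irreducible:
  assumes "i < m" obtains w j where "w < n" "j < n" "least_above (unit w j) (row (Suc i))"
proof -
  have "row (Suc i) \<in> insert (row 0) irreducibles" using rows assms by (metis atMost_iff imageI Suc_leI)
  moreover have "row (Suc i) \<noteq> row 0" using inj_onD[OF inj, of "Suc i" 0] assms by auto
  ultimately show thesis using that by (auto simp: irreducibles_def)
qed

private lemma bot_least: "q \<in> S \<Longrightarrow> row 0 \<le> q"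
  using bot by (simp add: least_above_def le_fun_def)

private lemma span_ge_iff: "finite T \<Longrightarrow> v \<le> span T x \<longleftrightarrow> v \<le> row 0 x \<or> (\<exists>i\<in>T. v \<le> row (Suc i) x)"
  unfolding span_def by (subst Max_ge_iff) auto

private lemma span_le_iff: "finite T \<Longrightarrow> span T \<le> q \<longleftrightarrow> row 0 \<le> q \<and> (\<forall>i\<in>T. row (Suc i) \<le> q)"
  unfolding span_def le_fun_def by (subst Max_le_iff) auto

private lemma span_union:
  assumes "finite T" "finite U" shows "span (T \<union> U) = sup (span T) (span U)"
proof (rule antisym)
  show "span (T \<union> U) \<le> sup (span T) (span U)"
    using assms span_le_iff[OF assms(1), of "span T"] span_le_iff[OF assms(2), of "span U"]
    by (subst span_le_iff) (auto intro: le_supI1 le_supI2)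
  show "sup (span T) (span U) \<le> span (T \<union> U)"
    using assms span_le_iff[of "T \<union> U" "span (T \<union> U)"] by (simp add: span_le_iff)
qed

private lemma span_S:
  assumes "T \<subseteq> {..<m}" shows "span T \<in> S"
proof -
  have "finite T" using assms finite_subset by blast
  then show ?thesis using assms
  proof (induction T)
    case empty
    have "span {} = row 0" by (simp add: span_def fun_eq_iff)
    then show ?case using row_S by simp
  next
    case (insert i T)
    have "span (insert i T) = sup (row (Suc i)) (span T)"
    proof (rule antisym)
      have "row 0 \<le> span T \<and> (\<forall>i\<in>T. row (Suc i) \<le> span T)"
        using span_le_iff[OF insert.hyps(1), of "span T"] by simp
      then show "span (insert i T) \<le> sup (row (Suc i)) (span T)"
        using insert.hyps by (simp add: span_le_iff le_supI2)
      have "row 0 \<le> span (insert i T) \<and> (\<forall>j\<in>insert i T. row (Suc j) \<le> span (insert i T))"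
        using span_le_iff[of "insert i T" "span (insert i T)"] insert.hyps by simp
      then show "sup (row (Suc i)) (span T) \<le> span (insert i T)"
        using insert.hyps by (simp add: span_le_iff)
    qed
    moreover have "row (Suc i) \<in> S" "span T \<in> S" using insert row_S[of "Suc i"] by simp_all
    ultimately show ?case using S_sup by metis
  qed
qed

text \<open>This is join-primality. A row is the least vector reaching \<open>j\<close> in some
  coordinate \<open>w\<close>, and a coordinate of a maximum reaches \<open>j\<close> only if one of
  its terms does.\<close>

private lemma row_le_span_iff:
  assumes "T \<subseteq> {..<m}" "i < m"
  shows "row (Suc i) \<le> span T \<longleftrightarrow> (\<exists>a\<in>T. row (Suc i) \<le> row (Suc a))"
proof
  have fin: "finite T" using assms(1) finite_subset by blast
  show "\<exists>a\<in>T. row (Suc i) \<le> row (Suc a) \<Longrightarrow> row (Suc i) \<le> span T"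
  proof -
    assume "\<exists>a\<in>T. row (Suc i) \<le> row (Suc a)"
    then obtain a where a: "a \<in> T" "row (Suc i) \<le> row (Suc a)" by blast
    have "row (Suc a) \<le> span T" using span_le_iff[OF fin, of "span T"] a(1) by simp
    with a(2) show "row (Suc i) \<le> span T" by (rule order_trans)
  qed
  assume le: "row (Suc i) \<le> span T"
  obtain w j where J: "least_above (unit w j) (row (Suc i))" using row_irreducible assms(2) by blast
  then have "unit w j \<le> span T" using le by (auto simp: least_above_def)
  then have "j \<le> row 0 w \<or> (\<exists>a\<in>T. j \<le> row (Suc a) w)" by (simp add: unit_le_iff span_ge_iff fin)
  \<comment> \<open>The bottom cannot be that term, since the row would then coincide with it
    against injectivity of \<open>row\<close>.\<close>
  moreover have "\<not> j \<le> row 0 w"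
  proof
    assume "j \<le> row 0 w"
    then have "row (Suc i) \<le> row 0" using J row_S[of 0] by (simp add: least_above_def unit_le_iff)
    then have "row (Suc i) = row 0" using bot_least row_S[of "Suc i"] assms(2) by (simp add: antisym)
    then show False using inj_onD[OF inj, of "Suc i" 0] assms by auto
  qed
  ultimately obtain a where "a \<in> T" "j \<le> row (Suc a) w" by blast
  moreover from this have "row (Suc a) \<in> S" using assms(1) by (intro row_S) auto
  ultimately show "\<exists>a\<in>T. row (Suc i) \<le> row (Suc a)"
    using J by (auto simp: least_above_def unit_le_iff)
qed

private lemma span_below:
  assumes q: "q \<in> S" shows "span {i. i < m \<and> row (Suc i) \<le> q} = q" (is "span ?T = q")
proof (rule antisym)
  show "span ?T \<le> q" using bot_least[OF q] by (simp add: span_le_iff)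
  show "q \<le> span ?T"
  proof (rule le_funI)
    fix x
    show "q x \<le> span ?T x"
    proof (cases "x < n")
      case True
      \<comment> \<open>\<open>J\<close> reaches \<open>q x\<close> in coordinate \<open>x\<close>
        and lies below \<open>q\<close>; it is in the table either as a poset element or as the
        bottom, which \<open>span\<close> includes.\<close>
      obtain J where J: "least_above (unit x (q x)) J" "J \<le> q"
        using least_above_exists[OF q, of "unit x (q x)"] by (auto simp: unit_le_iff)
      then have "J \<in> irreducibles" using True SD(1)[OF q True] by (auto simp: irreducibles_def)
      then have "J \<in> row ` {..m}" using rows by simp
      then obtain i where i: "i \<le> m" "row i = J" by auto
      have "q x \<le> J x" using J by (simp add: least_above_def unit_le_iff)
      then show ?thesis using i J(2) by (cases i) (auto simp: span_ge_iff)
    qed (simp add: SD(2) q)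
  qed
qed

text \<open>The inverse of \<open>span\<close> maps \<open>q\<close> to the set of elements below
  \<open>q\<close>. Closed sets are thus recovered from their span by \<open>mem\<close>, and
  intersections become infima because lying below both spans means lying below their
  infimum.\<close>

lemma birkhoff_order_rows:
  assumes A: "A \<in> set As"
  shows "birkhoff_order {..<m} (row_order m row) A (common_stable n As)"
  unfolding birkhoff_order_def
proof (intro conjI exI ballI)
  let ?R = "row_order m row"
  have eqD: "i = j" if "i < m" "j < m" "row (Suc i) \<le> row (Suc j)" "row (Suc j) \<le> row (Suc i)" for i j
    using inj_onD[OF inj, of "Suc i" "Suc j"] that by (simp add: antisym)
  show "partial_order_on {..<m} ?R"
    unfolding partial_order_on_def preorder_on_def
  proof (intro conjI)
    show "trans ?R" by (rule transI) (clarsimp simp: row_order_def, erule (1) order_trans)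
    show "antisym ?R" by (rule antisymI) (simp add: row_order_def eqD)
  qed (auto simp: row_order_def refl_on_def)
  have cl: "T \<subseteq> {..<m}" "finite T" if "T \<in> closed_sets {..<m} ?R" for T
    using that finite_subset by (auto simp: closed_sets_def)
  have mem: "i \<in> T \<longleftrightarrow> i < m \<and> row (Suc i) \<le> span T" if T: "T \<in> closed_sets {..<m} ?R" for T i
  proof
    assume "i \<in> T"
    then show "i < m \<and> row (Suc i) \<le> span T" using row_le_span_iff[OF cl(1)[OF T]] cl(1)[OF T] by auto
  next
    assume i: "i < m \<and> row (Suc i) \<le> span T"
    then obtain a where "a \<in> T" "row (Suc i) \<le> row (Suc a)" using row_le_span_iff[OF cl(1)[OF T]] by blast
    then show "i \<in> T" using T i cl(1)[OF T] by (auto simp: closed_sets_def row_order_def)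
  qed
  then have below: "{i. i < m \<and> row (Suc i) \<le> span T} = T" if "T \<in> closed_sets {..<m} ?R" for T
    using that by blast
  have "bij_betw span (closed_sets {..<m} ?R) S"
    unfolding bij_betw_def
  proof (intro conjI inj_onI)
    fix T U assume "T \<in> closed_sets {..<m} ?R" "U \<in> closed_sets {..<m} ?R" "span T = span U"
    then show "T = U" using below[of T] below[of U] by metis
  next
    have "q \<in> span ` closed_sets {..<m} ?R" if q: "q \<in> S" for q
    proof -
      have "{i. i < m \<and> row (Suc i) \<le> q} \<in> closed_sets {..<m} ?R"
        by (clarsimp simp: closed_sets_def row_order_def subset_iff) (erule (1) order_trans)
      then show ?thesis by (rule rev_image_eqI) (rule span_below[OF q, symmetric])
    qed
    moreover have "span ` closed_sets {..<m} ?R \<subseteq> S"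
      by (rule image_subsetI, rule span_S, rule cl(1))
    ultimately show "span ` closed_sets {..<m} ?R = S" by blast
  qed
  then show "bij_betw (matching \<circ> span) (closed_sets {..<m} ?R) (common_stable n As)"
    using bij_betw_matching by (rule bij_betw_trans)
  fix T U assume T: "T \<in> closed_sets {..<m} ?R" and U: "U \<in> closed_sets {..<m} ?R"
  note cT = cl[OF T] and cU = cl[OF U]
  have sS: "span T \<in> S" "span U \<in> S" by (rule span_S[OF cT(1)], rule span_S[OF cU(1)])
  show "(matching \<circ> span) (T \<union> U) = join A ((matching \<circ> span) T) ((matching \<circ> span) U)"
    using matching_join(1)[OF sS A] span_union[OF cT(2) cU(2)] by simp
  have "span (T \<inter> U) = span {i. i < m \<and> row (Suc i) \<le> inf (span T) (span U)}"
    by (intro arg_cong[where f = span] set_eqI) (auto simp: mem[OF T] mem[OF U])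
  also have "\<dots> = inf (span T) (span U)" using sS by (intro span_below S_inf)
  finally show "(matching \<circ> span) (T \<inter> U) = meet A ((matching \<circ> span) T) ((matching \<circ> span) U)"
    using matching_join(2)[OF sS A] by simp
qed simp

end

section \<open>Lexicographic successors\<close>

definition lex_less :: "(nat \<Rightarrow> nat) \<Rightarrow> (nat \<Rightarrow> nat) \<Rightarrow> bool" where
  "lex_less p q \<longleftrightarrow> (\<exists>i<n. (\<forall>x<i. p x = q x) \<and> p i < q i)"

lemma lex_less_irrefl: "\<not> lex_less p p"
  by (simp add: lex_less_def)

lemma lex_less_trans: "lex_less p q \<Longrightarrow> lex_less q r \<Longrightarrow> lex_less p r"
  unfolding lex_less_def
proof (elim exE conjE)
  fix i j assume h: "i < n" "\<forall>x<i. p x = q x" "p i < q i" "j < n" "\<forall>x<j. q x = r x" "q j < r j"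
  define k where "k = min i j"
  have "k < n" "\<forall>x<k. p x = r x" using h by (simp_all add: k_def)
  moreover have "p k < r k"
    using h by (cases i j rule: linorder_cases) (simp_all add: k_def min_def)
  ultimately show "\<exists>k<n. (\<forall>x<k. p x = r x) \<and> p k < r k" by blast
qed

lemma le_imp_lex_less:
  assumes "p \<le> q" "p \<noteq> q" "\<forall>w\<ge>n. p w = 0" "\<forall>w\<ge>n. q w = 0"
  shows "lex_less p q"
proof -
  have "\<exists>x. p x \<noteq> q x" using assms(2) by auto
  then obtain i where i: "p i \<noteq> q i" "\<And>x. x < i \<Longrightarrow> p x = q x"
    using exists_least_iff[of "\<lambda>x. p x \<noteq> q x"] by auto
  then have "i < n" using assms(3,4) by (metis not_le)
  moreover have "p i < q i" using le_funD[OF assms(1), of i] i(1) by simp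
  ultimately show ?thesis using i(2) by (auto simp: lex_less_def)
qed

definition bump :: "(nat \<Rightarrow> nat) \<Rightarrow> nat \<Rightarrow> nat \<Rightarrow> nat" where
  "bump q i = (\<lambda>x. if x < i then q x else if x = i then Suc (q i) else 0)"

definition candidate :: "(nat \<Rightarrow> nat) \<Rightarrow> nat \<Rightarrow> (nat \<Rightarrow> nat) \<Rightarrow> bool" where
  "candidate q i p \<longleftrightarrow> least_above (bump q i) p \<and> (\<forall>x<i. p x = q x)"

lemma candidate_lex_less:
  assumes "candidate q i p" "i < n" shows "p \<in> S \<and> lex_less q p"
proof -
  have "bump q i i \<le> p i" using assms(1) by (simp add: candidate_def least_above_def le_fun_def)
  then have "q i < p i" by (simp add: bump_def)
  then show ?thesis using assms by (auto simp: candidate_def least_above_def lex_less_def)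
qed

text \<open>The least vector above \<open>bump q i\<close> is squeezed between
  \<open>bump q i\<close> and \<open>r\<close>, both of which agree with \<open>q\<close> before
  \<open>i\<close>.\<close>

lemma lex_less_candidate:
  assumes "r \<in> S" "i < n" "\<forall>x<i. q x = r x" "q i < r i"
  obtains p where "candidate q i p" "p \<le> r"
proof -
  have "bump q i \<le> r" using assms by (auto simp: bump_def le_fun_def)
  then obtain p where p: "least_above (bump q i) p" "p \<le> r" using least_above_exists assms(1) by blast
  have "p x = q x" if "x < i" for x
  proof -
    have "bump q i x \<le> p x" using p by (simp add: least_above_def le_fun_def)
    then show ?thesis using that le_funD[OF p(2), of x] assms(3) by (simp add: bump_def)
  qed
  then show thesis using that p by (auto simp: candidate_def)
qed

text \<open>By \<open>lex_less_candidate\<close> the first difference \<open>j\<close> between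
  \<open>q\<close> and \<open>r\<close> carries a candidate, so \<open>j\<close> is at most
  \<open>i\<close>. If it is smaller, \<open>r\<close> exceeds \<open>p\<close>, which still agrees
  with \<open>q\<close> there; if it equals \<open>i\<close>, leastness puts \<open>p\<close> below
  \<open>r\<close>.\<close>

lemma lex_successor:
  assumes p: "candidate q i p" "i < n"
    and none: "\<And>i' p'. i < i' \<Longrightarrow> i' < n \<Longrightarrow> \<not> candidate q i' p'"
    and r: "r \<in> S" "lex_less q r"
  shows "r = p \<or> lex_less p r"
proof -
  obtain j where j: "j < n" "\<forall>x<j. q x = r x" "q j < r j" using r(2) by (auto simp: lex_less_def)
  obtain p' where p': "candidate q j p'" "p' \<le> r" using lex_less_candidate[OF r(1) j] by blast
  have "j \<le> i" using none[OF _ j(1)] p'(1) by (meson not_le)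
  moreover have "lex_less p r" if "j < i"
    using that p(1) j by (auto simp: candidate_def lex_less_def intro!: exI[of _ j])
  moreover have "r = p \<or> lex_less p r" if "j = i"
  proof -
    have "p = p'" using p(1) p'(1) that least_above_unique by (auto simp: candidate_def)
    then show ?thesis
      using p' le_imp_lex_less[of p r] SD(2) r(1) candidate_lex_less[OF p] by auto
  qed
  ultimately show ?thesis by linarith
qed

end

section \<open>Reading the input\<close>

text \<open>Array numbers: number of instances, \<open>n\<^sup>2 + 1\<close>, multiples of \<open>n\<close>, starts of the firms' lists
  of the instances, working vector and its failure flag, current vector, emptiness flag, output and
  its length, table of vectors with its number of rows, flags for a new row and for a comparison,
  and the continuation flag and next vector of the enumeration. Loop counters are 20 and above.\<close>

abbreviation (input) "aK \<equiv> 2::nat"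
abbreviation (input) "aSQ \<equiv> 3::nat"
abbreviation (input) "aWN \<equiv> 4::nat"
abbreviation (input) "aIO \<equiv> 5::nat"
abbreviation (input) "aP \<equiv> 6::nat"
abbreviation (input) "aFail \<equiv> 7::nat"
abbreviation (input) "aQ \<equiv> 8::nat"
abbreviation (input) "aBad \<equiv> 9::nat"
abbreviation (input) "aOut \<equiv> 10::nat"
abbreviation (input) "aLen \<equiv> 11::nat"
abbreviation (input) "aTab \<equiv> 12::nat"
abbreviation (input) "aCnt \<equiv> 13::nat"
abbreviation (input) "aNew \<equiv> 14::nat"
abbreviation (input) "aEq \<equiv> 15::nat"
abbreviation (input) "aGo \<equiv> 16::nat"
abbreviation (input) "aZ \<equiv> 17::nat"

definition assign :: "nat \<Rightarrow> exp \<Rightarrow> fcom" (infix \<open>::=\<close> 65) where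
  "v ::= e = Asg v (Const 0) e"

lemma assign_simps [simp]:
  "sem (v ::= e) m = upd v 0 (val e m) m" "mods (v ::= e) = {v}" "bounds (v ::= e) = {}"
  "counters_safe (v ::= e)"
  by (simp_all add: assign_def)

section \<open>Effects of array-filling and flag-setting loops\<close>

lemma sem_fill:
  assumes vc: "v \<notin> mods c" "b \<noteq> v" "a \<noteq> v"
    and step: "\<And>i m'. i < m b 0 \<Longrightarrow> m' v 0 = i \<Longrightarrow>
      (\<And>a. a \<notin> insert v (mods c) \<Longrightarrow> m' a = m a) \<Longrightarrow> sem c m' a = (m' a)(off + i := g i)"
  shows "sem (For v b c) m a = (\<lambda>x. if off \<le> x \<and> x < off + m b 0 then g (x - off) else m a x)"
proof (rule sem_For_induct[where I = "\<lambda>i m'. m' a = (\<lambda>x. if off \<le> x \<and> x < off + i then g (x - off) else m a x)", OF vc(1,2)])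
  show "upd v 0 0 m a = (\<lambda>x. if off \<le> x \<and> x < off + 0 then g (x - off) else m a x)"
    using vc(3) by (auto simp: upd_apply fun_eq_iff)
next
  fix i m'
  assume i: "i < m b 0" and I: "m' a = (\<lambda>x. if off \<le> x \<and> x < off + i then g (x - off) else m a x)"
    and v: "m' v 0 = i" and fr: "\<And>a. a \<notin> insert v (mods c) \<Longrightarrow> m' a = m a"
  have st: "sem c m' a = (m' a)(off + i := g i)" by (rule step[of i m', OF i v]) (rule fr)
  have "sem c m' a = (\<lambda>x. if off \<le> x \<and> x < off + Suc i then g (x - off) else m a x)"
    unfolding st I by (auto simp: fun_eq_iff)
  then show "upd v 0 (Suc i) (sem c m') a = (\<lambda>x. if off \<le> x \<and> x < off + Suc i then g (x - off) else m a x)"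
    using vc(3) by (simp add: upd_apply)
qed

lemma sem_flag:
  assumes vc: "b \<noteq> v" "a \<noteq> v"
    and step: "\<And>i m'. i < m b 0 \<Longrightarrow> m' v 0 = i \<Longrightarrow>
      (\<And>a'. a' \<noteq> v \<Longrightarrow> a' \<noteq> a \<Longrightarrow> m' a' = m a') \<Longrightarrow> val e m' \<noteq> 0 \<longleftrightarrow> C i"
  shows "sem (For v b (FIf e (a ::= Const x) FSkip)) m a 0 = (if \<exists>i<m b 0. C i then x else m a 0)"
proof (rule sem_For_induct[where I = "\<lambda>i m'. m' a 0 = (if \<exists>j<i. C j then x else m a 0)"])
  fix i m'
  assume i: "i < m b 0" and I: "m' a 0 = (if \<exists>j<i. C j then x else m a 0)"
    and v: "m' v 0 = i" and fr: "\<And>a'. a' \<notin> insert v (mods (FIf e (a ::= Const x) FSkip)) \<Longrightarrow> m' a' = m a'"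
  have "val e m' \<noteq> 0 \<longleftrightarrow> C i" by (rule step[of i m', OF i v]) (simp add: fr)
  then show "upd v 0 (Suc i) (sem (FIf e (a ::= Const x) FSkip) m') a 0 = (if \<exists>j<Suc i. C j then x else m a 0)"
    using vc I by (auto simp: upd_apply less_Suc_eq)
qed (use vc in \<open>simp_all add: upd_apply\<close>)

lemma sem_copy_arr:
  assumes "v \<noteq> a" "v \<noteq> b" "v \<noteq> bd" "a \<noteq> b"
  shows "sem (copy_arr v bd a b) m a = (\<lambda>x. if x < m bd 0 then m b x else m a x)"
  unfolding copy_arr_def
  by (subst sem_fill[where off = 0 and g = "m b"]) (use assms in \<open>auto simp: upd_apply\<close>)

lemma copy_arr_simps [simp]:
  "mods (copy_arr v bd a b) = {v, a}" "bounds (copy_arr v bd a b) = {bd}"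
  "counters_safe (copy_arr v bd a b) \<longleftrightarrow> v \<noteq> a"
  by (auto simp: copy_arr_def)

lemma concat_nth:
  assumes "\<And>xs. xs \<in> set xss \<Longrightarrow> length xs = L" "i < length xss" "j < L"
  shows "concat xss ! (i * L + j) = xss ! i ! j"
  using assms
proof (induction xss arbitrary: i)
  case (Cons xs xss)
  show ?case
  proof (cases i)
    case (Suc i')
    have "concat (xs # xss) ! (i * L + j) = concat xss ! (i' * L + j)"
      using Cons.prems(1)[of xs] Suc by (simp add: nth_append)
    then show ?thesis using Cons Suc by simp
  qed (use Cons.prems in \<open>simp add: nth_append\<close>)
qed simp

lemma length_concat_uniform:
  "(\<And>xs. xs \<in> set xss \<Longrightarrow> length xs = L) \<Longrightarrow> length (concat xss) = length xss * L"
  by (induction xss) auto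

definition wpref_exp :: "exp \<Rightarrow> exp \<Rightarrow> exp" where
  "wpref_exp w j = Cell 0 (Plus (Const 2) (Plus (Cell aWN w) j))"
definition fpref_exp :: "exp \<Rightarrow> exp \<Rightarrow> exp \<Rightarrow> exp" where
  "fpref_exp i f a = Cell 0 (Plus (Cell aIO i) (Plus (Cell aWN f) a))"

text \<open>For \<open>n = 0\<close> the instances contribute nothing to the input, whose size is then only
  logarithmic in their number; the number of instances is therefore copied only if \<open>n > 0\<close>.\<close>

definition setup1 :: fcom where
  "setup1 = FIf (Var 0) (aK ::= Cell 0 (Const 1)) FSkip ;;
     For 20 0 (aSQ ::= Plus (Var aSQ) (Var 0)) ;; aSQ ::= Plus (Var aSQ) (Const 1)"

text \<open>\<open>aSQ\<close> holds \<open>n * n + 1\<close>. Hence \<open>aSQ + 1\<close> is the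
  offset of the first instance's firm lists, after two header cells and \<open>n * n\<close> worker
  entries, and \<open>2 * aSQ - 2\<close> is the length of one instance. Multiples of
  \<open>n\<close> are tabulated far enough to address \<open>n * n + 1\<close> rows of
  vectors.\<close>

definition setup2 :: fcom where
  "setup2 = For 20 aSQ (Asg aWN (Plus (Var 20) (Const 1)) (Plus (Cell aWN (Var 20)) (Var 0))) ;;
     aIO ::= Plus (Var aSQ) (Const 1) ;;
     For 20 aK (Asg aIO (Plus (Var 20) (Const 1))
       (Plus (Cell aIO (Var 20)) (Minus (Plus (Var aSQ) (Var aSQ)) (Const 2))))"

definition violated_exp :: exp where
  "violated_exp = (let p = Cell aP (Var 21); f = wpref_exp (Var 21) p in
     EAnd (ELess p (Var 0)) (EAnd (ENot (ELess (Cell aP (Var 22)) (Var 23)))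
       (EAnd (EEq (wpref_exp (Var 22) (Var 23)) f) (EAnd (ELess (Var 25) (Var 26))
         (EAnd (EEq (fpref_exp (Var 24) f (Var 25)) (Var 22)) (EEq (fpref_exp (Var 24) f (Var 26)) (Var 21)))))))"

definition pass_body :: fcom where
  "pass_body = FIf violated_exp (Asg aP (Var 21) (Plus (Cell aP (Var 21)) (Const 1))) FSkip"

definition pass :: fcom where
  "pass = For 21 0 (For 22 0 (For 23 0 (For 24 aK (For 25 0 (For 26 0 pass_body)))))"

text \<open>The round count \<open>aSQ\<close> exceeds \<open>n * n\<close>, the largest possible
  sum of the pointers; a pointer that has reached \<open>n\<close> has run off its list.\<close>

definition advance :: fcom where
  "advance = For 20 aSQ pass ;; aFail ::= Const 0 ;;
     For 21 0 (FIf (ENot (ELess (Cell aP (Var 21)) (Var 0))) (aFail ::= Const 1) FSkip)"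

lemma mods_advance [simp]: "mods advance = {aP, aFail, 20, 21, 22, 23, 24, 25, 26}"
  and bounds_advance [simp]: "bounds advance = {0, aK, aSQ}"
  and counters_safe_advance [simp]: "counters_safe advance"
  by (auto simp: advance_def pass_def pass_body_def)

section \<open>Layout of the encoded input\<close>

context common_stable_matchings
begin

definition init_mem :: memory where
  "init_mem = mem (initial_state (enc_input (n, As)))"

text \<open>The conditions on the number of instances and on \<open>aIO\<close> are restricted to
  \<open>0 < n\<close> since \<open>setup1\<close> leaves \<open>aK\<close> at 0 when
  \<open>n = 0\<close>.\<close>

definition consts_ok :: "memory \<Rightarrow> bool" where
  "consts_ok m \<longleftrightarrow> m 0 = init_mem 0 \<and> (0 < n \<longrightarrow> m aK 0 = length As) \<and> m aSQ 0 = n * n + 1 \<and>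
     (\<forall>i\<le>n * n + 1. m aWN i = i * n) \<and>
     (0 < n \<longrightarrow> (\<forall>i<length As. m aIO i = 2 + n * n + i * (2 * n * n)))"

lemma consts_ok_cong: "(\<And>a. a < 6 \<Longrightarrow> m' a = m a) \<Longrightarrow> consts_ok m' = consts_ok m"
  by (simp add: consts_ok_def)

lemma length_prefs:
  assumes "A \<in> set As" "w < n" shows "length (wpref A w) = n" "length (fpref A w) = n"
  using valid[OF assms(1)] assms(2) pref_listD(1) by (auto simp: valid_instance_def)

lemma length_concat_prefs:
  assumes "A \<in> set As"
  shows "length (concat (map (wpref A) [0..<n])) = n * n" "length (concat (map (fpref A) [0..<n])) = n * n"
  by (subst length_concat_uniform[of _ n]; use length_prefs[OF assms] in force)+

lemma length_enc_instance: "A \<in> set As \<Longrightarrow> length (enc_instance n A) = 2 * n * n"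
  by (simp add: enc_instance_def length_concat_prefs)

lemma length_enc_input: "length (enc_input (n, As)) = 2 + length As * (2 * n * n)"
  using length_concat_uniform[of "map (enc_instance n) As" "2 * n * n"] length_enc_instance
  by (auto simp: enc_input_def)

lemma idx_less: "i < k \<Longrightarrow> j < L \<Longrightarrow> i * L + j < k * (L :: nat)"
proof -
  assume "i < k" "j < L"
  then have "i * L + j < Suc i * L" "Suc i * L \<le> k * L" by (simp, intro mult_le_mono1, simp)
  then show ?thesis by linarith
qed

lemma init_mem_0: "init_mem 0 0 = n" "init_mem 0 (Suc 0) = length As"
  by (simp_all add: init_mem_def initial_state_def enc_input_def)

lemma init_mem_nth:
  assumes "i < length As" "j < 2 * n * n"
  shows "init_mem 0 (2 + i * (2 * n * n) + j) = enc_instance n (As ! i) ! j"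
proof -
  have "i * (2 * n * n) + j < length As * (2 * n * n)" using idx_less assms .
  then have "init_mem 0 (2 + i * (2 * n * n) + j) = enc_input (n, As) ! (2 + i * (2 * n * n) + j)"
    unfolding init_mem_def initial_state_def using length_enc_input by simp
  also have "\<dots> = concat (map (enc_instance n) As) ! (i * (2 * n * n) + j)"
    by (simp add: enc_input_def eval_nat_numeral)
  also have "\<dots> = enc_instance n (As ! i) ! j"
    using assms length_enc_instance by (subst concat_nth) auto
  finally show ?thesis .
qed

lemma enc_instance_nth:
  assumes "A \<in> set As" "w < n" "j < n"
  shows "enc_instance n A ! (w * n + j) = wpref A w ! j"
    and "enc_instance n A ! (n * n + (w * n + j)) = fpref A w ! j"
proof -
  note l = length_concat_prefs(1)[OF assms(1)]
  have "w * n + j < n * n" using idx_less assms(2,3) .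
  then show "enc_instance n A ! (w * n + j) = wpref A w ! j"
    using length_prefs[OF assms(1)] assms l
    by (simp add: enc_instance_def nth_append) (subst concat_nth, auto)
  show "enc_instance n A ! (n * n + (w * n + j)) = fpref A w ! j"
    using length_prefs[OF assms(1)] assms l
    by (simp add: enc_instance_def nth_append) (subst concat_nth, auto)
qed

lemma input_wpref:
  assumes "w < n" "j < n" shows "init_mem 0 (2 + (w * n + j)) = wl w ! j"
proof -
  have "w * n + j < n * n" using idx_less assms .
  then have "w * n + j < 2 * n * n" by simp
  then show ?thesis
    using init_mem_nth[of 0 "w * n + j"] enc_instance_nth(1)[of "As ! 0" w j] nonempty assms
    by (simp add: wl_def)
qed

lemma input_fpref:
  assumes "i < length As" "f < n" "a < n"
  shows "init_mem 0 (2 + n * n + i * (2 * n * n) + (f * n + a)) = fl i f ! a"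
proof -
  have "f * n + a < n * n" using idx_less assms(2,3) .
  then have "n * n + (f * n + a) < 2 * n * n" by simp
  then show ?thesis
    using init_mem_nth[of i "n * n + (f * n + a)"] enc_instance_nth(2)[of "As ! i" f a] assms
    by (simp add: fl_def ac_simps)
qed

lemma consts_ok_n: "consts_ok m \<Longrightarrow> m 0 0 = n"
  by (simp add: consts_ok_def init_mem_0)

lemma le_square_Suc: "f < n \<Longrightarrow> f \<le> n * n + 1"
  using le_square[of n] by linarith

lemma val_wpref_exp:
  assumes "consts_ok m" "val w m < n" "val j m < n"
  shows "val (wpref_exp w j) m = wl (val w m) ! val j m"
  using assms input_wpref[of "val w m" "val j m"] le_square_Suc[of "val w m"]
  by (simp add: wpref_exp_def consts_ok_def)

lemma val_fpref_exp:
  assumes "consts_ok m" "val i m < length As" "val f m < n" "val a m < n"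
  shows "val (fpref_exp i f a) m = fl (val i m) (val f m) ! val a m"
  using assms input_fpref[of "val i m" "val f m" "val a m"] le_square_Suc[of "val f m"]
  by (simp add: fpref_exp_def consts_ok_def)


end

section \<open>Pointer advancing\<close>

context common_stable_matchings
begin

lemma sem_setup1:
  "sem setup1 init_mem 0 = init_mem 0"
  "sem setup1 init_mem aK 0 = (if n = 0 then 0 else length As)"
  "sem setup1 init_mem aSQ 0 = n * n + 1"
  "a \<notin> {0, aK, aSQ, 20} \<Longrightarrow> sem setup1 init_mem a = (\<lambda>_. 0)"
proof -
  have z: "init_mem a = (\<lambda>_. 0)" if "a \<noteq> 0" for a
    using that by (simp add: init_mem_def initial_state_def)
  define c1 where "c1 = FIf (Var 0) (aK ::= Cell 0 (Const 1)) FSkip"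
  define m1 where "m1 = sem c1 init_mem"
  define c2 where "c2 = For 20 0 (aSQ ::= Plus (Var aSQ) (Var 0))"
  have "m1 0 = init_mem 0" "m1 aSQ = init_mem aSQ"
    unfolding m1_def by (simp_all add: sem_frame c1_def del: sem.simps)
  moreover have "m1 aK 0 = (if init_mem 0 0 = 0 then init_mem aK 0 else init_mem 0 (Suc 0))"
    by (simp add: m1_def c1_def upd_apply)
  ultimately have m1: "m1 0 = init_mem 0" "m1 aSQ = (\<lambda>_. 0)" "m1 aK 0 = (if n = 0 then 0 else length As)"
    by (simp_all only: init_mem_0 z[of aK] z[of aSQ])
  have "sem c2 m1 aSQ 0 = m1 0 0 * n"
    unfolding c2_def
  proof (rule sem_For_induct[where I = "\<lambda>i m'. m' aSQ 0 = i * n"])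
    fix i m' assume "m' aSQ 0 = i * n"
      and fr: "\<And>a. a \<notin> insert 20 (mods (aSQ ::= Plus (Var aSQ) (Var 0))) \<Longrightarrow> m' a = m1 a"
    moreover have "m' 0 = m1 0" by (rule fr) simp
    ultimately show "upd 20 0 (Suc i) (sem (aSQ ::= Plus (Var aSQ) (Var 0)) m') aSQ 0 = Suc i * n"
      by (simp add: upd_apply m1 init_mem_0)
  qed (simp_all add: upd_apply m1)
  then have sq: "sem c2 m1 aSQ 0 = n * n" by (simp add: m1 init_mem_0)
  have eq: "sem setup1 init_mem = upd aSQ 0 (sem c2 m1 aSQ 0 + 1) (sem c2 m1)"
    by (simp add: setup1_def c1_def c2_def m1_def)
  have fr: "sem c2 m1 a = m1 a" if "a \<notin> {20, aSQ}" for a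
    using that by (intro sem_frame) (simp add: c2_def)
  show "sem setup1 init_mem 0 = init_mem 0"
    "sem setup1 init_mem aK 0 = (if n = 0 then 0 else length As)"
    "sem setup1 init_mem aSQ 0 = n * n + 1"
    by (simp_all add: eq upd_apply fr m1 sq)
  show "sem setup1 init_mem a = (\<lambda>_. 0)" if "a \<notin> {0, aK, aSQ, 20}"
  proof -
    have "sem setup1 init_mem a = init_mem a" using that by (intro sem_frame) (simp add: setup1_def)
    then show ?thesis using z that by simp
  qed
qed

lemma consts_ok_setup2: "consts_ok (sem setup2 (sem setup1 init_mem))"
proof -
  define m0 where "m0 = sem setup1 init_mem"
  note m0 = sem_setup1[folded m0_def]
  define b1 where "b1 = Asg aWN (Plus (Var 20) (Const 1)) (Plus (Cell aWN (Var 20)) (Var 0))"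
  define m1 where "m1 = sem (For 20 aSQ b1) m0"
  have fr1: "m1 a = m0 a" if "a \<notin> {20, aWN}" for a
    using that unfolding m1_def by (intro sem_frame) (simp add: b1_def)
  have wn: "\<forall>i\<le>m0 aSQ 0. m1 aWN i = i * n"
    unfolding m1_def
  proof (rule sem_For_induct[where I = "\<lambda>k m'. \<forall>i\<le>k. m' aWN i = i * n"])
    fix i m' assume "\<forall>j\<le>i. m' aWN j = j * n" "m' 20 0 = i"
      and fr: "\<And>a. a \<notin> insert 20 (mods b1) \<Longrightarrow> m' a = m0 a"
    moreover have "m' 0 = m0 0" by (rule fr) (simp add: b1_def)
    ultimately show "\<forall>j\<le>Suc i. upd 20 0 (Suc i) (sem b1 m') aWN j = j * n"
      by (auto simp: upd_apply b1_def m0 init_mem_0 le_Suc_eq)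
  qed (simp_all add: b1_def upd_apply m0)
  define m2 where "m2 = sem (aIO ::= Plus (Var aSQ) (Const 1)) m1"
  have m2: "m2 aIO 0 = n * n + 2" "\<And>a. a \<noteq> aIO \<Longrightarrow> m2 a = m1 a"
    by (simp_all add: m2_def upd_apply fr1 m0)
  define b3 where "b3 = Asg aIO (Plus (Var 20) (Const 1))
       (Plus (Cell aIO (Var 20)) (Minus (Plus (Var aSQ) (Var aSQ)) (Const 2)))"
  define m3 where "m3 = sem (For 20 aK b3) m2"
  have fr3: "m3 a = m2 a" if "a \<notin> {20, aIO}" for a
    using that unfolding m3_def by (intro sem_frame) (simp add: b3_def)
  have io: "\<forall>i\<le>m2 aK 0. m3 aIO i = 2 + n * n + i * (2 * n * n)"
    unfolding m3_def
  proof (rule sem_For_induct[where I = "\<lambda>k m'. \<forall>i\<le>k. m' aIO i = 2 + n * n + i * (2 * n * n)"])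
    fix i m' assume "\<forall>j\<le>i. m' aIO j = 2 + n * n + j * (2 * n * n)" "m' 20 0 = i"
      and fr: "\<And>a. a \<notin> insert 20 (mods b3) \<Longrightarrow> m' a = m2 a"
    moreover have "m' aSQ = m2 aSQ" by (rule fr) (simp add: b3_def)
    ultimately show "\<forall>j\<le>Suc i. upd 20 0 (Suc i) (sem b3 m') aIO j = 2 + n * n + j * (2 * n * n)"
      by (auto simp: upd_apply b3_def m2 fr1 m0 le_Suc_eq)
  qed (simp_all add: b3_def upd_apply m2)
  have "sem setup2 m0 = m3"
    by (simp add: setup2_def m3_def b3_def m2_def m1_def b1_def)
  moreover have "consts_ok m3"
    using wn io by (simp add: consts_ok_def fr3 m2 fr1 m0)
  ultimately show ?thesis by (simp add: m0_def)
qed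

lemma setup2_zero: "a \<notin> {0, aK, aSQ, aWN, aIO, 20} \<Longrightarrow> sem setup2 (sem setup1 init_mem) a = (\<lambda>_. 0)"
  by (subst sem_frame) (auto simp: setup2_def sem_setup1)

lemma consts_ok_K: "consts_ok m \<Longrightarrow> w < n \<Longrightarrow> m aK 0 = length As"
  by (simp add: consts_ok_def)

text \<open>Programs only touch the first \<open>n\<close> cells of a position array; the others may hold junk.\<close>

definition restr :: "(nat \<Rightarrow> nat) \<Rightarrow> nat \<Rightarrow> nat" where
  "restr p w = (if w < n then p w else 0)"

lemma restr_mono: "p \<le> q \<Longrightarrow> restr p \<le> restr q"
  by (simp add: restr_def le_fun_def)

text \<open>The third conjunct keeps the pointer sum bounded; the last one is safety: no common
  stable vector above the old pointers is passed. Fixing the cells from \<open>n\<close> on makes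
  every change visible in the sum.\<close>

definition adv :: "(nat \<Rightarrow> nat) \<Rightarrow> (nat \<Rightarrow> nat) \<Rightarrow> bool" where
  "adv p p' \<longleftrightarrow> p \<le> p' \<and> (\<forall>w\<ge>n. p' w = p w) \<and> ((\<forall>w<n. p w \<le> n) \<longrightarrow> (\<forall>w<n. p' w \<le> n)) \<and>
     (\<forall>q\<in>S. restr p \<le> q \<longrightarrow> restr p' \<le> q)"

lemma adv_order: "reflp adv" "transp adv" "antisymp adv"
proof -
  show "reflp adv" by (rule reflpI) (simp add: adv_def)
  show "antisymp adv" by (rule antisympI, rule order.antisym) (simp_all add: adv_def)
  show "transp adv"
  proof (rule transpI)
    fix x y z assume xy: "adv x y" and yz: "adv y z"
    have "x \<le> z" using xy yz order_trans[of x y z] by (simp add: adv_def)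
    then show "adv x z" using xy yz by (simp add: adv_def)
  qed
qed

text \<open>Constants live in arrays below 6 and the body only writes from 6 on, so
  \<open>consts_ok\<close> reaches every round.\<close>

lemma For_adv:
  assumes ok: "consts_ok m" and vc: "v \<notin> mods c" "b \<noteq> v" "6 < v" "\<forall>a\<in>mods c. 6 \<le> a" and B: "m b 0 = B"
    and step: "\<And>i m'. i < B \<Longrightarrow> consts_ok m' \<Longrightarrow> m' v 0 = i \<Longrightarrow>
      (\<And>a. a \<notin> insert v (mods c) \<Longrightarrow> m' a = m a) \<Longrightarrow> progress adv (G i) (m' aP) (sem c m' aP)"
  shows "progress adv (\<lambda>x. \<forall>i<B. G i x) (m aP) (sem (For v b c) m aP)"
  unfolding B[symmetric]
proof (rule sem_For_progress[OF adv_order vc(1,2)])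
  fix i m' assume i: "i < m b 0" "m' v 0 = i" and fr: "\<And>a. a \<notin> insert v (mods c) \<Longrightarrow> m' a = m a"
  have "m' a = m a" if "a < 6" for a
    by (rule fr) (use that vc(3,4) in auto)
  then have "consts_ok m'" using ok consts_ok_cong[of m' m] by blast
  then show "progress adv (G i) (m' aP) (sem c m' aP)"
    using i(1) B by (intro step[of i m'] i(2) fr) simp_all
qed (use vc in simp)

lemma val_violated_exp:
  assumes "consts_ok m" "m 21 0 = w" "m 22 0 = w'" "m 23 0 = j" "m 24 0 = i" "m 25 0 = a" "m 26 0 = b"
    and "w < n" "w' < n" "j < n" "i < length As" "a < n" "b < n"
  shows "val violated_exp m \<noteq> 0 \<longleftrightarrow> violated (m aP) w w' j i a b"
proof (cases "m aP w < n")
  case True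
  then have "wl w ! m aP w < n" using pref_listD(4)[OF pref_list_wl] assms by blast
  then show ?thesis using True assms
    by (auto simp: violated_exp_def violated_def Let_def val_wpref_exp val_fpref_exp consts_ok_n)
qed (use assms in \<open>simp add: violated_exp_def violated_def Let_def consts_ok_n\<close>)

lemma pass_body_progress:
  assumes h: "consts_ok m" "m 21 0 = w" "m 22 0 = w'" "m 23 0 = j" "m 24 0 = i" "m 25 0 = a" "m 26 0 = b"
    "w < n" "w' < n" "j < n" "i < length As" "a < n" "b < n"
  shows "progress adv (\<lambda>p. \<not> violated p w w' j i a b) (m aP) (sem pass_body m aP)"
proof (cases "violated (m aP) w w' j i a b")
  case True
  let ?p = "m aP"
  let ?p' = "?p(w := Suc (?p w))"
  have eq: "sem pass_body m aP = ?p'"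
    using True val_violated_exp[OF h] h(2) by (simp add: pass_body_def upd_apply)
  have "restr ?p' \<le> q" if q: "q \<in> S" "restr ?p \<le> q" for q
  proof -
    \<comment> \<open>\<open>violated_advance\<close> speaks about vectors below elements of
      \<open>S\<close>, hence the passage to \<open>restr\<close>; the strict increase it yields
      leaves room for the new pointer.\<close>
    have "violated (restr ?p) w w' j i a b" using True h by (simp add: violated_def restr_def)
    from violated_advance[OF this q h(8-)] have "Suc (?p w) \<le> q w" using h(8) by (simp add: restr_def)
    then show ?thesis
    proof (intro le_funI)
      fix x show "restr ?p' x \<le> q x"
        using le_funD[OF q(2), of x] \<open>Suc (?p w) \<le> q w\<close> by (auto simp: restr_def split: if_splits)
    qed
  qed
  then have "adv ?p ?p'" using True h(8) by (auto simp: adv_def le_fun_def violated_def)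
  then show ?thesis using True unfolding progress_def eq by (auto simp: fun_upd_idem_iff)
next
  case False
  then have "sem pass_body m aP = m aP"
    using val_violated_exp[OF h] by (simp add: pass_body_def)
  then show ?thesis using False adv_order(1) by (simp add: progress_def reflpD)
qed

definition unviolated :: "(nat \<Rightarrow> nat) \<Rightarrow> bool" where
  "unviolated p \<longleftrightarrow> (\<forall>w<n. \<forall>w'<n. \<forall>j<n. \<forall>i<length As. \<forall>a<n. \<forall>b<n. \<not> violated p w w' j i a b)"

lemma pass_progress:
  assumes "consts_ok m" shows "progress adv unviolated (m aP) (sem pass m aP)"
  unfolding unviolated_def pass_def
  apply (insert assms)
  apply (rule For_adv, assumption, (simp add: pass_body_def), (simp add: pass_body_def), (simp add: pass_body_def), (simp add: pass_body_def), rule consts_ok_n, assumption)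
  apply (rule For_adv, assumption, (simp add: pass_body_def), (simp add: pass_body_def), (simp add: pass_body_def), (simp add: pass_body_def), rule consts_ok_n, assumption)
  apply (rule For_adv, assumption, (simp add: pass_body_def), (simp add: pass_body_def), (simp add: pass_body_def), (simp add: pass_body_def), rule consts_ok_n, assumption)
  \<comment> \<open>This loop ranges over the instances; its bound is known only for positive
    \<open>n\<close>, and the enclosing worker loops supply some \<open>w < n\<close>.\<close>
  apply (rule For_adv, assumption, (simp add: pass_body_def), (simp add: pass_body_def), (simp add: pass_body_def), (simp add: pass_body_def), rule consts_ok_K, assumption, assumption)
  apply (rule For_adv, assumption, (simp add: pass_body_def), (simp add: pass_body_def), (simp add: pass_body_def), (simp add: pass_body_def), rule consts_ok_n, assumption)
  apply (rule For_adv, assumption, (simp add: pass_body_def), (simp add: pass_body_def), (simp add: pass_body_def), (simp add: pass_body_def), rule consts_ok_n, assumption)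
  apply (rule pass_body_progress)
  apply (simp_all add: pass_body_def)
  done

text \<open>At the fixed point no violation is left. If all pointers are below \<open>n\<close>,
  they form an element of \<open>S\<close>, least by safety; if one has reached \<open>n\<close>, no
  element of \<open>S\<close> lies above the final pointers, hence none above the initial
  ones.\<close>

lemma sem_advance:
  assumes ok: "consts_ok m" and le: "\<And>w. w < n \<Longrightarrow> m aP w \<le> n"
  shows "sem advance m aFail 0 = 0 \<Longrightarrow> least_above (restr (m aP)) (restr (sem advance m aP))"
    and "sem advance m aFail 0 \<noteq> 0 \<Longrightarrow> q \<in> S \<Longrightarrow> \<not> restr (m aP) \<le> q"
    and "sem advance m aFail 0 \<le> 1"
proof -
  define m1 where "m1 = sem (For 20 aSQ pass) m"
  have mono: "(\<Sum>w<n. x w) < (\<Sum>w<n. y w)" if xy: "adv x y" "y \<noteq> x" for x y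
  proof -
    obtain w where w: "y w \<noteq> x w" using xy(2) by auto
    have "w < n" using w xy(1) not_le unfolding adv_def by blast
    then have "restr x w \<noteq> restr y w" using w by (simp add: restr_def)
    then have ne: "restr x \<noteq> restr y" by auto
    have "(\<Sum>w<n. restr x w) < (\<Sum>w<n. restr y w)"
    proof (rule sum_less[OF restr_mono])
      show "x \<le> y" using xy(1) by (simp add: adv_def)
      show "restr x \<noteq> restr y" by (rule ne)
    qed (simp_all add: restr_def)
    then show ?thesis by (simp add: restr_def)
  qed
  have bound: "(\<Sum>w<n. x w) < m aSQ 0" if "adv (m aP) x" for x
  proof -
    have "\<forall>w<n. x w \<le> n" using that le by (simp add: adv_def)
    then have "(\<Sum>w<n. x w) \<le> n * n" using sum_bounded_above[of "{..<n}" x n] by simp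
    then show ?thesis using ok by (simp add: consts_ok_def)
  qed
  have "adv (m aP) (m1 aP) \<and> unviolated (m1 aP)"
    unfolding m1_def
  proof (rule sem_For_iterate[where \<mu> = "\<lambda>x. \<Sum>w<n. x w", OF adv_order(1,2)])
    fix m' assume fr: "\<And>a. a \<notin> insert 20 (mods pass) \<Longrightarrow> m' a = m a"
    have "consts_ok m'" using ok by (subst consts_ok_cong[of m' m]) (auto intro!: fr simp: pass_def pass_body_def)
    then show "progress adv unviolated (m' aP) (sem pass m' aP)" by (rule pass_progress)
  qed (use mono bound in \<open>auto simp: pass_def pass_body_def\<close>)
  then have adv: "adv (m aP) (m1 aP)" and unv: "unviolated (m1 aP)" by auto
  have m10: "m1 0 0 = n"
    using ok by (simp add: m1_def sem_frame pass_def pass_body_def consts_ok_n)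
  define m2 where "m2 = sem (aFail ::= Const 0) m1"
  define c where "c = FIf (ENot (ELess (Cell aP (Var 21)) (Var 0))) (aFail ::= Const 1) FSkip"
  have eq: "sem advance m = sem (For 21 0 c) m2"
    by (simp add: advance_def m2_def m1_def c_def)
  have m2: "m2 0 0 = n" "m2 aFail 0 = 0" "m2 aP = m1 aP" by (simp_all add: m2_def m10 upd_apply)
  have P: "sem advance m aP = m1 aP"
    unfolding eq using m2(3) by (simp add: sem_frame c_def)
  have "sem (For 21 0 c) m2 aFail 0 = (if \<exists>i<m2 0 0. \<not> m1 aP i < n then 1 else m2 aFail 0)"
    unfolding c_def
  proof (rule sem_flag)
    fix i m' assume "m' 21 0 = i" and fr: "\<And>a'. a' \<noteq> 21 \<Longrightarrow> a' \<noteq> aFail \<Longrightarrow> m' a' = m2 a'"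
    moreover have "m' 0 = m2 0" "m' aP = m2 aP" by (rule fr; simp)+
    ultimately show "val (ENot (ELess (Cell aP (Var 21)) (Var 0))) m' \<noteq> 0 \<longleftrightarrow> \<not> m1 aP i < n"
      using m2 by simp
  qed simp_all
  then have F: "sem advance m aFail 0 = (if \<exists>i<n. \<not> m1 aP i < n then 1 else 0)"
    by (simp add: eq m2)
  show "sem advance m aFail 0 \<le> 1" by (simp add: F)
  show "least_above (restr (m aP)) (restr (sem advance m aP))" if "sem advance m aFail 0 = 0"
  proof -
    have lt: "m1 aP i < n" if "i < n" for i using that \<open>sem advance m aFail 0 = 0\<close> by (auto simp: F split: if_splits)
    have "restr (m1 aP) \<in> S"
    proof (rule no_violation_stable)
      fix w w' j i a b
      assume h: "w < n" "w' < n" "j < n" "i < length As" "a < n" "b < n"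
      have "violated (restr (m1 aP)) w w' j i a b = violated (m1 aP) w w' j i a b"
        using h(1,2) by (simp add: violated_def restr_def)
      then show "\<not> violated (restr (m1 aP)) w w' j i a b" using unv h unfolding unviolated_def by blast
    qed (simp_all add: restr_def lt)
    moreover have "restr (m aP) \<le> restr (m1 aP)" using adv by (intro restr_mono) (simp add: adv_def)
    ultimately show ?thesis using adv unfolding P least_above_def adv_def by blast
  qed
  show "\<not> restr (m aP) \<le> q" if "sem advance m aFail 0 \<noteq> 0" "q \<in> S"
  proof
    assume "restr (m aP) \<le> q"
    then have "restr (m1 aP) \<le> q" using adv that(2) by (simp add: adv_def)
    moreover obtain i where "i < n" "\<not> m1 aP i < n"
      using \<open>sem advance m aFail 0 \<noteq> 0\<close> unfolding F by (auto split: if_splits)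
    ultimately show False using SD(1)[OF \<open>q \<in> S\<close>, of i] le_funD[of "restr (m1 aP)" q i]
      by (simp add: restr_def)
  qed
qed

end

section \<open>Optimal matchings\<close>

text \<open>Loop bounds of a later stage may be computed by an earlier one.\<close>

fun stage_com :: "fcom list \<Rightarrow> com" where
  "stage_com [] = Skip"
| "stage_com (c # cs) = Seq (compile c) (stage_com cs)"

fun stages_ok :: "nat \<Rightarrow> fcom list \<Rightarrow> memory \<Rightarrow> bool" where
  "stages_ok N [] m \<longleftrightarrow> True"
| "stages_ok N (c # cs) m \<longleftrightarrow> counters_safe c \<and> bounds c \<inter> mods c = {} \<and> (\<forall>b\<in>bounds c. m b 0 \<le> N) \<and>
     stages_ok N cs (sem c m)"

fun stage_time :: "nat \<Rightarrow> fcom list \<Rightarrow> nat" where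
  "stage_time N [] = 1"
| "stage_time N (c # cs) = time_bound N c + stage_time N cs"

lemma stage_time_poly: "\<exists>p :: nat poly. \<forall>N. stage_time N cs = poly p N"
proof (induction cs)
  case Nil
  have "\<forall>N. stage_time N [] = poly [:1:] N" by simp
  then show ?case by blast
next
  case (Cons c cs)
  obtain p q :: "nat poly" where "\<forall>N. time_bound N c = poly p N" "\<forall>N. stage_time N cs = poly q N"
    using Cons time_bound_poly[of c] by blast
  then have "\<forall>N. stage_time N (c # cs) = poly (p + q) N" by simp
  then show ?case by blast
qed

lemma exec_stages:
  assumes "stages_ok N cs (mem s)"
  shows "\<exists>t\<le>stage_time N cs. exec (stage_com cs) s (s\<lparr>mem := fold sem cs (mem s), clock := clock s + t\<rparr>)"
  using assms
proof (induction cs arbitrary: s)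
  case Nil
  have "exec Skip s (tick 1 s)" by (rule exec.Skip)
  then show ?case by (auto simp: tick_def intro!: exI[of _ 1])
next
  case (Cons c cs)
  have "counters_safe c" "bounds c \<inter> mods c = {}" "\<forall>b\<in>bounds c. mem s b 0 \<le> N"
    using Cons.prems by auto
  from exec_compile[OF this] obtain t1 where t1: "t1 \<le> time_bound N c"
    and e1: "exec (compile c) s (s\<lparr>mem := sem c (mem s), clock := clock s + t1\<rparr>)" (is "exec _ _ ?s1")
    by blast
  have "stages_ok N cs (mem ?s1)" using Cons.prems by simp
  from Cons.IH[OF this] obtain t2 where t2: "t2 \<le> stage_time N cs"
    and e2: "exec (stage_com cs) ?s1 (?s1\<lparr>mem := fold sem cs (mem ?s1), clock := clock ?s1 + t2\<rparr>)"
    by blast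
  from exec.Seq[OF e1 e2] t1 t2 show ?case
    by (intro exI[of _ "t1 + t2"]) (simp add: add.assoc)
qed

lemma solvable_in_poly_timeI:
  assumes ok: "\<And>x. x \<in> D \<Longrightarrow> stages_ok (input_size (enc x)) cs (mem (initial_state (enc x)))"
    and out: "\<And>x m. x \<in> D \<Longrightarrow> m = fold sem cs (mem (initial_state (enc x))) \<Longrightarrow>
      R x (map (m aOut) [0..<m aLen 0]) \<and> m aLen 0 \<le> poly q (input_size (enc x))"
  shows "solvable_in_poly_time enc D R"
proof -
  obtain p :: "nat poly" where p: "\<And>N. stage_time N cs = poly p N" using stage_time_poly by metis
  let ?c = "Seq (stage_com cs) (Emit aOut (Var aLen))"
  \<comment> \<open>The 3 is the fixed charge of the closing \<open>Emit\<close>: one unit for the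
    operation and two for reading \<open>aLen\<close>. The polynomial \<open>q\<close> pays for the
    length of the item.\<close>
  have "\<exists>y t' t. runs ?c (enc x) [(t', y)] t \<and> t \<le> poly (p + q + [:3:]) (input_size (enc x)) \<and> R x y"
    if x: "x \<in> D" for x
  proof -
    let ?s = "initial_state (enc x)" and ?N = "input_size (enc x)"
    define m where "m = fold sem cs (mem ?s)"
    obtain t where t: "t \<le> stage_time ?N cs" and e: "exec (stage_com cs) ?s (?s\<lparr>mem := m, clock := clock ?s + t\<rparr>)"
      (is "exec _ _ ?s1") using exec_stages[OF ok[OF x]] unfolding m_def by blast
    have "exec (Emit aOut (Var aLen)) ?s1 (emit (map (mem ?s1 aOut) [0..<val (Var aLen) (mem ?s1)])
        (tick (1 + cost (Var aLen) + val (Var aLen) (mem ?s1)) ?s1))" by (rule exec.Emit)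
    from exec.Seq[OF e this] have "runs ?c (enc x) [(t + 3 + m aLen 0, map (m aOut) [0..<m aLen 0])] (t + 3 + m aLen 0)"
      unfolding runs_def by (intro exI conjI, assumption) (simp_all add: emit_def tick_def initial_state_def)
    moreover have "t + 3 + m aLen 0 \<le> poly (p + q + [:3:]) ?N"
      using t p out[OF x m_def] by simp
    ultimately show ?thesis using out[OF x m_def] by blast
  qed
  then show ?thesis unfolding solvable_in_poly_time_def by blast
qed

definition prefix :: fcom where
  "prefix = setup2 ;; advance ;; aBad ::= Var aFail ;; copy_arr 33 0 aQ aP"

text \<open>If no common stable matching exists, the single emitted cell is an untouched zero of
  \<open>aOut\<close>, which is exactly the output \<open>[0]\<close>.\<close>

definition write_matching :: fcom where
  "write_matching = aLen ::= Const 1 ;; FIf (Var aBad) FSkip (aOut ::= Const 1 ;;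
     For 33 0 (Asg aOut (Plus (Var 33) (Const 1)) (wpref_exp (Var 33) (Cell aQ (Var 33)))) ;;
     aLen ::= Plus (Var 0) (Const 1))"

definition climb_step :: fcom where
  "climb_step = copy_arr 33 0 aP aQ ;; Asg aP (Var 31) (Plus (Cell aP (Var 31)) (Const 1)) ;; advance ;;
     FIf (Var aFail) FSkip (copy_arr 33 0 aQ aP)"

definition climb :: fcom where
  "climb = For 32 aSQ (For 31 0 climb_step)"

section \<open>Input size bounds and the bottom vector\<close>

context common_stable_matchings
begin

abbreviation N :: nat where "N \<equiv> input_size (enc_input (n, As))"

lemma input_size_ge: "length xs \<le> input_size xs"
  unfolding input_size_def by (induction xs) auto

text \<open>Every number of the input counts at least one unit, so the size dominates the length of
  the encoding, which contains \<open>2 * n * n\<close> cells for each of at least one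
  instance.\<close>

lemma N_bounds: "n * n + 2 \<le> N" "0 < n \<Longrightarrow> length As \<le> N" "n \<le> N" "2 \<le> N"
proof -
  have len: "2 + length As * (2 * n * n) \<le> N" using input_size_ge length_enc_input by metis
  have "1 * (2 * n * n) \<le> length As * (2 * n * n)" using nonempty by (intro mult_right_mono) (simp_all add: Suc_leI)
  then show "n * n + 2 \<le> N" using len by linarith
  show "2 \<le> N" using len by simp
  show "length As \<le> N" if "0 < n"
  proof -
    have "length As * 1 \<le> length As * (2 * n * n)" using that by (intro mult_left_mono) auto
    then show ?thesis using len by linarith
  qed
  show "n \<le> N" using \<open>n * n + 2 \<le> N\<close> le_square[of n] by linarith
qed

lemma ready_bounds:
  assumes "b \<in> {0, aK, aSQ}"
  shows "sem setup1 init_mem b 0 \<le> N"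
  using assms N_bounds by (auto simp: sem_setup1 init_mem_0)

lemma bounds_setup1: "bounds setup1 = {0}" "mods setup1 = {aK, 20, aSQ}" "counters_safe setup1"
  by (auto simp: setup1_def)

lemma bounds_setup2: "bounds setup2 = {aK, aSQ}" "mods setup2 = {20, aWN, aIO}" "counters_safe setup2"
  by (auto simp: setup2_def)

lemma stages_ok_setup:
  assumes "counters_safe c" "bounds c \<subseteq> {0, aK, aSQ}" "mods c \<inter> {0, aK, aSQ} = {}"
    and "stages_ok N cs (sem c (sem setup1 init_mem))"
  shows "stages_ok N (setup1 # c # cs) init_mem"
  using assms ready_bounds N_bounds(3) init_mem_0 bounds_setup1 by auto

abbreviation m0 :: memory where "m0 \<equiv> sem setup2 (sem setup1 init_mem)"

abbreviation m1 :: memory where "m1 \<equiv> sem prefix (sem setup1 init_mem)"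

lemma common_stable_empty_iff: "common_stable n As = {} \<longleftrightarrow> S = {}"
  using bij_betw_matching by (auto simp: bij_betw_def)

lemma prefix_props:
  shows "consts_ok m1" "m1 aBad 0 = 0 \<Longrightarrow> least_above (\<lambda>_. 0) (restr (m1 aQ))"
    "m1 aBad 0 \<noteq> 0 \<longleftrightarrow> S = {}" "m1 aBad 0 \<le> 1"
    "a \<notin> {0, aK, aSQ, aWN, aIO, aP, aFail, aBad, aQ} \<Longrightarrow> a < 20 \<Longrightarrow> m1 a = (\<lambda>_. 0)"
proof -
  have ok: "consts_ok m0" by (rule consts_ok_setup2)
  have z: "m0 a = (\<lambda>_. 0)" if "a \<notin> {0, aK, aSQ, aWN, aIO, 20}" for a using setup2_zero[OF that] .
  have r: "restr (m0 aP) = (\<lambda>_. 0)" by (simp add: z restr_def fun_eq_iff)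
  define ma where "ma = sem advance m0"
  define mb where "mb = upd aBad 0 (ma aFail 0) ma"
  have eq: "m1 = sem (copy_arr 33 0 aQ aP) mb"
    by (simp add: prefix_def ma_def mb_def)
  have fra: "ma a = m0 a" if "a < 6" for a unfolding ma_def by (rule sem_frame) (use that in simp)
  have okb: "consts_ok mb" using ok consts_ok_cong[of mb m0] by (simp add: mb_def upd_apply fra)
  have "consts_ok m1 = consts_ok mb" unfolding eq by (rule consts_ok_cong) (simp add: sem_frame)
  then show "consts_ok m1" using okb by simp
  have bad: "m1 aBad 0 = ma aFail 0" unfolding eq by (simp add: sem_frame mb_def upd_apply)
  have Q: "restr (m1 aQ) = restr (ma aP)"
    unfolding eq by (subst sem_copy_arr) (simp_all add: restr_def consts_ok_n[OF okb] fun_eq_iff, simp add: mb_def upd_apply)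
  note adv = sem_advance[OF ok, folded ma_def, unfolded z[of aP, simplified] r]
  have zz: "restr (\<lambda>_. 0) = (\<lambda>_. 0)" by (simp add: restr_def fun_eq_iff)
  show l: "least_above (\<lambda>_. 0) (restr (m1 aQ))" if "m1 aBad 0 = 0"
    using adv(1) that unfolding Q bad zz by simp
  show "m1 aBad 0 \<noteq> 0 \<longleftrightarrow> S = {}"
  proof
    assume "m1 aBad 0 \<noteq> 0"
    then have "\<not> (\<lambda>_. 0) \<le> q" if "q \<in> S" for q using adv(2)[OF _ _ that] unfolding bad zz by simp
    then show "S = {}" by (auto simp: le_fun_def)
  next
    assume "S = {}"
    then show "m1 aBad 0 \<noteq> 0" using l by (auto simp: least_above_def)
  qed
  show "m1 aBad 0 \<le> 1" using adv(3) unfolding bad by simp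
  show "m1 a = (\<lambda>_. 0)" if "a \<notin> {0, aK, aSQ, aWN, aIO, aP, aFail, aBad, aQ}" "a < 20"
  proof -
    have "m1 a = ma a" unfolding eq mb_def using that by (simp add: sem_frame upd_apply)
    also have "\<dots> = m0 a" unfolding ma_def by (rule sem_frame) (use that in simp)
    also have "\<dots> = (\<lambda>_. 0)" by (rule z) (use that in simp)
    finally show ?thesis .
  qed
qed

lemma bounds_prefix: "bounds prefix = {0, aK, aSQ}" "counters_safe prefix"
  "mods prefix = {20, 21, 22, 23, 24, 25, 26, 33, aWN, aIO, aP, aFail, aBad, aQ}"
  by (auto simp: prefix_def bounds_setup2)

lemma bounds_write_matching: "bounds write_matching = {0}" "counters_safe write_matching"
  "mods write_matching = {aLen, aOut, 33}"
  by (auto simp: write_matching_def)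

lemma bounds_climb: "bounds climb = {0, aK, aSQ}" "counters_safe climb"
  "mods climb = {20, 21, 22, 23, 24, 25, 26, 31, 32, 33, aP, aFail, aQ}"
  by (auto simp: climb_def climb_step_def)

lemma sem_write_matching:
  assumes ok: "consts_ok m"
  defines "m' \<equiv> sem write_matching m"
  shows "m aBad 0 \<noteq> 0 \<Longrightarrow> m aOut = (\<lambda>_. 0) \<Longrightarrow> map (m' aOut) [0..<m' aLen 0] = [0]"
    and "m aBad 0 = 0 \<Longrightarrow> (\<And>w. w < n \<Longrightarrow> m aQ w < n) \<Longrightarrow>
      map (m' aOut) [0..<m' aLen 0] = 1 # enc_matching n (matching (restr (m aQ)))"
    and "m' aLen 0 \<le> n + 1"
proof -
  show "map (m' aOut) [0..<m' aLen 0] = [0]" if "m aBad 0 \<noteq> 0" "m aOut = (\<lambda>_. 0)"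
    using that by (simp add: m'_def write_matching_def upd_apply)
  define ma where "ma = upd aOut 0 1 (upd aLen 0 1 m)"
  define c where "c = Asg aOut (Plus (Var 33) (Const 1)) (wpref_exp (Var 33) (Cell aQ (Var 33)))"
  have oka: "consts_ok ma" using ok consts_ok_cong[of ma m] by (simp add: ma_def upd_apply)
  have eq: "m' = upd aLen 0 (sem (For 33 0 c) ma 0 0 + 1) (sem (For 33 0 c) ma)" if "m aBad 0 = 0"
    using that by (simp add: m'_def write_matching_def ma_def c_def upd_apply)
  have fr: "sem (For 33 0 c) ma 0 = ma 0" by (rule sem_frame) (simp add: c_def)
  have len: "m' aLen 0 = n + 1" if "m aBad 0 = 0"
    by (simp add: eq[OF that] upd_apply fr consts_ok_n[OF oka])
  show "m' aLen 0 \<le> n + 1"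
    using len by (cases "m aBad 0 = 0") (simp_all add: m'_def write_matching_def upd_apply)
  show "map (m' aOut) [0..<m' aLen 0] = 1 # enc_matching n (matching (restr (m aQ)))"
    if bad: "m aBad 0 = 0" and Q: "\<And>w. w < n \<Longrightarrow> m aQ w < n"
  proof -
    have "sem (For 33 0 c) ma aOut = (\<lambda>x. if 1 \<le> x \<and> x < 1 + ma 0 0 then matching (restr (m aQ)) (x - 1) else ma aOut x)"
    proof (rule sem_fill)
      fix i k assume i: "i < ma 0 0" and k: "k 33 0 = i" and fr: "\<And>a. a \<notin> insert 33 (mods c) \<Longrightarrow> k a = ma a"
      have i': "i < n" using i consts_ok_n[OF oka] by simp
      have fr': "k a = ma a" if "a < 6 \<or> a = aQ" for a by (rule fr) (use that in \<open>auto simp: c_def\<close>)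
      have "consts_ok k" using oka consts_ok_cong[of k ma] fr' by blast
      then have "val (wpref_exp (Var 33) (Cell aQ (Var 33))) k = wl i ! m aQ i"
        using Q[OF i'] i' k by (subst val_wpref_exp) (simp_all add: fr' ma_def upd_apply)
      then show "sem c k aOut = (k aOut)(1 + i := matching (restr (m aQ)) i)"
        using i' k by (simp add: c_def upd_apply matching_def restr_def)
    qed (simp_all add: c_def)
    then have out: "m' aOut x = (if 1 \<le> x \<and> x < 1 + n then matching (restr (m aQ)) (x - 1) else ma aOut x)" for x
      by (simp add: eq[OF bad] upd_apply consts_ok_n[OF oka])
    show ?thesis
      unfolding len[OF bad] enc_matching_def
      by (rule nth_equalityI) (auto simp: out nth_Cons ma_def upd_apply simp del: upt_Suc split: nat.split)
  qed
qed

end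

section \<open>Climbing to the greatest common stable vector\<close>

context common_stable_matchings
begin

definition climbs :: "(nat \<Rightarrow> nat) \<Rightarrow> (nat \<Rightarrow> nat) \<Rightarrow> bool" where
  "climbs q q' \<longleftrightarrow> q \<le> q' \<and> (\<forall>w\<ge>n. q' w = q w) \<and> (restr q \<in> S \<longrightarrow> restr q' \<in> S)"

lemma climbs_order: "reflp climbs" "transp climbs" "antisymp climbs"
proof -
  show "reflp climbs" by (rule reflpI) (simp add: climbs_def)
  show "antisymp climbs" by (rule antisympI, rule order.antisym) (simp_all add: climbs_def)
  show "transp climbs"
  proof (rule transpI)
    fix x y z assume xy: "climbs x y" and yz: "climbs y z"
    have "x \<le> z" using xy yz order_trans[of x y z] by (simp add: climbs_def)
    then show "climbs x z" using xy yz by (simp add: climbs_def)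
  qed
qed

definition maximal_at :: "nat \<Rightarrow> (nat \<Rightarrow> nat) \<Rightarrow> bool" where
  "maximal_at w q \<longleftrightarrow> \<not> (\<exists>r\<in>S. restr q \<le> r \<and> q w < r w)"

text \<open>Lying above the current vector with coordinate \<open>w\<close> raised by one is the
  same as lying above the current vector and being strictly larger at \<open>w\<close>, so failure
  of \<open>advance\<close> is exactly maximality at \<open>w\<close>.\<close>

lemma climb_step_progress:
  assumes ok: "consts_ok m" and w: "m 31 0 = w" "w < n" and q: "restr (m aQ) \<in> S"
  shows "progress climbs (maximal_at w) (m aQ) (sem climb_step m aQ)"
proof -
  define ma where "ma = sem (copy_arr 33 0 aP aQ) m"
  define mb where "mb = upd aP w (ma aP w + 1) ma"
  define mc where "mc = sem advance mb"
  have ma: "ma aP = (\<lambda>x. if x < n then m aQ x else m aP x)" "\<And>a. a \<notin> {33, aP} \<Longrightarrow> ma a = m a"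
    unfolding ma_def using consts_ok_n[OF ok] by (simp_all add: sem_copy_arr sem_frame)
  have eq: "sem climb_step m aQ = (if mc aFail 0 = 0 then sem (copy_arr 33 0 aQ aP) mc aQ else mc aQ)"
    by (simp add: climb_step_def ma_def[symmetric] mb_def mc_def ma(2) w)
  have okb: "consts_ok mb" using ok consts_ok_cong[of mb m] by (simp add: mb_def ma upd_apply)
  have frc: "mc a = mb a" if "a \<notin> {aP, aFail, 20, 21, 22, 23, 24, 25, 26}" for a
    unfolding mc_def by (rule sem_frame) (use that in simp)
  have okc: "consts_ok mc" using okb consts_ok_cong[of mc mb] by (simp add: frc)
  have qn: "m aQ x < n" if "x < n" for x using SD(1)[OF q that] that by (simp add: restr_def)
  have P: "restr (mb aP) = (restr (m aQ))(w := Suc (m aQ w))"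
    using w(2) by (simp add: mb_def upd_apply ma restr_def fun_eq_iff)
  have le: "mb aP x \<le> n" if "x < n" for x
    using qn[OF that] qn[OF w(2)] that by (simp add: mb_def upd_apply ma Suc_le_eq)
  note adv = sem_advance[OF okb le, folded mc_def, unfolded P]
  have Qc: "mc aQ = m aQ" by (simp add: frc mb_def upd_apply ma)
  have up: "(restr (m aQ))(w := Suc (m aQ w)) \<le> r \<longleftrightarrow> restr (m aQ) \<le> r \<and> m aQ w < r w" for r
    using w(2) by (auto simp: le_fun_def restr_def Suc_le_eq)
  show ?thesis
  proof (cases "mc aFail 0 = 0")
    case True
    let ?q' = "sem (copy_arr 33 0 aQ aP) mc aQ"
    have l: "least_above ((restr (m aQ))(w := Suc (m aQ w))) (restr (mc aP))" using adv(1)[OF _ True] by simp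
    then have r: "restr (mc aP) \<in> S" "restr (m aQ) \<le> restr (mc aP)" "m aQ w < restr (mc aP) w"
      using up by (simp_all add: least_above_def)
    have q': "?q' = (\<lambda>x. if x < n then mc aP x else m aQ x)"
      by (subst sem_copy_arr) (auto simp: Qc consts_ok_n[OF okc] fun_eq_iff)
    have "restr ?q' = restr (mc aP)" unfolding q' by (simp add: restr_def fun_eq_iff)
    moreover have "m aQ \<le> ?q'"
    proof (rule le_funI)
      fix x show "m aQ x \<le> ?q' x" using le_funD[OF r(2), of x] unfolding q' by (auto simp: restr_def split: if_splits)
    qed
    ultimately have "climbs (m aQ) ?q'" using r(1) by (simp add: climbs_def) (simp add: q')
    moreover have "?q' w \<noteq> m aQ w" using r(3) w(2) unfolding q' by (simp add: restr_def)
    then have "?q' \<noteq> m aQ" by metis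
    moreover have "\<not> maximal_at w (m aQ)" using r by (auto simp: maximal_at_def)
    ultimately show ?thesis using True unfolding progress_def eq by simp
  next
    case False
    have "\<not> (restr (m aQ))(w := Suc (m aQ w)) \<le> r" if "r \<in> S" for r
      using adv(2)[OF _ False that] by simp
    then have "maximal_at w (m aQ)" unfolding up maximal_at_def by blast
    then show ?thesis using False climbs_order(1) unfolding progress_def eq by (simp add: Qc reflpD)
  qed
qed

text \<open>The climb stops only when no coordinate can be raised. Were some \<open>r\<close> in
  \<open>S\<close> larger at a coordinate, the supremum with \<open>r\<close> would raise it, so the
  final vector is the greatest.\<close>

lemma climb_greatest:
  assumes ok: "consts_ok m" and q: "restr (m aQ) \<in> S"
  shows "restr (sem climb m aQ) \<in> S" and "r \<in> S \<Longrightarrow> r \<le> restr (sem climb m aQ)"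
proof -
  define G where "G = (\<lambda>q. \<forall>w<n. maximal_at w q)"
  have mods: "mods climb_step = {aP, aFail, aQ, 20, 21, 22, 23, 24, 25, 26, 33}" by (auto simp: climb_step_def)
  have mono: "(\<Sum>w<n. x w) < (\<Sum>w<n. y w)" if xy: "climbs x y" "y \<noteq> x" for x y
  proof -
    obtain w where w: "y w \<noteq> x w" using xy(2) by auto
    have "w < n" using w xy(1) not_le unfolding climbs_def by blast
    then have "restr x w \<noteq> restr y w" using w by (simp add: restr_def)
    then have ne: "restr x \<noteq> restr y" by auto
    have "(\<Sum>w<n. restr x w) < (\<Sum>w<n. restr y w)"
    proof (rule sum_less[OF restr_mono])
      show "x \<le> y" using xy(1) by (simp add: climbs_def)
      show "restr x \<noteq> restr y" by (rule ne)
    qed (simp_all add: restr_def)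
    then show ?thesis by (simp add: restr_def)
  qed
  have bound: "(\<Sum>w<n. x w) < m aSQ 0" if x: "climbs (m aQ) x" for x
  proof -
    have "restr x \<in> S" using x q by (simp add: climbs_def)
    then have "x w \<le> n" if "w < n" for w using SD(1)[OF \<open>restr x \<in> S\<close> that] that by (simp add: restr_def)
    then have "(\<Sum>w<n. x w) \<le> n * n" using sum_bounded_above[of "{..<n}" x n] by simp
    then show ?thesis using ok by (simp add: consts_ok_def)
  qed
  have "climbs (m aQ) (sem climb m aQ) \<and> G (sem climb m aQ)"
    unfolding climb_def
  proof (rule sem_For_iterate[where \<mu> = "\<lambda>x. \<Sum>w<n. x w", OF climbs_order(1,2)])
    fix k assume R: "climbs (m aQ) (k aQ)" and fr: "\<And>a. a \<notin> insert 32 (mods (For 31 0 climb_step)) \<Longrightarrow> k a = m a"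
    have okk: "consts_ok k" using ok by (subst consts_ok_cong[of k m]) (auto intro!: fr simp: mods)
    have Qk: "restr (k aQ) \<in> S" using R q by (simp add: climbs_def)
    have "progress climbs (\<lambda>x. \<forall>w<k 0 0. maximal_at w x) (k aQ) (sem (For 31 0 climb_step) k aQ)"
    proof (rule sem_For_progress[OF climbs_order])
      fix w k' assume w: "w < k 0 0" "k' 31 0 = w" and R': "climbs (k aQ) (k' aQ)"
        and fr': "\<And>a. a \<notin> insert 31 (mods climb_step) \<Longrightarrow> k' a = k a"
      have "consts_ok k'" using okk by (subst consts_ok_cong[of k' k]) (auto intro!: fr' simp: mods)
      then show "progress climbs (maximal_at w) (k' aQ) (sem climb_step k' aQ)"
        by (rule climb_step_progress) (use w R' Qk consts_ok_n[OF okk] in \<open>simp_all add: climbs_def\<close>)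
    qed (simp_all add: mods)
    then show "progress climbs G (k aQ) (sem (For 31 0 climb_step) k aQ)"
      by (simp add: G_def consts_ok_n[OF okk])
  qed (use mono bound in \<open>auto simp: mods\<close>)
  then have c: "climbs (m aQ) (sem climb m aQ)" and g: "G (sem climb m aQ)" by auto
  show Q: "restr (sem climb m aQ) \<in> S" using c q by (simp add: climbs_def)
  show "r \<le> restr (sem climb m aQ)" if r: "r \<in> S"
  proof (rule le_funI)
    fix w
    let ?q = "sem climb m aQ"
    show "r w \<le> restr ?q w"
    proof (cases "w < n")
      case True
      have "sup (restr ?q) r \<in> S" using S_sup[OF Q r] .
      then have "\<not> ?q w < sup (restr ?q) r w"
        using g True unfolding G_def maximal_at_def by (meson sup.cobounded1)
      then show ?thesis using True by (simp add: restr_def sup_nat_def)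
    qed (simp add: SD(2)[OF r])
  qed
qed

lemma worker_stages_ok: "stages_ok N [setup1, prefix ;; write_matching] init_mem"
  by (rule stages_ok_setup) (auto simp: bounds_prefix bounds_write_matching)

lemma firm_stages_ok: "stages_ok N [setup1, prefix ;; climb ;; write_matching] init_mem"
  by (rule stages_ok_setup) (auto simp: bounds_prefix bounds_write_matching bounds_climb)

lemma worker_output:
  assumes "m = fold sem [setup1, prefix ;; write_matching] init_mem"
  shows "worker_optimal_output (n, As) (map (m aOut) [0..<m aLen 0]) \<and> m aLen 0 \<le> n + 1"
proof -
  have m: "m = sem write_matching m1" using assms by simp
  note p = prefix_props(1-3) and wm = sem_write_matching[OF prefix_props(1), folded m]
  have out: "m1 aOut = (\<lambda>_. 0)" by (rule prefix_props(5)) simp_all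
  show ?thesis
  proof (cases "S = {}")
    case True
    then show ?thesis using wm(1)[OF _ out] wm(3) p(3) common_stable_empty_iff
      by (simp add: worker_optimal_output_def Let_def)
  next
    case False
    then have b: "m1 aBad 0 = 0" using p(3) by simp
    have l: "least_above (\<lambda>_. 0) (restr (m1 aQ))" using p(2)[OF b] .
    then have q: "restr (m1 aQ) \<in> S" by (simp add: least_above_def)
    have "m1 aQ w < n" if "w < n" for w using SD(1)[OF q that] that by (simp add: restr_def)
    from wm(2)[OF b this] show ?thesis
      using worker_optimal_least[OF l] False wm(3) common_stable_empty_iff
      by (auto simp: worker_optimal_output_def Let_def)
  qed
qed

lemma firm_output:
  assumes "m = fold sem [setup1, prefix ;; climb ;; write_matching] init_mem"
  shows "firm_optimal_output (n, As) (map (m aOut) [0..<m aLen 0]) \<and> m aLen 0 \<le> n + 1"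
proof -
  define mc where "mc = sem climb m1"
  have m: "m = sem write_matching mc" using assms by (simp add: mc_def)
  have fr: "mc a = m1 a" if "a < 6 \<or> a = aOut \<or> a = aBad" for a
    unfolding mc_def by (rule sem_frame) (use that in \<open>auto simp: bounds_climb\<close>)
  have okc: "consts_ok mc" using prefix_props(1) consts_ok_cong[of mc m1] fr by blast
  note wm = sem_write_matching[OF okc, folded m]
  have out: "mc aOut = (\<lambda>_. 0)" using prefix_props(5)[of aOut] by (simp add: fr)
  have bad: "mc aBad 0 = m1 aBad 0" by (simp add: fr)
  show ?thesis
  proof (cases "S = {}")
    case True
    then show ?thesis using wm(1)[OF _ out] wm(3) prefix_props(3) common_stable_empty_iff bad
      by (simp add: firm_optimal_output_def Let_def)
  next
    case False
    then have b: "m1 aBad 0 = 0" using prefix_props(3) by simp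
    have "restr (m1 aQ) \<in> S" using prefix_props(2)[OF b] by (simp add: least_above_def)
    note g = climb_greatest[OF prefix_props(1) this, folded mc_def]
    have "mc aQ w < n" if "w < n" for w using SD(1)[OF g(1) that] that by (simp add: restr_def)
    from wm(2)[OF _ this] show ?thesis
      using firm_optimal_greatest[OF g] False wm(3) common_stable_empty_iff b bad
      by (auto simp: firm_optimal_output_def Let_def)
  qed
qed

end

lemma worker_optimal_solvable:
  "solvable_in_poly_time enc_input same_workers_inputs worker_optimal_output"
proof (rule solvable_in_poly_timeI[where cs = "[setup1, prefix ;; write_matching]" and q = "[:0, 1:]"])
  fix x :: "nat \<times> sm_instance list" assume x: "x \<in> same_workers_inputs"
  obtain n As where x': "x = (n, As)" by fastforce
  interpret common_stable_matchings n As using x x' by unfold_locales simp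
  show "stages_ok (input_size (enc_input x)) [setup1, prefix ;; write_matching] (mem (initial_state (enc_input x)))"
    using worker_stages_ok unfolding x' init_mem_def .
  fix m assume "m = fold sem [setup1, prefix ;; write_matching] (mem (initial_state (enc_input x)))"
  note out = worker_output[OF this[unfolded x', folded init_mem_def]]
  have "n + 1 \<le> N" using N_bounds(1) le_square[of n] by linarith
  with out
  show "worker_optimal_output x (map (m aOut) [0..<m aLen 0]) \<and> m aLen 0 \<le> poly [:0, 1:] (input_size (enc_input x))"
    unfolding x' by auto
qed

lemma firm_optimal_solvable:
  "solvable_in_poly_time enc_input same_workers_inputs firm_optimal_output"
proof (rule solvable_in_poly_timeI[where cs = "[setup1, prefix ;; climb ;; write_matching]" and q = "[:0, 1:]"])
  fix x :: "nat \<times> sm_instance list" assume x: "x \<in> same_workers_inputs"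
  obtain n As where x': "x = (n, As)" by fastforce
  interpret common_stable_matchings n As using x x' by unfold_locales simp
  show "stages_ok (input_size (enc_input x)) [setup1, prefix ;; climb ;; write_matching] (mem (initial_state (enc_input x)))"
    using firm_stages_ok unfolding x' init_mem_def .
  fix m assume "m = fold sem [setup1, prefix ;; climb ;; write_matching] (mem (initial_state (enc_input x)))"
  note out = firm_output[OF this[unfolded x', folded init_mem_def]]
  have "n + 1 \<le> N" using N_bounds(1) le_square[of n] by linarith
  with out
  show "firm_optimal_output x (map (m aOut) [0..<m aLen 0]) \<and> m aLen 0 \<le> poly [:0, 1:] (input_size (enc_input x))"
    unfolding x' by auto
qed

section \<open>The Birkhoff order\<close>

abbreviation (input) "aM \<equiv> 18::nat"

definition tab :: "exp \<Rightarrow> exp \<Rightarrow> exp" where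
  "tab r x = Cell aTab (Plus (Cell aWN r) x)"

text \<open>Row 0 of the table is the least element; the elements of the poset are rows 1 to \<open>aM\<close>.\<close>

definition append_row :: "nat \<Rightarrow> fcom" where
  "append_row a = For 33 0 (Asg aTab (Plus (Cell aWN (Var aCnt)) (Var 33)) (Cell a (Var 33))) ;;
     aCnt ::= Plus (Var aCnt) (Const 1)"

text \<open>The loop runs over all possible rows and skips those not yet filled, because
  \<open>aCnt\<close> changes in the same stage and so cannot serve as a loop bound.\<close>

definition test_new :: fcom where
  "test_new = aNew ::= ENot (Var aFail) ;;
     For 34 aSQ (FIf (ELess (Var 34) (Var aCnt))
       (aEq ::= Const 1 ;;
        For 33 0 (FIf (ENot (EEq (tab (Var 34) (Var 33)) (Cell aP (Var 33)))) (aEq ::= Const 0) FSkip) ;;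
        FIf (Var aEq) (aNew ::= Const 0) FSkip) FSkip)"

definition collect_step :: fcom where
  "collect_step = For 33 0 (Asg aP (Var 33) (Const 0)) ;; Asg aP (Var 31) (Var 32) ;; advance ;;
     test_new ;; FIf (Var aNew) (append_row aP) FSkip"

text \<open>\<open>aM\<close> excludes the bottom row and becomes a loop bound of the next stage.
  Setting it to 0 when there is no common stable matching bounds it in that case without analysing
  the table.\<close>

definition collect :: fcom where
  "collect = append_row aQ ;; For 31 0 (For 32 0 collect_step) ;;
     FIf (Var aBad) (aM ::= Const 0) (aM ::= Minus (Var aCnt) (Const 1))"

definition write_entry :: fcom where
  "write_entry = aEq ::= Const 1 ;;
     For 33 0 (FIf (ELess (tab (Plus (Var 35) (Const 1)) (Var 33)) (tab (Plus (Var 34) (Const 1)) (Var 33)))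
       (aEq ::= Const 0) FSkip) ;;
     Asg aOut (Var aLen) (Var aEq) ;; aLen ::= Plus (Var aLen) (Const 1)"

definition write_order :: fcom where
  "write_order = aLen ::= Const 1 ;; FIf (Var aBad) FSkip (aOut ::= Const 1 ;; Asg aOut (Const 1) (Var aM) ;;
     aLen ::= Const 2 ;; For 34 aM (For 35 aM write_entry))"

lemma mods_append_row: "mods (append_row a) = {aTab, aCnt, 33}"
  by (auto simp: append_row_def)

lemma mods_test_new: "mods test_new = {aNew, aEq, 33, 34}"
  by (auto simp: test_new_def)

lemma mods_collect_step:
  "mods collect_step = {aP, aFail, aNew, aEq, aTab, aCnt, 20, 21, 22, 23, 24, 25, 26, 33, 34}"
  by (auto simp: collect_step_def mods_append_row mods_test_new)

lemma mods_write_entry: "mods write_entry = {aEq, aOut, aLen, 33}"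
  by (auto simp: write_entry_def)

section \<open>The table of least vectors\<close>

context common_stable_matchings
begin

definition row :: "memory \<Rightarrow> nat \<Rightarrow> nat \<Rightarrow> nat" where
  "row m r = (\<lambda>x. if x < n then m aTab (r * n + x) else 0)"

lemma row_cong: "m' aTab = m aTab \<Longrightarrow> row m' = row m"
  by (intro ext) (simp add: row_def)

lemma val_tab: "consts_ok m \<Longrightarrow> val r m \<le> n * n + 1 \<Longrightarrow> val x m < n \<Longrightarrow> val (tab r x) m = row m (val r m) (val x m)"
  by (simp add: tab_def row_def consts_ok_def)

lemma sem_append_row:
  assumes ok: "consts_ok m" and cnt: "m aCnt 0 \<le> n * n + 1" and a: "a \<noteq> 33" "a \<noteq> aTab"
  shows "sem (append_row a) m aCnt 0 = m aCnt 0 + 1" (is ?A)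
    and "row (sem (append_row a) m) (m aCnt 0) = restr (m a)" (is ?B)
    and "r < m aCnt 0 \<Longrightarrow> row (sem (append_row a) m) r = row m r"
proof -
  define k where "k = m aCnt 0"
  define c where "c = Asg aTab (Plus (Cell aWN (Var aCnt)) (Var 33)) (Cell a (Var 33))"
  define ma where "ma = sem (For 33 0 c) m"
  have fr: "ma b = m b" if "b \<notin> {33, aTab}" for b
    unfolding ma_def by (rule sem_frame) (use that in \<open>simp add: c_def\<close>)
  have eq: "sem (append_row a) m = upd aCnt 0 (k + 1) ma"
    by (simp add: append_row_def ma_def[symmetric] c_def[symmetric] fr k_def)
  show ?A by (simp add: eq k_def upd_apply)
  have "ma aTab = (\<lambda>x. if k * n \<le> x \<and> x < k * n + m 0 0 then m a (x - k * n) else m aTab x)"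
    unfolding ma_def
  proof (rule sem_fill)
    fix i m' assume i: "i < m 0 0" "m' 33 0 = i" and f: "\<And>b. b \<notin> insert 33 (mods c) \<Longrightarrow> m' b = m b"
    have "m' aWN = m aWN" "m' aCnt = m aCnt" "m' a = m a" by (rule f; use a in \<open>simp add: c_def\<close>)+
    then show "sem c m' aTab = (m' aTab)(k * n + i := m a i)"
      using ok cnt i(2) by (simp add: c_def upd_apply k_def consts_ok_def)
  qed (simp_all add: c_def)
  then have tab: "sem (append_row a) m aTab x = (if k * n \<le> x \<and> x < k * n + n then m a (x - k * n) else m aTab x)" for x
    by (simp add: eq upd_apply consts_ok_n[OF ok])
  show ?B unfolding k_def[symmetric] by (simp add: row_def tab restr_def fun_eq_iff)
  show "row (sem (append_row a) m) r = row m r" if "r < m aCnt 0"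
  proof
    fix x
    have "r * n + x < k * n" if "x < n" using idx_less[OF _ that] \<open>r < m aCnt 0\<close> by (simp add: k_def)
    then show "row (sem (append_row a) m) r x = row m r x" by (auto simp: row_def tab)
  qed
qed

lemma sem_test_new:
  assumes ok: "consts_ok m" and cnt: "m aCnt 0 \<le> n * n + 1"
  shows "sem test_new m aNew 0 \<noteq> 0 \<longleftrightarrow> m aFail 0 = 0 \<and> (\<forall>r<m aCnt 0. row m r \<noteq> restr (m aP))"
proof -
  define cx where "cx = FIf (ENot (EEq (tab (Var 34) (Var 33)) (Cell aP (Var 33)))) (aEq ::= Const 0) FSkip"
  define c where "c = FIf (ELess (Var 34) (Var aCnt)) (aEq ::= Const 1 ;; For 33 0 cx ;;
        FIf (Var aEq) (aNew ::= Const 0) FSkip) FSkip"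
  define ma where "ma = upd aNew 0 (val (ENot (Var aFail)) m) m"
  have eq: "sem test_new m = sem (For 34 aSQ c) ma"
    by (simp add: test_new_def c_def cx_def ma_def)
  have mods: "mods c = {aEq, aNew, 33}" by (auto simp: c_def cx_def)
  let ?I = "\<lambda>i m'. m' aNew 0 \<noteq> 0 \<longleftrightarrow> m aFail 0 = 0 \<and> (\<forall>r<i. r < m aCnt 0 \<longrightarrow> row m r \<noteq> restr (m aP))"
  have "?I (ma aSQ 0) (sem (For 34 aSQ c) ma)"
  proof (rule sem_For_induct[where I = ?I])
    show "?I 0 (upd 34 0 0 ma)" by (auto simp: ma_def upd_apply ENot_def)
    fix i m' assume i: "i < ma aSQ 0" "m' 34 0 = i" and I: "?I i m'"
      and f: "\<And>b. b \<notin> insert 34 (mods c) \<Longrightarrow> m' b = ma b"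
    have fr: "m' b = m b" if "b \<notin> {34, aEq, aNew, 33}" for b
    proof -
      have "m' b = ma b" by (rule f) (use that in \<open>simp add: mods\<close>)
      then show ?thesis using that by (simp add: ma_def upd_apply)
    qed
    have i': "i \<le> n * n + 1" using i(1) ok by (simp add: ma_def upd_apply consts_ok_def)
    have "?I (Suc i) (sem c m')"
    proof (cases "i < m aCnt 0")
      case True
      define mb where "mb = upd aEq 0 1 m'"
      define mc where "mc = sem (For 33 0 cx) mb"
      have mb0: "mb 0 0 = n" using consts_ok_n[OF ok] by (simp add: mb_def upd_apply fr)
      have "mc aEq 0 = (if \<exists>x<mb 0 0. row m i x \<noteq> m aP x then 0 else mb aEq 0)"
        unfolding mc_def cx_def
      proof (rule sem_flag)
        fix x k assume x: "x < mb 0 0" "k 33 0 = x" and fk: "\<And>b. b \<noteq> 33 \<Longrightarrow> b \<noteq> aEq \<Longrightarrow> k b = mb b"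
        have fk': "k b = m' b" if "b \<noteq> 33" "b \<noteq> aEq" for b using fk[OF that] that by (simp add: mb_def upd_apply)
        have "consts_ok k" using ok consts_ok_cong[of k m] by (simp add: fk' fr)
        moreover have "row k = row m" by (rule row_cong) (simp add: fk' fr)
        ultimately show "val (ENot (EEq (tab (Var 34) (Var 33)) (Cell aP (Var 33)))) k \<noteq> 0 \<longleftrightarrow> row m i x \<noteq> m aP x"
          using x i(2) i' mb0 by (simp add: val_tab fk' fr)
      qed simp_all
      then have "mc aEq 0 \<noteq> 0 \<longleftrightarrow> row m i = restr (m aP)"
        by (auto simp: mb0 fun_eq_iff restr_def row_def) (simp add: mb_def upd_apply)
      moreover have "mc aNew = m' aNew" by (simp add: mc_def sem_frame cx_def mb_def upd_apply)
      moreover have "sem c m' = (if mc aEq 0 \<noteq> 0 then upd aNew 0 0 mc else mc)"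
        using True i(2) fr[of aCnt] by (simp add: c_def mb_def mc_def)
      ultimately have "sem c m' aNew 0 \<noteq> 0 \<longleftrightarrow> m' aNew 0 \<noteq> 0 \<and> row m i \<noteq> restr (m aP)"
        by (cases "mc aEq 0 = 0") (simp_all add: upd_apply)
      then show ?thesis unfolding I less_Suc_eq using True by blast
    next
      case False
      then have "sem c m' = m'" using i(2) fr[of aCnt] by (simp add: c_def)
      moreover have "r < Suc i \<and> r < m aCnt 0 \<longleftrightarrow> r < i \<and> r < m aCnt 0" for r using False by linarith
      ultimately show ?thesis using I by metis
    qed
    then show "?I (Suc i) (upd 34 0 (Suc i) (sem c m'))" by (simp add: upd_apply)
  qed (simp_all add: mods)
  moreover have "ma aSQ 0 = n * n + 1" using ok by (simp add: ma_def upd_apply consts_ok_def)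
  moreover have "r < n * n + 1 \<and> r < m aCnt 0 \<longleftrightarrow> r < m aCnt 0" for r using cnt by linarith
  ultimately show ?thesis unfolding eq by metis
qed

text \<open>\<open>D\<close> is the set of least vectors found after \<open>k\<close> pairs have
  been tried. The row count is only bounded by \<open>k + 1\<close> because several pairs may give
  the same vector and some give none.\<close>

definition collected :: "(nat \<Rightarrow> nat) set \<Rightarrow> nat \<Rightarrow> memory \<Rightarrow> bool" where
  "collected D k m \<longleftrightarrow> consts_ok m \<and> 1 \<le> m aCnt 0 \<and> m aCnt 0 \<le> k + 1 \<and> inj_on (row m) {..<m aCnt 0} \<and>
     row m ` {..<m aCnt 0} = insert (row m 0) D \<and> least_above (\<lambda>_. 0) (row m 0)"

lemma collected_cong:
  "(\<And>a. a < 6 \<or> a = aTab \<or> a = aCnt \<Longrightarrow> m' a = m a) \<Longrightarrow> collected D k m' = collected D k m"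
  using consts_ok_cong[of m' m] row_cong[of m' m] by (simp add: collected_def)

lemma collected_upd: "20 \<le> v \<Longrightarrow> collected D k (upd v i x m) = collected D k m"
  by (rule collected_cong) (auto simp: upd_apply)

text \<open>By uniqueness of least vectors the added set has at most one element, and it is empty
  exactly when \<open>advance\<close> fails.\<close>

lemma collect_step_collected:
  assumes c: "collected D k m" and wj: "m 31 0 = w" "m 32 0 = j" "w < n" "j < n" and k: "k < n * n"
  shows "collected (D \<union> {J. least_above (unit w j) J}) (k + 1) (sem collect_step m)"
proof -
  have ok: "consts_ok m" using c by (simp add: collected_def)
  define c1 where "c1 = For 33 0 (Asg aP (Var 33) (Const 0))"
  define ma where "ma = sem c1 m"
  define mb where "mb = upd aP w j ma"
  define mc where "mc = sem advance mb"
  define md where "md = sem test_new mc"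
  have fra: "ma a = m a" if "a \<notin> {33, aP}" for a
    unfolding ma_def by (rule sem_frame) (use that in \<open>simp add: c1_def\<close>)
  have "ma aP = (\<lambda>x. if 0 \<le> x \<and> x < 0 + m 0 0 then (\<lambda>_. 0) (x - 0) else m aP x)"
    unfolding ma_def c1_def by (rule sem_fill) (simp_all add: upd_apply)
  then have P: "restr (mb aP) = unit w j"
    using wj(3) consts_ok_n[OF ok] by (simp add: mb_def upd_apply restr_def unit_def fun_eq_iff)
  have le: "mb aP x \<le> n" if "x < n" for x
    using fun_cong[OF P, of x] that wj(4) by (simp add: restr_def unit_def split: if_splits)
  have frb: "mb a = m a" if "a \<notin> {33, aP}" for a using that by (simp add: mb_def upd_apply fra)
  have okb: "consts_ok mb" using ok consts_ok_cong[of mb m] by (simp add: frb)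
  have frc: "mc a = m a" if "a < 6 \<or> a \<in> {aTab, aCnt}" for a
  proof -
    have "mc a = mb a" unfolding mc_def by (rule sem_frame) (use that in auto)
    then show ?thesis using that frb by auto
  qed
  have okc: "consts_ok mc" using ok consts_ok_cong[of mc m] frc by blast
  have cntc: "mc aCnt 0 \<le> n * n + 1" using c k by (simp add: frc collected_def)
  note new = sem_test_new[OF okc cntc, folded md_def]
  have rowc: "row mc = row m" by (rule row_cong) (simp add: frc)
  have frd: "md a = mc a" if "a \<notin> {aNew, aEq, 33, 34}" for a
    unfolding md_def by (rule sem_frame) (use that in \<open>simp add: mods_test_new\<close>)
  have frd': "md a = m a" if "a < 6 \<or> a = aTab \<or> a = aCnt" for a
    using that frc[of a] frd[of a] by auto
  have okd: "consts_ok md" using ok consts_ok_cong[of md m] frd' by blast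
  have rowd: "row md = row m" by (rule row_cong) (simp add: frd')
  have eq: "sem collect_step m = (if md aNew 0 \<noteq> 0 then sem (append_row aP) md else md)"
    using wj by (simp add: collect_step_def c1_def[symmetric] ma_def[symmetric] fra mb_def[symmetric]
        mc_def[symmetric] md_def[symmetric])
  note adv = sem_advance[OF okb le, folded mc_def, unfolded P]
  have D: "row m ` {..<m aCnt 0} = insert (row m 0) D" using c by (simp add: collected_def)
  show ?thesis
  proof (cases "md aNew 0 = 0")
    case False
    then have F: "mc aFail 0 = 0" and nn: "\<And>r. r < m aCnt 0 \<Longrightarrow> row m r \<noteq> restr (mc aP)"
      using new by (auto simp: rowc frc)
    have J: "least_above (unit w j) (restr (mc aP))" using adv(1)[OF _ F] by simp
    have J': "{J. least_above (unit w j) J} = {restr (mc aP)}" using J least_above_unique by blast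
    define q where "q = m aCnt 0"
    have q: "md aCnt 0 = q" by (simp add: frd' q_def)
    have "md aCnt 0 \<le> n * n + 1" using cntc by (simp add: frd)
    moreover have "aP \<noteq> (33::nat)" "aP \<noteq> aTab" by simp_all
    ultimately have ap: "sem (append_row aP) md aCnt 0 = q + 1" "row (sem (append_row aP) md) q = restr (md aP)"
      "\<And>r. r < q \<Longrightarrow> row (sem (append_row aP) md) r = row md r"
      using sem_append_row[OF okd, of aP] unfolding q by blast+
    let ?m = "sem (append_row aP) md"
    have Pd: "md aP = mc aP" by (simp add: frd)
    have r1: "row ?m q = restr (mc aP)" using ap(2) by (simp add: Pd)
    have r2: "row ?m r = row m r" if "r < q" for r using ap(3)[OF that] by (simp add: rowd)
    have set: "{..<?m aCnt 0} = insert q {..<q}" using ap(1) by (simp add: lessThan_Suc)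
    have q0: "0 < q" using c by (simp add: collected_def q_def)
    have im: "row ?m ` {..<q} = row m ` {..<q}" by (intro image_cong) (simp_all add: r2)
    have "inj_on (row ?m) (insert q {..<q})"
    proof (subst inj_on_insert, intro conjI)
      have "inj_on (row ?m) {..<q} = inj_on (row m) {..<q}" by (rule inj_on_cong) (simp add: r2)
      then show "inj_on (row ?m) {..<q}" using c by (simp add: collected_def q_def)
      have "restr (mc aP) \<notin> row m ` {..<q}" using nn[folded q_def] by (metis imageE lessThan_iff)
      then have "restr (mc aP) \<notin> row ?m ` {..<q}" by (simp only: im not_False_eq_True)
      then show "row ?m q \<notin> row ?m ` ({..<q} - {q})" unfolding r1 by (meson Diff_subset image_mono subsetD)
    qed
    moreover have "row ?m ` insert q {..<q} = insert (row m 0) (D \<union> {J. least_above (unit w j) J})"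
      unfolding image_insert im J' r1 D[folded q_def] by auto
    moreover have "consts_ok ?m"
      using okd consts_ok_cong[of ?m md] by (simp add: sem_frame mods_append_row)
    moreover have "sem collect_step m = ?m" using eq False by simp
    ultimately show ?thesis
      using c ap(1) r2[OF q0] unfolding collected_def \<open>sem collect_step m = ?m\<close> set by (simp add: q_def)
  next
    case True
    \<comment> \<open>Nothing is appended here: either \<open>advance\<close> failed and the set is
      empty, or its vector already is a row.\<close>
    have "{J. least_above (unit w j) J} \<subseteq> insert (row m 0) D"
    proof
      fix J assume J: "J \<in> {J. least_above (unit w j) J}"
      then have "J \<in> S" "unit w j \<le> J" by (simp_all add: least_above_def)
      then have F: "mc aFail 0 = 0" using adv(2)[of J] by auto
      then obtain r where "r < m aCnt 0" "row m r = restr (mc aP)" using True new by (auto simp: rowc frc)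
      moreover have "J = restr (mc aP)" using J adv(1)[OF _ F] least_above_unique by simp
      ultimately show "J \<in> insert (row m 0) D" unfolding D[symmetric] by (metis imageI lessThan_iff)
    qed
    then have "insert (row m 0) (D \<union> {J. least_above (unit w j) J}) = insert (row m 0) D" by auto
    then have "collected (D \<union> {J. least_above (unit w j) J}) (k + 1) m"
      using c by (simp add: collected_def)
    then show ?thesis using True collected_cong[of md m] frd' by (simp add: eq)
  qed
qed

text \<open>These are the vectors arising from the pairs that the two nested loops handle before
  \<open>(w, j)\<close>.\<close>

definition irreducibles_upto :: "nat \<Rightarrow> nat \<Rightarrow> (nat \<Rightarrow> nat) set" where
  "irreducibles_upto w j = {J. \<exists>w'<n. \<exists>j'<n. (w' < w \<or> w' = w \<and> j' < j) \<and> least_above (unit w' j') J}"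

lemma irreducibles_upto_simps:
  "irreducibles_upto 0 0 = {}"
  "w < n \<Longrightarrow> j < n \<Longrightarrow> irreducibles_upto w (Suc j) = irreducibles_upto w j \<union> {J. least_above (unit w j) J}"
  "irreducibles_upto w n = irreducibles_upto (Suc w) 0"
  "irreducibles_upto n 0 = irreducibles"
  by (auto simp: irreducibles_upto_def irreducibles_def less_Suc_eq)

lemma collect_loop:
  assumes c: "collected {} 0 m"
  shows "collected irreducibles (n * n) (sem (For 31 0 (For 32 0 collect_step)) m)"
proof -
  let ?I = "\<lambda>w m'. collected (irreducibles_upto w 0) (w * n) m'"
  have n: "m 0 0 = n" using c consts_ok_n by (simp add: collected_def)
  have "?I (m 0 0) (sem (For 31 0 (For 32 0 collect_step)) m)"
  proof (rule sem_For_induct[where I = ?I])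
    show "?I 0 (upd 31 0 0 m)"
      using c by (simp add: collected_upd irreducibles_upto_simps upd_apply)
    fix w m' assume w: "w < m 0 0" "m' 31 0 = w" and I: "?I w m'"
    let ?J = "\<lambda>j k. collected (irreducibles_upto w j) (w * n + j) k"
    have n': "m' 0 0 = n" using I consts_ok_n by (simp add: collected_def)
    have "?J (m' 0 0) (sem (For 32 0 collect_step) m')"
    proof (rule sem_For_induct[where I = ?J])
      show "?J 0 (upd 32 0 0 m')"
        using I by (simp add: collected_upd upd_apply)
      fix j k assume j: "j < m' 0 0" "k 32 0 = j" and J: "?J j k"
        and fr: "\<And>a. a \<notin> insert 32 (mods collect_step) \<Longrightarrow> k a = m' a"
      have "k 31 = m' 31" by (rule fr) (simp add: mods_collect_step)
      then have "collected (irreducibles_upto w j \<union> {J. least_above (unit w j) J}) (w * n + j + 1) (sem collect_step k)"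
        using j w n n' idx_less[of w n j n] by (intro collect_step_collected[OF J]) simp_all
      then show "?J (Suc j) (upd 32 0 (Suc j) (sem collect_step k))"
        using j w n n' by (simp add: collected_upd irreducibles_upto_simps upd_apply)
    qed (simp_all add: mods_collect_step)
    then show "?I (Suc w) (upd 31 0 (Suc w) (sem (For 32 0 collect_step) m'))"
      by (simp add: collected_upd n' irreducibles_upto_simps upd_apply add.commute)
  qed (simp_all add: mods_collect_step)
  then show ?thesis by (simp add: n irreducibles_upto_simps)
qed

end

section \<open>From the table to the written order matrix\<close>

context common_stable_matchings
begin

lemma bounds_collect: "bounds collect = {0, aK, aSQ}" "counters_safe collect"
  "mods collect = {aP, aFail, aNew, aEq, aTab, aCnt, aM, 20, 21, 22, 23, 24, 25, 26, 31, 32, 33, 34}"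
  by (auto simp: collect_def collect_step_def append_row_def test_new_def)

lemma bounds_write_order: "bounds write_order = {0, aM}" "counters_safe write_order"
  "mods write_order = {aLen, aOut, aEq, 33, 34, 35}"
  by (auto simp: write_order_def write_entry_def)

lemma sem_collect:
  assumes S: "S \<noteq> {}"
  defines "m \<equiv> sem collect m1"
  shows "consts_ok m" "m aBad 0 = 0" "m aM 0 \<le> n * n" "least_above (\<lambda>_. 0) (row m 0)"
    "inj_on (row m) {..m aM 0}" "row m ` {..m aM 0} = insert (row m 0) irreducibles"
proof -
  note ok = prefix_props(1)
  have b: "m1 aBad 0 = 0" using prefix_props(3) S by simp
  have l: "least_above (\<lambda>_. 0) (restr (m1 aQ))" using prefix_props(2)[OF b] .
  have z: "m1 aCnt 0 = 0" using prefix_props(5)[of aCnt] by simp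
  define ma where "ma = sem (append_row aQ) m1"
  have fra: "ma a = m1 a" if "a \<notin> {aTab, aCnt, 33}" for a
    unfolding ma_def by (rule sem_frame) (use that in \<open>simp add: mods_append_row\<close>)
  have oka: "consts_ok ma" using ok consts_ok_cong[of ma m1] by (simp add: fra)
  have "m1 aCnt 0 \<le> n * n + 1" by (simp add: z)
  moreover have "aQ \<noteq> (33::nat)" "aQ \<noteq> aTab" by simp_all
  ultimately have ap: "ma aCnt 0 = 1" "row ma 0 = restr (m1 aQ)"
    using sem_append_row(1,2)[OF ok, of aQ] unfolding ma_def z by simp_all
  have "collected {} 0 ma" using l by (simp add: collected_def oka ap lessThan_Suc)
  note c = collect_loop[OF this]
  define mb where "mb = sem (For 31 0 (For 32 0 collect_step)) ma"
  have c: "collected irreducibles (n * n) mb" using c by (simp add: mb_def)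
  have "mb aBad = ma aBad" unfolding mb_def by (rule sem_frame) (simp add: mods_collect_step)
  then have bad: "mb aBad 0 = 0" by (simp add: fra b)
  have eq: "m = upd aM 0 (mb aCnt 0 - 1) mb"
    by (simp add: m_def collect_def ma_def[symmetric] mb_def[symmetric] bad)
  have "collected irreducibles (n * n) m = collected irreducibles (n * n) mb"
    unfolding eq by (rule collected_cong) (auto simp: upd_apply)
  then have cm: "collected irreducibles (n * n) m" using c by simp
  have M: "m aM 0 = m aCnt 0 - 1" by (simp add: eq upd_apply)
  then have set: "{..<m aCnt 0} = {..m aM 0}" using cm by (auto simp: collected_def)
  show "m aM 0 \<le> n * n" using cm unfolding collected_def M by linarith
  show "consts_ok m" "least_above (\<lambda>_. 0) (row m 0)"
    using cm by (simp_all add: collected_def)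
  show "m aBad 0 = 0" by (simp add: eq upd_apply bad)
  show "inj_on (row m) {..m aM 0}" "row m ` {..m aM 0} = insert (row m 0) irreducibles"
    using cm unfolding collected_def set by simp_all
qed

text \<open>Cells 0 and 1 hold the success flag and the poset size, hence the offset 2; entry
  \<open>t\<close> of the row-major matrix belongs to the pair of quotient and remainder of
  \<open>t\<close>.\<close>

definition order_written :: "memory \<Rightarrow> nat \<Rightarrow> memory \<Rightarrow> bool" where
  "order_written m c m' \<longleftrightarrow> m' aLen 0 = 2 + c \<and> m' aOut 0 = 1 \<and> m' aOut 1 = m aM 0 \<and>
     (\<forall>t<c. m' aOut (2 + t) = of_bool ((t div m aM 0, t mod m aM 0) \<in> row_order (m aM 0) (row m)))"

lemma sem_write_entry:
  assumes ok: "consts_ok m" and M: "m aM 0 \<le> n * n" and rq: "r < m aM 0" "q < m aM 0"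
    and fr: "\<And>a. a \<notin> {aLen, aOut, aEq, 33, 34, 35} \<Longrightarrow> m' a = m a" and v: "m' 34 0 = r" "m' 35 0 = q"
    and w: "order_written m (r * m aM 0 + q) m'"
  shows "order_written m (r * m aM 0 + Suc q) (sem write_entry m')"
proof -
  define e where "e = ELess (tab (Plus (Var 35) (Const 1)) (Var 33)) (tab (Plus (Var 34) (Const 1)) (Var 33))"
  define ma where "ma = upd aEq 0 1 m'"
  define mb where "mb = sem (For 33 0 (FIf e (aEq ::= Const 0) FSkip)) ma"
  have fra: "ma a = m' a" if "a \<noteq> aEq" for a using that by (simp add: ma_def upd_apply)
  have frb: "mb a = m' a" if "a \<notin> {33, aEq}" for a
  proof -
    have "mb a = ma a" unfolding mb_def by (rule sem_frame) (use that in simp)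
    then show ?thesis using that by (simp add: fra)
  qed
  have ma0: "ma 0 0 = n" using consts_ok_n[OF ok] by (simp add: fra fr)
  have "mb aEq 0 = (if \<exists>x<ma 0 0. \<not> row m (Suc r) x \<le> row m (Suc q) x then 0 else ma aEq 0)"
    unfolding mb_def
  proof (rule sem_flag)
    fix x k assume x: "x < ma 0 0" "k 33 0 = x" and fk: "\<And>b. b \<noteq> 33 \<Longrightarrow> b \<noteq> aEq \<Longrightarrow> k b = ma b"
    have fk': "k b = m b" if "b \<notin> {aLen, aOut, aEq, 33, 34, 35}" for b
      using fk[of b] that by (simp add: fra fr)
    have okk: "consts_ok k" using ok consts_ok_cong[of k m] by (simp add: fk')
    have rowk: "row k = row m" by (rule row_cong) (simp add: fk')
    have kv: "k 34 0 = r" "k 35 0 = q" using fk[of 34] fk[of 35] v by (simp_all add: fra)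
    have "Suc r \<le> n * n + 1" "Suc q \<le> n * n + 1" using rq M by simp_all
    then show "val e k \<noteq> 0 \<longleftrightarrow> \<not> row m (Suc r) x \<le> row m (Suc q) x"
      using x ma0 by (simp add: e_def val_tab[OF okk] kv rowk not_le)
  qed simp_all
  moreover have "(\<exists>x<n. \<not> row m (Suc r) x \<le> row m (Suc q) x) \<longleftrightarrow> \<not> row m (Suc r) \<le> row m (Suc q)"
    by (auto simp: le_fun_def row_def)
  ultimately have E: "mb aEq 0 = of_bool ((r, q) \<in> row_order (m aM 0) (row m))"
    using rq by (simp add: ma0 row_order_def) (simp add: ma_def upd_apply)
  define c where "c = r * m aM 0 + q"
  have len: "mb aLen 0 = 2 + c" using w by (simp add: frb order_written_def c_def)
  have eq: "sem write_entry m' = upd aLen 0 (3 + c) (upd aOut (2 + c) (mb aEq 0) mb)"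
  proof -
    have "sem write_entry m' = sem (Asg aOut (Var aLen) (Var aEq) ;; aLen ::= Plus (Var aLen) (Const 1)) mb"
      by (simp add: write_entry_def e_def ma_def mb_def)
    then show ?thesis using len by (simp add: upd_apply eval_nat_numeral)
  qed
  have dm: "c div m aM 0 = r" "c mod m aM 0 = q" using rq(2) by (simp_all add: c_def)
  show ?thesis
    using w unfolding order_written_def eq c_def[symmetric] add_Suc_right
    by (auto simp: upd_apply frb less_Suc_eq E dm)
qed

lemma sem_write_order:
  assumes ok: "consts_ok m" and M: "m aM 0 \<le> n * n" and bad: "m aBad 0 = 0"
  defines "m' \<equiv> sem write_order m"
  shows "map (m' aOut) [0..<m' aLen 0] = 1 # enc_poset (m aM 0) (row_order (m aM 0) (row m))"
    and "m' aLen 0 = 2 + m aM 0 * m aM 0"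
proof -
  define M where "M = m aM 0"
  define ma where "ma = upd aLen 0 2 (upd aOut 1 M (upd aOut 0 1 (upd aLen 0 1 m)))"
  have fra: "ma a = m a" if "a \<notin> {aLen, aOut}" for a using that by (simp add: ma_def upd_apply)
  have eq: "m' = sem (For 34 aM (For 35 aM write_entry)) ma"
    using bad by (simp add: m'_def write_order_def ma_def upd_apply M_def)
  have upd: "order_written m c (upd v i x k) = order_written m c k" if "v \<ge> 20" for c v i x k
    using that by (simp add: order_written_def upd_apply)
  have aM: "ma aM 0 = M" by (simp add: fra M_def)
  have "order_written m (ma aM 0 * M) m'"
    unfolding eq
  proof (rule sem_For_induct[where I = "\<lambda>r k. order_written m (r * M) k"])
    show "order_written m (0 * M) (upd 34 0 0 ma)"
      by (simp add: upd) (simp add: order_written_def ma_def upd_apply M_def)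
    fix r k assume r: "r < ma aM 0" "k 34 0 = r" and I: "order_written m (r * M) k"
      and frk: "\<And>a. a \<notin> insert 34 (mods (For 35 aM write_entry)) \<Longrightarrow> k a = ma a"
    have frk': "k a = m a" if "a \<notin> {aLen, aOut, aEq, 33, 34, 35}" for a
      using frk[of a] that by (simp add: mods_write_entry fra)
    have kM: "k aM 0 = M" by (simp add: frk' M_def)
    have "order_written m (r * M + k aM 0) (sem (For 35 aM write_entry) k)"
    proof (rule sem_For_induct[where I = "\<lambda>q k. order_written m (r * M + q) k"])
      show "order_written m (r * M + 0) (upd 35 0 0 k)" using I by (simp add: upd)
      fix q k' assume q: "q < k aM 0" "k' 35 0 = q" and J: "order_written m (r * M + q) k'"
        and frq: "\<And>a. a \<notin> insert 35 (mods write_entry) \<Longrightarrow> k' a = k a"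
      have "order_written m (r * m aM 0 + Suc q) (sem write_entry k')"
      proof (rule sem_write_entry[OF ok \<open>m aM 0 \<le> n * n\<close>])
        show "r < m aM 0" "q < m aM 0" using r(1) q(1) by (simp_all add: aM kM M_def)
        show "k' 34 0 = r" using frq[of 34] r(2) by (simp add: mods_write_entry)
        show "k' a = m a" if "a \<notin> {aLen, aOut, aEq, 33, 34, 35}" for a
          using frq[of a] that by (simp add: mods_write_entry frk')
      qed (use q J in \<open>simp_all add: M_def\<close>)
      then show "order_written m (r * M + Suc q) (upd 35 0 (Suc q) (sem write_entry k'))"
        by (simp add: upd M_def)
    qed (simp_all add: mods_write_entry)
    then show "order_written m (Suc r * M) (upd 34 0 (Suc r) (sem (For 35 aM write_entry) k))"
      by (simp add: upd kM add.commute)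
  qed (simp_all add: mods_write_entry)
  then have w: "order_written m (M * M) m'" by (simp add: aM)
  then show len: "m' aLen 0 = 2 + m aM 0 * m aM 0" by (simp add: order_written_def M_def)
  show "map (m' aOut) [0..<m' aLen 0] = 1 # enc_poset (m aM 0) (row_order (m aM 0) (row m))"
  proof (rule nth_equalityI)
    show "length (map (m' aOut) [0..<m' aLen 0]) = length (1 # enc_poset (m aM 0) (row_order (m aM 0) (row m)))"
      by (simp add: len enc_poset_def)
    fix i assume "i < length (map (m' aOut) [0..<m' aLen 0])"
    then have i: "i < 2 + M * M" by (simp add: len M_def)
    consider "i = 0" | "i = 1" | t where "i = 2 + t" "t < M * M"
      using i by (metis One_nat_def add_2_eq_Suc less_2_cases nat_add_left_cancel_less not_less le_Suc_ex)
    then show "map (m' aOut) [0..<m' aLen 0] ! i = (1 # enc_poset (m aM 0) (row_order (m aM 0) (row m))) ! i"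
    proof cases
      case 3
      have "m' aOut i = of_bool ((t div M, t mod M) \<in> row_order M (row m))"
        using w 3 by (simp add: order_written_def M_def)
      moreover have "0 < M" using 3(2) by (cases M) simp_all
      ultimately show ?thesis
        using 3 i by (simp add: len enc_poset_def M_def[symmetric] product_nth less_mult_imp_div_less del: upt_Suc)
    qed (use w i in \<open>simp_all add: order_written_def len enc_poset_def M_def del: upt_Suc\<close>)
  qed
qed

lemma order_stages_ok: "stages_ok N [setup1, prefix ;; collect, write_order] init_mem"
proof (rule stages_ok_setup)
  let ?m = "sem collect m1"
  have bad: "?m aBad 0 = m1 aBad 0" by (simp add: sem_frame bounds_collect)
  have "?m aM 0 \<le> N"
  proof (cases "S = {}")
    case True
    then have "m1 aBad 0 \<noteq> 0" using prefix_props(3) by simp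
    define mb where "mb = sem (For 31 0 (For 32 0 collect_step)) (sem (append_row aQ) m1)"
    have "mb aBad 0 \<noteq> 0" using \<open>m1 aBad 0 \<noteq> 0\<close>
      by (simp add: mb_def sem_frame mods_collect_step mods_append_row)
    then show ?thesis by (simp add: collect_def mb_def[symmetric] upd_apply)
  next
    case False
    then show ?thesis using sem_collect(3) N_bounds(1) by fastforce
  qed
  moreover have "?m 0 0 \<le> N"
    using N_bounds(3) consts_ok_n[OF prefix_props(1)] by (simp add: sem_frame bounds_collect)
  ultimately show "stages_ok N [write_order] (sem (prefix ;; collect) (sem setup1 init_mem))"
    by (auto simp: bounds_write_order)
qed (auto simp: bounds_prefix bounds_collect)

lemma order_output:
  assumes "m = fold sem [setup1, prefix ;; collect, write_order] init_mem"
  shows "birkhoff_order_output (n, As) (map (m aOut) [0..<m aLen 0]) \<and> m aLen 0 \<le> 2 + N * N"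
proof -
  define mc where "mc = sem collect m1"
  have m: "m = sem write_order mc" using assms by (simp add: mc_def)
  show ?thesis
  proof (cases "S = {}")
    case True
    then have "mc aBad 0 \<noteq> 0" using prefix_props(3) by (simp add: mc_def sem_frame bounds_collect)
    moreover have "mc aOut = (\<lambda>_. 0)"
      using prefix_props(5)[of aOut] by (simp add: mc_def sem_frame bounds_collect)
    ultimately have "map (m aOut) [0..<m aLen 0] = [0]" "m aLen 0 = 1"
      by (simp_all add: m write_order_def upd_apply)
    then show ?thesis using True common_stable_empty_iff by (simp add: birkhoff_order_output_def Let_def)
  next
    case False
    note c = sem_collect[OF False, folded mc_def]
    note w = sem_write_order[OF c(1,3,2), folded m]
    have "mc aM 0 \<le> N" using c(3) N_bounds(1) by linarith
    then have "mc aM 0 * mc aM 0 \<le> N * N" by (intro mult_mono) auto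
    then show ?thesis
      using birkhoff_order_rows[OF c(4-6)] w False common_stable_empty_iff
      by (auto simp: birkhoff_order_output_def Let_def)
  qed
qed

end

lemma birkhoff_order_solvable:
  "solvable_in_poly_time enc_input same_workers_inputs birkhoff_order_output"
proof (rule solvable_in_poly_timeI[where cs = "[setup1, prefix ;; collect, write_order]" and q = "[:2, 0, 1:]"])
  fix x :: "nat \<times> sm_instance list" assume x: "x \<in> same_workers_inputs"
  obtain n As where x': "x = (n, As)" by fastforce
  interpret common_stable_matchings n As using x x' by unfold_locales simp
  show "stages_ok (input_size (enc_input x)) [setup1, prefix ;; collect, write_order] (mem (initial_state (enc_input x)))"
    using order_stages_ok unfolding x' init_mem_def .
  fix m assume "m = fold sem [setup1, prefix ;; collect, write_order] (mem (initial_state (enc_input x)))"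
  note order_output[OF this[unfolded x', folded init_mem_def]]
  then show "birkhoff_order_output x (map (m aOut) [0..<m aLen 0]) \<and>
      m aLen 0 \<le> poly [:2, 0, 1:] (input_size (enc_input x))"
    unfolding x' by simp
qed

section \<open>Enumeration\<close>

definition write_current :: fcom where
  "write_current = For 33 0 (Asg aOut (Var 33) (wpref_exp (Var 33) (Cell aQ (Var 33))))"

definition try_bump :: fcom where
  "try_bump = For 33 0 (FIf (ELess (Var 33) (Var 31)) (Asg aP (Var 33) (Cell aQ (Var 33)))
       (FIf (EEq (Var 33) (Var 31)) (Asg aP (Var 33) (Plus (Cell aQ (Var 33)) (Const 1)))
         (Asg aP (Var 33) (Const 0)))) ;;
     advance ;; aNew ::= ENot (Var aFail) ;;
     For 33 0 (FIf (EAnd (ELess (Var 33) (Var 31)) (ENot (EEq (Cell aP (Var 33)) (Cell aQ (Var 33)))))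
       (aNew ::= Const 0) FSkip) ;;
     FIf (Var aNew) (copy_arr 33 0 aZ aP ;; aGo ::= Const 1) FSkip"

text \<open>Indices are tried in increasing order and a later success overwrites \<open>aZ\<close>,
  so the candidate with the largest index survives. The separate array keeps \<open>aQ\<close>
  intact as the common reference of all trials. If none succeeds, \<open>aQ\<close> receives stale
  contents, but \<open>aGo\<close> is 0 and the enumeration ends.\<close>

definition next_matching :: fcom where
  "next_matching = aGo ::= Const 0 ;; For 31 0 try_bump ;; copy_arr 33 0 aQ aZ"

definition start_enum :: fcom where
  "start_enum = prefix ;; aGo ::= ENot (Var aBad)"

text \<open>A genuine \<open>While\<close>: the number of matchings may be exponential, so no
  counted loop with a polynomial bound can drive it.\<close>

definition enum_loop :: com where
  "enum_loop = While (Var aGo) (Seq (compile write_current) (Seq (Emit aOut (Var 0)) (compile next_matching)))"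

lemma mods_try_bump:
  "mods try_bump = {aP, aFail, aNew, aZ, aGo, 20, 21, 22, 23, 24, 25, 26, 33}"
  by (auto simp: try_bump_def)

lemma bounds_next_matching: "bounds next_matching = {0, aK, aSQ}" "counters_safe next_matching"
  "mods next_matching = {aP, aFail, aNew, aZ, aGo, aQ, 20, 21, 22, 23, 24, 25, 26, 31, 33}"
  by (auto simp: next_matching_def try_bump_def)

lemma bounds_write_current: "bounds write_current = {0}" "counters_safe write_current"
  "mods write_current = {aOut, 33}"
  by (auto simp: write_current_def)

section \<open>Computing the lexicographic successor\<close>

context common_stable_matchings
begin

lemma sem_try_bump:
  assumes ok: "consts_ok m" and q: "restr (m aQ) \<in> S" and i: "m 31 0 = i" "i < n"
  defines "m' \<equiv> sem try_bump m"
  shows "candidate (restr (m aQ)) i p \<Longrightarrow> m' aGo 0 = 1 \<and> candidate (restr (m aQ)) i (restr (m' aZ))"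
    and "(\<And>p. \<not> candidate (restr (m aQ)) i p) \<Longrightarrow> m' aGo = m aGo \<and> m' aZ = m aZ"
proof -
  let ?q = "restr (m aQ)"
  define c where "c = FIf (ELess (Var 33) (Var 31)) (Asg aP (Var 33) (Cell aQ (Var 33)))
       (FIf (EEq (Var 33) (Var 31)) (Asg aP (Var 33) (Plus (Cell aQ (Var 33)) (Const 1)))
         (Asg aP (Var 33) (Const 0)))"
  define ma where "ma = sem (For 33 0 c) m"
  define mb where "mb = sem advance ma"
  define mc where "mc = upd aNew 0 (val (ENot (Var aFail)) mb) mb"
  define e where "e = EAnd (ELess (Var 33) (Var 31)) (ENot (EEq (Cell aP (Var 33)) (Cell aQ (Var 33))))"
  define md where "md = sem (For 33 0 (FIf e (aNew ::= Const 0) FSkip)) mc"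
  have fra: "ma a = m a" if "a \<notin> {33, aP}" for a
    unfolding ma_def by (rule sem_frame) (use that in \<open>simp add: c_def\<close>)
  have "ma aP = (\<lambda>x. if 0 \<le> x \<and> x < 0 + m 0 0 then bump (m aQ) i (x - 0) else m aP x)"
    unfolding ma_def
  proof (rule sem_fill)
    fix x k assume x: "k 33 0 = x" and f: "\<And>b. b \<notin> insert 33 (mods c) \<Longrightarrow> k b = m b"
    have "k 31 = m 31" "k aQ = m aQ" by (rule f; simp add: c_def)+
    then show "sem c k aP = (k aP)(0 + x := bump (m aQ) i x)"
      using x i by (auto simp: c_def bump_def upd_apply)
  qed (auto simp: c_def)
  then have P: "restr (ma aP) = bump ?q i"
    using consts_ok_n[OF ok] i(2) by (auto simp: restr_def bump_def fun_eq_iff)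
  have le: "ma aP x \<le> n" if "x < n" for x
  proof -
    have "ma aP x = bump ?q i x" using fun_cong[OF P, of x] that by (simp add: restr_def)
    then show ?thesis using SD(1)[OF q that] SD(1)[OF q i(2)] by (simp add: bump_def)
  qed
  have oka: "consts_ok ma" using ok consts_ok_cong[of ma m] by (simp add: fra)
  have frb: "mb a = m a" if "a \<notin> {aP, aFail, 20, 21, 22, 23, 24, 25, 26, 33}" for a
  proof -
    have "mb a = ma a" unfolding mb_def by (rule sem_frame) (use that in simp)
    then show ?thesis using that by (simp add: fra)
  qed
  note adv = sem_advance[OF oka le, folded mb_def, unfolded P]
  have mc0: "mc 0 0 = n" using consts_ok_n[OF ok] by (simp add: mc_def upd_apply frb)
  have "md aNew 0 = (if \<exists>x<mc 0 0. x < i \<and> mb aP x \<noteq> m aQ x then 0 else mc aNew 0)"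
    unfolding md_def
  proof (rule sem_flag)
    fix x k assume x: "k 33 0 = x" and f: "\<And>b. b \<noteq> 33 \<Longrightarrow> b \<noteq> aNew \<Longrightarrow> k b = mc b"
    have "k 31 = m 31" "k aP = mb aP" "k aQ = m aQ"
      using f[of 31] f[of aP] f[of aQ] by (simp_all add: mc_def upd_apply frb)
    then show "val e k \<noteq> 0 \<longleftrightarrow> x < i \<and> mb aP x \<noteq> m aQ x" using x i by (simp add: e_def)
  qed simp_all
  then have new: "md aNew 0 \<noteq> 0 \<longleftrightarrow> mb aFail 0 = 0 \<and> (\<forall>x<i. mb aP x = m aQ x)"
    using i(2) by (auto simp: mc0) (auto simp: mc_def upd_apply ENot_def)
  have frd: "md a = mb a" if "a \<notin> {33, aNew}" for a
  proof -
    have "md a = mc a" unfolding md_def by (rule sem_frame) (use that in simp)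
    then show ?thesis using that by (simp add: mc_def upd_apply)
  qed
  have eq: "m' = (if md aNew 0 \<noteq> 0 then upd aGo 0 1 (sem (copy_arr 33 0 aZ aP) md) else md)"
    by (simp add: m'_def try_bump_def c_def ma_def mb_def mc_def e_def md_def)
  have pre: "(\<forall>x<i. restr (mb aP) x = ?q x) \<longleftrightarrow> (\<forall>x<i. mb aP x = m aQ x)"
    using i(2) by (auto simp: restr_def)
  show "m' aGo 0 = 1 \<and> candidate ?q i (restr (m' aZ))" if p: "candidate ?q i p"
  proof -
    have l: "least_above (bump ?q i) p" using p by (simp add: candidate_def)
    then have F: "mb aFail 0 = 0" using adv(2)[of p] by (auto simp: least_above_def)
    have eqp: "p = restr (mb aP)" using adv(1)[OF _ F] l least_above_unique by blast
    have N: "md aNew 0 \<noteq> 0" using new F p pre unfolding candidate_def eqp by simp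
    have mb0: "mb 0 0 = n" using consts_ok_n[OF ok] by (simp add: frb)
    have "m' aZ = sem (copy_arr 33 0 aZ aP) md aZ" using N by (simp add: eq upd_apply)
    also have "\<dots> = (\<lambda>x. if x < n then mb aP x else md aZ x)"
      by (subst sem_copy_arr) (auto simp: mb0 frd fun_eq_iff)
    finally have "restr (m' aZ) = p" unfolding eqp by (simp add: restr_def fun_eq_iff)
    then show ?thesis using N p by (simp add: eq upd_apply)
  qed
  show "m' aGo = m aGo \<and> m' aZ = m aZ" if none: "\<And>p. \<not> candidate ?q i p"
  proof -
    have "md aNew 0 = 0"
    proof (rule ccontr)
      assume "md aNew 0 \<noteq> 0"
      then have "mb aFail 0 = 0" "\<forall>x<i. mb aP x = m aQ x" using new by simp_all
      then have "candidate ?q i (restr (mb aP))" using adv(1) pre by (simp add: candidate_def)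
      then show False using none by blast
    qed
    then show ?thesis by (simp add: eq frd frb)
  qed
qed

text \<open>This is the recursion behind the enumeration: what is left after \<open>q\<close> is
  either nothing or the successor together with what is left after it.\<close>

lemma sem_next_matching:
  assumes ok: "consts_ok m" and q: "restr (m aQ) \<in> S"
  defines "m' \<equiv> sem next_matching m"
  shows "m' aGo 0 = 0 \<Longrightarrow> {r \<in> S. lex_less (restr (m aQ)) r} = {}"
    and "m' aGo 0 \<noteq> 0 \<Longrightarrow> restr (m' aQ) \<in> S \<and> {r \<in> S. lex_less (restr (m aQ)) r} =
      insert (restr (m' aQ)) {r \<in> S. lex_less (restr (m' aQ)) r}"
proof -
  let ?q = "restr (m aQ)"
  define ma where "ma = upd aGo 0 0 m"
  define mb where "mb = sem (For 31 0 try_bump) ma"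
  have eq: "m' = sem (copy_arr 33 0 aQ aZ) mb"
    by (simp add: m'_def next_matching_def ma_def mb_def)
  have ma0: "ma 0 0 = n" using consts_ok_n[OF ok] by (simp add: ma_def upd_apply)
  let ?none = "\<lambda>i j. \<forall>i'. i \<le> i' \<longrightarrow> i' < j \<longrightarrow> (\<forall>p. \<not> candidate ?q i' p)"
  \<comment> \<open>Once the flag is set, \<open>aZ\<close> holds the candidate of some index
    \<open>i'\<close> and no later index tried so far has one; after the last round this is the
    premise of \<open>lex_successor\<close>.\<close>
  let ?I = "\<lambda>i k. (k aGo 0 = 0 \<and> ?none 0 i) \<or>
    (k aGo 0 \<noteq> 0 \<and> (\<exists>i'<i. candidate ?q i' (restr (k aZ)) \<and> ?none (Suc i') i))"
  have "?I (ma 0 0) mb"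
    unfolding mb_def
  proof (rule sem_For_induct[where I = ?I])
    show "?I 0 (upd 31 0 0 ma)" by (simp add: ma_def upd_apply)
    fix i k assume i: "i < ma 0 0" "k 31 0 = i" and I: "?I i k"
      and f: "\<And>a. a \<notin> insert 31 (mods try_bump) \<Longrightarrow> k a = ma a"
    have fk: "k a = m a" if "a < 6 \<or> a = aQ" for a
    proof -
      have "k a = ma a" by (rule f) (use that in \<open>auto simp: mods_try_bump\<close>)
      then show ?thesis using that by (auto simp: ma_def upd_apply)
    qed
    have okk: "consts_ok k" using ok consts_ok_cong[of k m] fk by blast
    have Qk: "k aQ = m aQ" by (simp add: fk)
    have qk: "restr (k aQ) \<in> S" using q by (simp add: Qk)
    have lt: "i < n" using i(1) ma0 by simp
    note t = sem_try_bump[OF okk qk i(2) lt, unfolded Qk]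
    have "?I (Suc i) (sem try_bump k)"
    proof (cases "\<exists>p. candidate ?q i p")
      case True
      then have c: "sem try_bump k aGo 0 = 1" "candidate ?q i (restr (sem try_bump k aZ))" using t(1) by blast+
      have "\<exists>i'<Suc i. candidate ?q i' (restr (sem try_bump k aZ)) \<and> ?none (Suc i') (Suc i)"
      proof (intro exI conjI)
        show "candidate ?q i (restr (sem try_bump k aZ))" by (rule c(2))
      qed simp_all
      with c(1) show ?thesis by (intro disjI2 conjI) simp
    next
      case False
      then have e: "sem try_bump k aGo = k aGo \<and> sem try_bump k aZ = k aZ" using t(2) by blast
      have n: "?none j (Suc i)" if h: "?none j i" for j
      proof (intro allI impI)
        fix i' p assume i': "j \<le> i'" "i' < Suc i"
        show "\<not> candidate ?q i' p"
        proof (cases "i' = i")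
          case True
          then show ?thesis using \<open>\<not> (\<exists>p. candidate ?q i p)\<close> by blast
        next
          case False
          then have "i' < i" using i'(2) by simp
          then show ?thesis using h i'(1) by blast
        qed
      qed
      show ?thesis
      proof (cases "k aGo 0 = 0")
        case True
        have "?none 0 i"
          using I
        proof (elim disjE conjE)
          assume "k aGo 0 \<noteq> 0"
          with True show ?thesis by contradiction
        qed
        then have "?none 0 (Suc i)" by (rule n)
        moreover have "sem try_bump k aGo 0 = 0" using True e by simp
        ultimately show ?thesis by (intro disjI1 conjI)
      next
        case False
        have "\<exists>i'<i. candidate ?q i' (restr (k aZ)) \<and> ?none (Suc i') i"
          using I
        proof (elim disjE conjE)
          assume "k aGo 0 = 0"
          with False show ?thesis by contradiction
        qed
        then obtain i' where i': "i' < i" "candidate ?q i' (restr (k aZ))" "?none (Suc i') i"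
          by (elim exE conjE)
        have "\<exists>i'<Suc i. candidate ?q i' (restr (sem try_bump k aZ)) \<and> ?none (Suc i') (Suc i)"
        proof (intro exI[of _ i'] conjI)
          show "candidate ?q i' (restr (sem try_bump k aZ))" using i'(2) e by simp
          show "?none (Suc i') (Suc i)" by (rule n[OF i'(3)])
        qed (use i'(1) in simp)
        moreover have "sem try_bump k aGo 0 \<noteq> 0" using False e by simp
        ultimately show ?thesis by (intro disjI2 conjI)
      qed
    qed
    then show "?I (Suc i) (upd 31 0 (Suc i) (sem try_bump k))" by (simp add: upd_apply)
  qed (simp_all add: mods_try_bump)
  then have I: "?I n mb" by (simp only: ma0)
  have go: "m' aGo = mb aGo" by (simp add: eq sem_frame)
  show "{r \<in> S. lex_less ?q r} = {}" if "m' aGo 0 = 0"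
  proof -
    have none: "\<not> candidate ?q i p" if "i < n" for i p using I \<open>m' aGo 0 = 0\<close> that unfolding go by blast
    have False if r: "r \<in> S" "lex_less ?q r" for r
    proof -
      obtain i where i: "i < n" "\<forall>x<i. ?q x = r x" "?q i < r i" using r(2) by (auto simp: lex_less_def)
      show False using lex_less_candidate[OF r(1) i] none[OF i(1)] by blast
    qed
    then show ?thesis by blast
  qed
  show "restr (m' aQ) \<in> S \<and> {r \<in> S. lex_less ?q r} = insert (restr (m' aQ)) {r \<in> S. lex_less (restr (m' aQ)) r}"
    if g: "m' aGo 0 \<noteq> 0"
  proof -
    have "\<exists>i<n. candidate ?q i (restr (mb aZ)) \<and> ?none (Suc i) n"
      using I
    proof (elim disjE conjE)
      assume "mb aGo 0 = 0"
      with g show ?thesis by (simp add: go)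
    qed
    then obtain i where i: "i < n" "candidate ?q i (restr (mb aZ))" "?none (Suc i) n"
      by (elim exE conjE)
    have mb0: "mb 0 0 = n" using consts_ok_n[OF ok] by (simp add: mb_def sem_frame mods_try_bump ma_def upd_apply)
    have "m' aQ = (\<lambda>x. if x < n then mb aZ x else mb aQ x)"
      unfolding eq by (subst sem_copy_arr) (simp_all add: mb0)
    then have Q: "restr (m' aQ) = restr (mb aZ)" by (simp add: restr_def fun_eq_iff)
    have c: "restr (m' aQ) \<in> S" "lex_less ?q (restr (m' aQ))"
      using candidate_lex_less[OF i(2,1)] by (simp_all add: Q)
    have "r = restr (m' aQ) \<or> lex_less (restr (m' aQ)) r" if "r \<in> S" "lex_less ?q r" for r
      unfolding Q by (rule lex_successor[OF i(2,1) _ that]) (use i(3) in \<open>simp add: Suc_le_eq\<close>)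
    moreover have "lex_less ?q r" if "lex_less (restr (m' aQ)) r" for r using lex_less_trans[OF c(2) that] .
    ultimately show ?thesis using c by blast
  qed
qed

end

lemma successively_nth: "successively P xs \<Longrightarrow> Suc i < length xs \<Longrightarrow> P (xs ! i) (xs ! Suc i)"
proof (induction xs arbitrary: i)
  case (Cons x xs)
  then show ?case by (cases i) (auto simp: successively_Cons hd_conv_nth)
qed simp

section \<open>Correctness and delay of the enumeration loop\<close>

context common_stable_matchings
begin

lemma finite_S: "finite S"
proof -
  have "common_stable n As \<subseteq> {M. M permutes {..<n}}"
  proof
    fix M assume "M \<in> common_stable n As"
    then have "stable n (As ! 0) M" using nonempty by (simp add: common_stable_def stable_matchings_def)
    then show "M \<in> {M. M permutes {..<n}}" by (simp add: stable_permutes)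
  qed
  then have "finite (common_stable n As)" by (rule finite_subset) (simp add: finite_permutations)
  then show ?thesis using bij_betw_finite[OF bij_betw_matching] by simp
qed

lemma inj_on_enc: "inj_on (\<lambda>q. enc_matching n (matching q)) S"
proof (rule inj_onI)
  fix p q assume pq: "p \<in> S" "q \<in> S" and eq: "enc_matching n (matching p) = enc_matching n (matching q)"
  have "matching p = matching q"
  proof
    fix w
    have "\<forall>x\<in>{0..<n}. matching p x = matching q x" using eq by (simp add: enc_matching_def)
    then show "matching p w = matching q w" by (cases "w < n") (simp_all add: matching_def)
  qed
  then show "p = q" using bij_betw_matching pq by (auto simp: bij_betw_def inj_on_def)
qed

lemma sem_write_current:
  assumes ok: "consts_ok m" and q: "restr (m aQ) \<in> S"
  shows "map (sem write_current m aOut) [0..<n] = enc_matching n (matching (restr (m aQ)))"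
proof -
  have lt: "m aQ x < n" if "x < n" for x using SD(1)[OF q that] that by (simp add: restr_def)
  define c where "c = Asg aOut (Var 33) (wpref_exp (Var 33) (Cell aQ (Var 33)))"
  have "sem (For 33 0 c) m aOut = (\<lambda>x. if 0 \<le> x \<and> x < 0 + m 0 0 then matching (restr (m aQ)) (x - 0) else m aOut x)"
  proof (rule sem_fill)
    fix i k assume i: "i < m 0 0" and k: "k 33 0 = i" and fr: "\<And>a. a \<notin> insert 33 (mods c) \<Longrightarrow> k a = m a"
    have i': "i < n" using i consts_ok_n[OF ok] by simp
    have fr': "k a = m a" if "a < 6 \<or> a = aQ" for a by (rule fr) (use that in \<open>auto simp: c_def\<close>)
    have okk: "consts_ok k" using ok consts_ok_cong[of k m] fr' by blast
    have Q: "k aQ = m aQ" by (rule fr') simp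
    have "val (wpref_exp (Var 33) (Cell aQ (Var 33))) k = wl i ! m aQ i"
      using lt[OF i'] i' k by (subst val_wpref_exp[OF okk]) (simp_all add: Q)
    then show "sem c k aOut = (k aOut)(0 + i := matching (restr (m aQ)) i)"
      using i' k by (simp add: c_def upd_apply matching_def restr_def)
  qed (simp_all add: c_def)
  then show ?thesis
    by (simp add: write_current_def c_def[symmetric] enc_matching_def consts_ok_n[OF ok])
qed

text \<open>For \<open>n = 0\<close> the predicate \<open>consts_ok\<close> says nothing about
  \<open>aK\<close>, yet \<open>aK\<close> is a loop bound; its bound is therefore carried
  separately.\<close>

definition enum_ready :: "memory \<Rightarrow> bool" where
  "enum_ready m \<longleftrightarrow> consts_ok m \<and> m aK 0 \<le> N"

lemma enum_ready_cong: "(\<And>a. a < 6 \<Longrightarrow> m' a = m a) \<Longrightarrow> enum_ready m' = enum_ready m"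
  using consts_ok_cong[of m' m] by (simp add: enum_ready_def)

lemma enum_ready_bounds: "enum_ready m \<Longrightarrow> b \<in> {0, aK, aSQ} \<Longrightarrow> m b 0 \<le> N"
proof -
  assume r: "enum_ready m" and b: "b \<in> {0, aK, aSQ}"
  have "m 0 0 \<le> N" using consts_ok_n[of m] r N_bounds(3) by (simp add: enum_ready_def)
  moreover have "m aK 0 \<le> N" "m aSQ 0 \<le> N" using r N_bounds(1) by (simp_all add: enum_ready_def consts_ok_def)
  ultimately show ?thesis using b by auto
qed

definition remaining :: "(nat \<Rightarrow> nat) \<Rightarrow> (nat \<Rightarrow> nat) set" where
  "remaining q = {r \<in> S. lex_less q r}"

text \<open>The induction is on the number of matchings still to come. \<open>t0\<close> is the time
  of the previous event and \<open>U\<close> the time that may pass between it and the next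
  evaluation of the guard, so the claim composes: after an item, \<open>next_matching\<close> fits
  into \<open>U\<close>. The 6 pays for the guard and the fixed charge of \<open>Emit\<close>, 3
  each.\<close>

lemma exec_enum_loop:
  fixes U :: nat
  assumes "enum_ready (mem s)" "mem s aGo 0 \<noteq> 0" "restr (mem s aQ) = q" "q \<in> S"
    and U: "time_bound N next_matching \<le> U"
  shows "\<exists>s' os. exec enum_loop s s' \<and> emitted s' = emitted s @ os \<and>
    map snd os \<noteq> [] \<and> distinct (map snd os) \<and>
    set (map snd os) = (\<lambda>q. enc_matching n (matching q)) ` insert q (remaining q) \<and>
    (\<forall>t0. clock s \<le> t0 + U \<longrightarrow>
      successively (\<lambda>a b. b \<le> a + (U + time_bound N write_current + N + 6)) (t0 # map fst os @ [clock s']))"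
  using assms(1-4)
proof (induction "card (remaining q)" arbitrary: s q rule: less_induct)
  case less
  let ?enc = "\<lambda>q. enc_matching n (matching q)"
  let ?D = "U + time_bound N write_current + N + 6"
  have ok: "consts_ok (mem s)" using less.prems(1) by (simp add: enum_ready_def)
  have q: "restr (mem s aQ) \<in> S" using less.prems by simp
  let ?s1 = "tick (1 + cost (Var aGo)) s"
  have "\<exists>t\<le>time_bound N write_current. exec (compile write_current) ?s1
      (?s1\<lparr>mem := sem write_current (mem ?s1), clock := clock ?s1 + t\<rparr>)"
    using N_bounds(3) consts_ok_n[OF ok]
    by (intro exec_compile) (auto simp: bounds_write_current tick_def)
  then obtain t1 where t1: "t1 \<le> time_bound N write_current" and e1: "exec (compile write_current) ?s1
      (?s1\<lparr>mem := sem write_current (mem ?s1), clock := clock ?s1 + t1\<rparr>)" (is "exec _ _ ?s2") by blast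
  have fr2: "mem ?s2 a = mem s a" if "a \<notin> {aOut, 33}" for a
    using that by (simp add: tick_def sem_frame bounds_write_current)
  define ck where "ck = clock s + 3 + t1 + 3 + n"
  define m3 where "m3 = mem ?s2"
  let ?s3 = "s\<lparr>mem := m3, clock := ck, emitted := emitted s @ [(ck, ?enc q)]\<rparr>"
  have "exec (Emit aOut (Var 0)) ?s2 (emit (map (mem ?s2 aOut) [0..<val (Var 0) (mem ?s2)])
      (tick (1 + cost (Var 0) + val (Var 0) (mem ?s2)) ?s2))" by (rule exec.Emit)
  also have "emit (map (mem ?s2 aOut) [0..<val (Var 0) (mem ?s2)])
      (tick (1 + cost (Var 0) + val (Var 0) (mem ?s2)) ?s2) = ?s3"
  proof -
    have "val (Var 0) (mem ?s2) = n" using fr2[of 0] consts_ok_n[OF ok] by simp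
    moreover have "map (mem ?s2 aOut) [0..<n] = ?enc q"
      using sem_write_current[OF ok q] less.prems(3) by (simp add: tick_def)
    ultimately show ?thesis by (simp add: emit_def tick_def ck_def m3_def)
  qed
  finally have e2: "exec (Emit aOut (Var 0)) ?s2 ?s3" .
  have fr3: "m3 a = mem s a" if "a \<notin> {aOut, 33}" for a using fr2[OF that] by (simp add: m3_def)
  have r3: "enum_ready m3" using less.prems(1) enum_ready_cong[of m3 "mem s"] by (simp add: fr3)
  then have ok3: "consts_ok m3" by (simp add: enum_ready_def)
  have Q3: "m3 aQ = mem s aQ" by (simp add: fr3)
  then have q3: "restr (m3 aQ) \<in> S" using q by simp
  have "\<exists>t\<le>time_bound N next_matching. exec (compile next_matching) ?s3
      (?s3\<lparr>mem := sem next_matching (mem ?s3), clock := clock ?s3 + t\<rparr>)"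
    using enum_ready_bounds[OF r3] by (intro exec_compile) (auto simp: bounds_next_matching)
  then obtain t2 where t2: "t2 \<le> time_bound N next_matching"
    and e3: "exec (compile next_matching) ?s3 (?s3\<lparr>mem := sem next_matching (mem ?s3), clock := clock ?s3 + t2\<rparr>)"
      (is "exec _ _ ?s4") by blast
  define m4 where "m4 = sem next_matching m3"
  have s4: "mem ?s4 = m4" "clock ?s4 = ck + t2" "emitted ?s4 = emitted s @ [(ck, ?enc q)]"
    by (simp_all add: m4_def)
  have r4: "enum_ready m4"
    using r3 enum_ready_cong[of m4 m3] by (simp add: m4_def sem_frame bounds_next_matching)
  note nxt = sem_next_matching[OF ok3 q3, folded m4_def, unfolded Q3 less.prems(3), folded remaining_def]
  have body: "exec (Seq (compile write_current) (Seq (Emit aOut (Var 0)) (compile next_matching))) ?s1 ?s4"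
    using exec.Seq[OF e1 exec.Seq[OF e2 e3]] .
  have guard: "val (Var aGo) (mem s) \<noteq> 0" using less.prems(2) by simp
  have loop: "exec enum_loop s s'" if "exec enum_loop ?s4 s'" for s'
    using exec.WhileTrue[OF guard body] that by (simp add: enum_loop_def)
  have ck: "ck \<le> t0 + ?D" if "clock s \<le> t0 + U" for t0
    using that t1 N_bounds(3) by (simp add: ck_def)
  show ?case
  proof (cases "m4 aGo 0 = 0")
    case True
    have "exec enum_loop ?s4 (tick (1 + cost (Var aGo)) ?s4)"
      unfolding enum_loop_def using True s4 by (intro exec.WhileFalse) simp
    note ex = loop[OF this]
    have rem: "remaining q = {}" using nxt(1) True by simp
    show ?thesis
    proof (intro exI[of _ "tick (1 + cost (Var aGo)) ?s4"] exI[of _ "[(ck, ?enc q)]"] conjI allI impI)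
      fix t0 assume "clock s \<le> t0 + U"
      from ck[OF this] show "successively (\<lambda>a b. b \<le> a + ?D) (t0 # map fst [(ck, ?enc q)] @ [clock (tick (1 + cost (Var aGo)) ?s4)])"
        using t2 U by (simp add: tick_def)
    qed (use ex in \<open>simp_all add: tick_def rem\<close>)
  next
    case False
    define q' where "q' = restr (m4 aQ)"
    have q': "q' \<in> S" "remaining q = insert q' (remaining q')"
      using nxt(2) False by (simp_all add: q'_def)
    have "q' \<notin> remaining q'" using lex_less_irrefl by (simp add: remaining_def)
    moreover have fin: "finite (remaining q')" using finite_S by (simp add: remaining_def)
    ultimately have "card (remaining q') < card (remaining q)" by (simp add: q'(2))
    from less.hyps[OF this, of ?s4] obtain s' os where IH: "exec enum_loop ?s4 s'" "emitted s' = emitted ?s4 @ os"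
      "map snd os \<noteq> []" "distinct (map snd os)" "set (map snd os) = ?enc ` insert q' (remaining q')"
      "\<And>t0. clock ?s4 \<le> t0 + U \<Longrightarrow> successively (\<lambda>a b. b \<le> a + ?D) (t0 # map fst os @ [clock s'])"
      using r4 False q'(1) unfolding s4(1) q'_def by blast
    \<comment> \<open>Each vector is lexicographically smaller than all later ones, so no item is
      repeated.\<close>
    have "q \<notin> insert q' (remaining q')" using lex_less_irrefl unfolding q'(2)[symmetric] by (simp add: remaining_def)
    moreover have "insert q (insert q' (remaining q')) \<subseteq> S" using less.prems(4) q'(1) by (auto simp: remaining_def)
    ultimately have new: "?enc q \<notin> set (map snd os)"
      unfolding IH(5) using inj_on_image_mem_iff[OF inj_on_enc, of q "insert q' (remaining q')"] by blast
    show ?thesis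
    proof (intro exI[of _ s'] exI[of _ "(ck, ?enc q) # os"] conjI allI impI)
      show "exec enum_loop s s'" by (rule loop[OF IH(1)])
      show "emitted s' = emitted s @ (ck, ?enc q) # os" using IH(2) s4(3) by simp
      show "set (map snd ((ck, ?enc q) # os)) = ?enc ` insert q (remaining q)"
        using IH(5) by (simp add: q'(2))
      fix t0 assume "clock s \<le> t0 + U"
      from ck[OF this] show "successively (\<lambda>a b. b \<le> a + ?D) (t0 # map fst ((ck, ?enc q) # os) @ [clock s'])"
        using IH(6)[of ck] t2 U s4(2) by (simp add: successively_Cons)
    qed (use IH(4) new in simp_all)
  qed
qed

lemma enum_stages_ok: "stages_ok N [setup1, start_enum] init_mem"
  by (rule stages_ok_setup) (auto simp: start_enum_def bounds_prefix)

lemma enum_runs: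
  "\<exists>os t. runs (Seq (stage_com [setup1, start_enum]) enum_loop) (enc_input (n, As)) os t \<and>
     distinct (map snd os) \<and> set (map snd os) = enc_matching n ` common_stable n As \<and>
     successively (\<lambda>a b. b \<le> a + (stage_time N [setup1, start_enum] + time_bound N next_matching +
       time_bound N write_current + N + 6)) (0 # map fst os @ [t])"
proof -
  let ?s = "initial_state (enc_input (n, As))"
  let ?T = "stage_time N [setup1, start_enum]"
  let ?enc = "\<lambda>q. enc_matching n (matching q)"
  define m where "m = sem start_enum (sem setup1 init_mem)"
  obtain t where t: "t \<le> ?T" and e: "exec (stage_com [setup1, start_enum]) ?s (?s\<lparr>mem := m, clock := clock ?s + t\<rparr>)"
    (is "exec _ _ ?s1")
    using exec_stages[of N "[setup1, start_enum]" ?s] enum_stages_ok unfolding init_mem_def m_def by auto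
  have s1: "mem ?s1 = m" "clock ?s1 = t" "emitted ?s1 = []" by (simp_all add: initial_state_def)
  have m: "m = upd aGo 0 (val (ENot (Var aBad)) m1) m1" by (simp add: m_def start_enum_def)
  have imgs: "?enc ` S = enc_matching n ` common_stable n As"
    using bij_betw_matching unfolding bij_betw_def by (metis image_image)
  show ?thesis
  proof (cases "S = {}")
    case True
    then have "m1 aBad 0 \<noteq> 0" using prefix_props(3) by simp
    then have "m aGo 0 = 0" by (simp add: m upd_apply)
    then have "exec enum_loop ?s1 (tick (1 + cost (Var aGo)) ?s1)"
      unfolding enum_loop_def using s1 by (intro exec.WhileFalse) simp
    from exec.Seq[OF e this] have "runs (Seq (stage_com [setup1, start_enum]) enum_loop) (enc_input (n, As)) [] (t + 3)"
      unfolding runs_def by (intro exI conjI, assumption) (simp_all add: tick_def initial_state_def)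
    then show ?thesis using t True imgs by (intro exI[of _ "[]"] exI[of _ "t + 3"]) simp
  next
    case False
    then have b: "m1 aBad 0 = 0" using prefix_props(3) by simp
    have l: "least_above (\<lambda>_. 0) (restr (m1 aQ))" using prefix_props(2)[OF b] .
    define q where "q = restr (m aQ)"
    have Q: "q = restr (m1 aQ)" by (simp add: q_def m upd_apply)
    have q: "q \<in> S" using l by (simp add: Q least_above_def)
    \<comment> \<open>The bottom vector lies below every element and is therefore lexicographically
      least, so the enumeration starting from it covers all of \<open>S\<close>.\<close>
    have "insert q (remaining q) = S"
    proof -
      have "r = q \<or> lex_less q r" if r: "r \<in> S" for r
      proof -
        have "q \<le> r" using l r by (simp add: Q least_above_def le_fun_def)
        then show ?thesis using le_imp_lex_less[of q r] SD(2)[OF q] SD(2)[OF r] by metis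
      qed
      then show ?thesis using q by (auto simp: remaining_def)
    qed
    have "m1 aK 0 \<le> N"
    proof -
      have "m1 aK = sem setup1 init_mem aK" by (rule sem_frame) (simp add: bounds_prefix)
      then show ?thesis using ready_bounds[of aK] by simp
    qed
    then have "enum_ready m1" using prefix_props(1) by (simp add: enum_ready_def)
    then have r: "enum_ready (mem ?s1)" unfolding s1(1) m
      by (subst enum_ready_cong[of _ m1]) (simp_all add: upd_apply)
    have go: "mem ?s1 aGo 0 \<noteq> 0" unfolding s1(1) m by (simp add: upd_apply b ENot_def)
    \<comment> \<open>A single slack serves both situations: \<open>?T\<close> covers the setup
      before the first item, \<open>time_bound N next_matching\<close> the work between
      items.\<close>
    have U: "time_bound N next_matching \<le> ?T + time_bound N next_matching" by simp
    have Qs1: "restr (mem ?s1 aQ) = q" unfolding s1(1) q_def ..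
    obtain s' os where
      ex: "exec enum_loop ?s1 s'" "emitted s' = emitted ?s1 @ os" "distinct (map snd os)"
      "set (map snd os) = ?enc ` insert q (remaining q)"
      "\<And>t0. clock ?s1 \<le> t0 + (?T + time_bound N next_matching) \<Longrightarrow>
        successively (\<lambda>a b. b \<le> a + (?T + time_bound N next_matching + time_bound N write_current + N + 6))
          (t0 # map fst os @ [clock s'])"
      using exec_enum_loop[OF r go Qs1 q U] by (elim exE conjE) (rule that, assumption+, blast)
    have "runs (Seq (stage_com [setup1, start_enum]) enum_loop) (enc_input (n, As)) os (clock s')"
      unfolding runs_def
    proof (intro exI[of _ s'] conjI)
      show "emitted s' = os" using ex(2) s1(3) by simp
    qed (rule exec.Seq[OF e ex(1)], rule refl)
    moreover have "clock ?s1 \<le> 0 + (?T + time_bound N next_matching)" using t s1(2) by simp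
    note gap = ex(5)[OF this]
    moreover have "set (map snd os) = enc_matching n ` common_stable n As"
      using ex(4) imgs \<open>insert q (remaining q) = S\<close> by simp
    ultimately show ?thesis using ex(3) by (intro exI conjI)
  qed
qed

end

lemma enumerable_common_stable:
  "enumerable_with_poly_delay enc_input same_workers_inputs (\<lambda>(n, As). enc_matching n ` common_stable n As)"
proof -
  obtain p1 :: "nat poly" where p1: "\<forall>N. stage_time N [setup1, start_enum] = poly p1 N"
    using stage_time_poly by blast
  obtain p2 :: "nat poly" where p2: "\<forall>N. time_bound N next_matching = poly p2 N"
    using time_bound_poly by blast
  obtain p3 :: "nat poly" where p3: "\<forall>N. time_bound N write_current = poly p3 N"
    using time_bound_poly by blast
  let ?p = "p1 + p2 + p3 + [:6, 1:]"
  let ?c = "Seq (stage_com [setup1, start_enum]) enum_loop"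
  have "\<exists>os t. runs ?c (enc_input x) os t \<and> distinct (map snd os) \<and>
      set (map snd os) = (\<lambda>(n, As). enc_matching n ` common_stable n As) x \<and>
      (let ts = 0 # map fst os @ [t] in
        \<forall>i. Suc i < length ts \<longrightarrow> ts ! Suc i \<le> ts ! i + poly ?p (input_size (enc_input x)))"
    if x: "x \<in> same_workers_inputs" for x
  proof -
    obtain n As where x': "x = (n, As)" by fastforce
    interpret common_stable_matchings n As using x x' by unfold_locales simp
    have eq: "stage_time N [setup1, start_enum] + time_bound N next_matching + time_bound N write_current + N + 6
        = poly ?p N" by (simp only: p1 p2 p3 poly_add) simp
    obtain os t where os: "runs ?c (enc_input (n, As)) os t" "distinct (map snd os)"
      "set (map snd os) = enc_matching n ` common_stable n As"
      "successively (\<lambda>a b. b \<le> a + poly ?p N) (0 # map fst os @ [t])"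
      using enum_runs unfolding eq by (elim exE conjE)
    have gaps: "(0 # map fst os @ [t]) ! Suc i \<le> (0 # map fst os @ [t]) ! i + poly ?p N"
      if "Suc i < length (0 # map fst os @ [t])" for i
      by (rule successively_nth[OF os(4) that])
    show ?thesis
      unfolding x' prod.case Let_def
    proof (intro exI conjI allI impI)
      show "runs ?c (enc_input (n, As)) os t" by (rule os(1))
    qed (rule os gaps, assumption?)+
  qed
  then show ?thesis
    unfolding enumerable_with_poly_delay_def
    by (intro exI[of _ ?c] exI[of _ ?p] ballI)
qed

theorem theorem9:
  shows "(\<forall>(n, As)\<in>same_workers_inputs. \<forall>A\<in>set As. sublattice n A (common_stable n As)) \<and>
    solvable_in_poly_time enc_input same_workers_inputs worker_optimal_output \<and>
    solvable_in_poly_time enc_input same_workers_inputs firm_optimal_output \<and>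
    solvable_in_poly_time enc_input same_workers_inputs birkhoff_order_output \<and>
    enumerable_with_poly_delay enc_input same_workers_inputs
      (\<lambda>(n, As). enc_matching n ` common_stable n As)"
  using worker_optimal_solvable firm_optimal_solvable birkhoff_order_solvable enumerable_common_stable
  by (auto intro: common_stable_matchings.common_stable_sublattice common_stable_matchings.intro)

end
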